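(* Let $M$ be a complete connected Riemannian manifold and consider the stochastic differential equation $dx_t=X(x_t)\circ dB_t+A(x_t)\,dt$ on $M$. Assume there is a point $\bar x\in M$ with $\xi(\bar x)=\infty$ almost surely. Suppose that for every $K\in K_1^1$ and each $t>0$, $$\liminf_{j\to\infty}\ \sup_{x\in K} E\left(|T_xF_{S_j^K}|\,\chi_{\{S_j^K<t\}}\right)<\infty .$$ Then $\xi^H=\infty$ almost surely for all $H\in K_1^1$. In particular the equation is strongly $1$-complete, and it is strongly complete if the dimension of $M$ is less than or equal to $2$.
   Context: Setting: $B_t$ is an $m$-dimensional Brownian motion on a filtered probability space; $X:\mathbb{R}^m\times M\to TM$ is $C^2$ with $X(x):\mathbb{R}^m\to T_xM$ linear for each $x$; $A$ is a $C^2$ vector field; the equation is a Stratonovich equation. $F_t(x)$, $0\le t<\xi(x)$, denotes the maximal solution starting at $x$ with explosion time $\xi(x)$, always taken to be the partial flow: almost surely, for all $t$, $M_t(\omega)=\{x: t<\xi(x,\omega)\}$ is open, $F_t(\cdot,\omega):M_t(\omega)\to M$ is a $C^1$ diffeomorphism onto an open subset of $M$, continuous in $t$ for $C^1$ convergence on compacta, and for compact $K$ with $\xi^K=\inf_{x\in K}\xi(x)$ one has $\lim_{t\nearrow\xi^K}\sup_{x\in K}d(x_0,F_t(x))=\infty$ almost surely on $\{\xi^K<\infty\}$. $T_xF_t$ is the derivative of $F_t$ at $x$ and $|T_xF_t|$ its operator norm for the Riemannian metric; $\chi$ denotes an indicator function. $K_1^1=\{\mathrm{Image}(\sigma)\mid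 \sigma:[0,\ell]\to M \text{ is } C^1,\ \ell<\infty\}$. Stopping times $S_j^K$: fix a nested sequence of relatively compact open sets $U_i$ covering $M$ with $\overline{U_i}\subset U_{i+1}$, and smooth cut-off functions $\lambda^i$ with $\lambda^i=1$ on $U_{i+1}$ and $\lambda^i=0$ off $U_{i+2}$. Let $F^i_t$ be the (global, smooth) solution flow of the equation with coefficients $\lambda^iX,\lambda^iA$; let $S_i(x)$ be the first exit time of $F^i_t(x)$ from $\overline{U_i}$, and $S_i^K=\inf_{x\in K}S_i(x)$ for compact $K$. Then $F^i_t(x)=F_t(x)$ for $x\in K$ before $S_i^K$, $S_i^K\le\xi^K$, and $\lim_{i\to\infty}S_i^K=\xi^K$. Let $S_p$ be the set of images of all smooth singular $p$-simplices in $M$ (smooth meaning extending smoothly over an open neighbourhood). The equation is strongly $p$-complete if the solution can be chosen jointly continuous in time and space a.s. for all time when restricted to any $K\in S_p$; equivalently $\xi^K=\infty$ a.s. for all $K\in S_p$. It is strongly complete if the solution can be chosen jointly continuous in time and space on all of $M$ for all time, i.e. $\inf_{x\in M}\xi(x)=\infty$ a.s. *)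

theory Defs
  imports "HOL-Probability.Probability"
begin

section \<open>Maps of class $C^k$ between Euclidean spaces\<close>

(* C^k on an open set, by continuity of all iterated partial derivatives up to order k. *)
primrec Ck_on :: "nat \<Rightarrow> ('a::euclidean_space \<Rightarrow> 'b::real_normed_vector) \<Rightarrow> 'a set \<Rightarrow> bool" where
  "Ck_on 0 f S \<longleftrightarrow> continuous_on S f"
| "Ck_on (Suc k) f S \<longleftrightarrow> (\<forall>x\<in>S. f differentiable (at x)) \<and>
     (\<forall>v\<in>Basis. Ck_on k (\<lambda>x. frechet_derivative f (at x) v) S)"

definition smooth_on :: "('a::euclidean_space \<Rightarrow> 'b::real_normed_vector) \<Rightarrow> 'a set \<Rightarrow> bool" where
  "smooth_on f S \<longleftrightarrow> (\<forall>k. Ck_on k f S)"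


section \<open>Smooth manifolds, tangent vectors\<close>

(* The manifold is a whole type, carrying its topology through the type classes
   t2_space and second_countable_topology.  A chart is a pair (domain, coordinate map). *)
type_synonym ('a, 'e) chart = "'a set \<times> ('a \<Rightarrow> 'e)"

abbreviation chart_inv :: "('a, 'e) chart \<Rightarrow> 'e \<Rightarrow> 'a" where
  "chart_inv c \<equiv> inv_into (fst c) (snd c)"

definition smooth_manifold ::
  "('a::{t2_space, second_countable_topology}, 'e::euclidean_space) chart set \<Rightarrow> bool" where
  "smooth_manifold \<A> \<longleftrightarrow>
     (\<Union>c\<in>\<A>. fst c) = UNIV \<and>
     (\<forall>c\<in>\<A>. open (fst c) \<and> open (snd c ` fst c) \<and>
        homeomorphism (fst c) (snd c ` fst c) (snd c) (chart_inv c)) \<and>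
     (\<forall>c\<in>\<A>. \<forall>c'\<in>\<A>. smooth_on (snd c' \<circ> chart_inv c) (snd c ` (fst c \<inter> fst c')))"

(* A tangent vector at x is the family of its coordinate vectors in all charts around x,
   related by the derivatives of the coordinate changes (and 0 for the other charts). *)
type_synonym ('a, 'e) tvec = "('a, 'e) chart \<Rightarrow> 'e"

definition transition_deriv ::
  "('a, 'e::euclidean_space) chart \<Rightarrow> ('a, 'e) chart \<Rightarrow> 'a \<Rightarrow> 'e \<Rightarrow> 'e" where
  "transition_deriv c c' x = frechet_derivative (snd c' \<circ> chart_inv c) (at (snd c x))"

definition tangent_space ::
  "('a, 'e::euclidean_space) chart set \<Rightarrow> 'a \<Rightarrow> ('a, 'e) tvec set" where
  "tangent_space \<A> x =
     {v. (\<forall>c\<in>\<A>. \<forall>c'\<in>\<A>. x \<in> fst c \<and> x \<in> fst c' \<longrightarrow> v c' = transition_deriv c c' x (v c)) \<and>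
         (\<forall>c. \<not> (c \<in> \<A> \<and> x \<in> fst c) \<longrightarrow> v c = 0)}"

(* The tangent vector at x whose coordinates in the chart c are u. *)
definition tvec_of ::
  "('a, 'e::euclidean_space) chart set \<Rightarrow> ('a, 'e) chart \<Rightarrow> 'a \<Rightarrow> 'e \<Rightarrow> ('a, 'e) tvec" where
  "tvec_of \<A> c x u = (\<lambda>c'. if c' \<in> \<A> \<and> x \<in> fst c' then transition_deriv c c' x u else 0)"

definition chart_at :: "('a, 'e) chart set \<Rightarrow> 'a \<Rightarrow> ('a, 'e) chart" where
  "chart_at \<A> x = (SOME c. c \<in> \<A> \<and> x \<in> fst c)"

definition Ck_map_on ::
  "nat \<Rightarrow> ('a::topological_space, 'e::euclidean_space) chart set \<Rightarrow> ('a \<Rightarrow> 'a) \<Rightarrow> 'a set \<Rightarrow> bool" where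
  "Ck_map_on k \<A> f W \<longleftrightarrow> continuous_on W f \<and>
     (\<forall>c\<in>\<A>. \<forall>c'\<in>\<A>. Ck_on k (snd c' \<circ> f \<circ> chart_inv c) (snd c ` (fst c \<inter> W \<inter> f -` fst c')))"

definition C1_diffeo_onto_open ::
  "('a::topological_space, 'e::euclidean_space) chart set \<Rightarrow> ('a \<Rightarrow> 'a) \<Rightarrow> 'a set \<Rightarrow> bool" where
  "C1_diffeo_onto_open \<A> f W \<longleftrightarrow>
     inj_on f W \<and> open (f ` W) \<and> Ck_map_on 1 \<A> f W \<and> Ck_map_on 1 \<A> (inv_into W f) (f ` W)"

definition smooth_real ::
  "('a, 'e::euclidean_space) chart set \<Rightarrow> ('a \<Rightarrow> real) \<Rightarrow> bool" where
  "smooth_real \<A> f \<longleftrightarrow> (\<forall>c\<in>\<A>. smooth_on (f \<circ> chart_inv c) (snd c ` fst c))"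

definition test_function ::
  "('a::topological_space, 'e::euclidean_space) chart set \<Rightarrow> ('a \<Rightarrow> real) \<Rightarrow> bool" where
  "test_function \<A> f \<longleftrightarrow> smooth_real \<A> f \<and> (\<exists>K. compact K \<and> (\<forall>x. x \<notin> K \<longrightarrow> f x = 0))"

(* df(v) for v tangent at x *)
definition dir_deriv ::
  "('a, 'e::euclidean_space) chart set \<Rightarrow> ('a \<Rightarrow> real) \<Rightarrow> 'a \<Rightarrow> ('a, 'e) tvec \<Rightarrow> real" where
  "dir_deriv \<A> f x v =
     (let c = chart_at \<A> x in frechet_derivative (f \<circ> chart_inv c) (at (snd c x)) (v c))"

(* T_x f *)
definition tangent_map ::
  "('a, 'e::euclidean_space) chart set \<Rightarrow> ('a \<Rightarrow> 'a) \<Rightarrow> 'a \<Rightarrow> ('a, 'e) tvec \<Rightarrow> ('a, 'e) tvec" where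
  "tangent_map \<A> f x v = (\<lambda>c'. if c' \<in> \<A> \<and> f x \<in> fst c'
     then let c = chart_at \<A> x
          in frechet_derivative (snd c' \<circ> f \<circ> chart_inv c) (at (snd c x)) (v c)
     else 0)"


section \<open>Riemannian metrics\<close>

type_synonym ('a, 'e) metric = "'a \<Rightarrow> ('a, 'e) tvec \<Rightarrow> ('a, 'e) tvec \<Rightarrow> real"

definition riemannian_metric ::
  "('a, 'e::euclidean_space) chart set \<Rightarrow> ('a, 'e) metric \<Rightarrow> bool" where
  "riemannian_metric \<A> g \<longleftrightarrow>
     (\<forall>x. \<forall>u\<in>tangent_space \<A> x. \<forall>v\<in>tangent_space \<A> x. g x u v = g x v u) \<and>
     (\<forall>x. \<forall>u\<in>tangent_space \<A> x. \<forall>v\<in>tangent_space \<A> x. \<forall>w\<in>tangent_space \<A> x. \<forall>a b.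
        g x (\<lambda>c. a *\<^sub>R u c + b *\<^sub>R v c) w = a * g x u w + b * g x v w) \<and>
     (\<forall>x. \<forall>u\<in>tangent_space \<A> x. u \<noteq> (\<lambda>c. 0) \<longrightarrow> 0 < g x u u) \<and>
     (\<forall>c\<in>\<A>. \<forall>u v. smooth_on
        (\<lambda>p. g (chart_inv c p) (tvec_of \<A> c (chart_inv c p) u) (tvec_of \<A> c (chart_inv c p) v))
        (snd c ` fst c))"

definition gnorm :: "('a, 'e) metric \<Rightarrow> 'a \<Rightarrow> ('a, 'e) tvec \<Rightarrow> real" where
  "gnorm g x v = sqrt (g x v v)"

(* sigma is a C^1 curve on [0,l] (one-sided derivatives at the end points) with velocity v *)
definition C1_curve ::
  "('a::topological_space, 'e::euclidean_space) chart set \<Rightarrow> real \<Rightarrow> (real \<Rightarrow> 'a) \<Rightarrow>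
     (real \<Rightarrow> ('a, 'e) tvec) \<Rightarrow> bool" where
  "C1_curve \<A> l \<sigma> v \<longleftrightarrow> 0 < l \<and> continuous_on {0..l} \<sigma> \<and>
     (\<forall>t\<in>{0..l}. v t \<in> tangent_space \<A> (\<sigma> t)) \<and>
     (\<forall>c\<in>\<A>. \<forall>t\<in>{0..l}. \<sigma> t \<in> fst c \<longrightarrow>
        ((snd c \<circ> \<sigma>) has_vector_derivative v t c) (at t within {0..l})) \<and>
     (\<forall>c\<in>\<A>. continuous_on {t\<in>{0..l}. \<sigma> t \<in> fst c} (\<lambda>t. v t c))"

(* x and y are joined by a piecewise C^1 curve of the given length *)
inductive joined_by_length ::
  "('a::topological_space, 'e::euclidean_space) chart set \<Rightarrow> ('a, 'e) metric \<Rightarrow>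
     'a \<Rightarrow> 'a \<Rightarrow> real \<Rightarrow> bool" for \<A> g where
  "C1_curve \<A> l \<sigma> v \<Longrightarrow>
     joined_by_length \<A> g (\<sigma> 0) (\<sigma> l) (integral {0..l} (\<lambda>t. gnorm g (\<sigma> t) (v t)))"
| "joined_by_length \<A> g x y L \<Longrightarrow> joined_by_length \<A> g y z L' \<Longrightarrow>
     joined_by_length \<A> g x z (L + L')"

definition rdist ::
  "('a::topological_space, 'e::euclidean_space) chart set \<Rightarrow> ('a, 'e) metric \<Rightarrow> 'a \<Rightarrow> 'a \<Rightarrow> real" where
  "rdist \<A> g x y = Inf {L. joined_by_length \<A> g x y L}"

definition riemannian_complete ::
  "('a::topological_space, 'e::euclidean_space) chart set \<Rightarrow> ('a, 'e) metric \<Rightarrow> bool" where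
  "riemannian_complete \<A> g \<longleftrightarrow>
     (\<forall>u :: nat \<Rightarrow> 'a. (\<forall>\<epsilon>>0. \<exists>N. \<forall>m\<ge>N. \<forall>n\<ge>N. rdist \<A> g (u m) (u n) < \<epsilon>) \<longrightarrow> (\<exists>x. u \<longlonglongrightarrow> x))"

(* operator norm of T_x f *)
definition tangent_opnorm ::
  "('a, 'e::euclidean_space) chart set \<Rightarrow> ('a, 'e) metric \<Rightarrow> ('a \<Rightarrow> 'a) \<Rightarrow> 'a \<Rightarrow> real" where
  "tangent_opnorm \<A> g f x =
     (SUP v\<in>{v\<in>tangent_space \<A> x. gnorm g x v \<le> 1}. gnorm g (f x) (tangent_map \<A> f x v))"

definition K11 ::
  "('a::topological_space, 'e::euclidean_space) chart set \<Rightarrow> 'a set set" where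
  "K11 \<A> = {\<sigma> ` {0..l} | \<sigma> l. \<exists>v. C1_curve \<A> l \<sigma> v}"

(* Images of smooth singular p-simplices.  The type 'p stands for R^p, and the standard
   p-simplex is realised as the convex hull of 0 and the standard basis of R^p. *)
definition smooth_simplices ::
  "'p::euclidean_space itself \<Rightarrow> ('a::topological_space, 'e::euclidean_space) chart set \<Rightarrow> 'a set set" where
  "smooth_simplices p \<A> = {\<sigma> ` (convex hull (insert 0 (Basis :: 'p set))) | \<sigma>.
     \<exists>W. open W \<and> convex hull (insert 0 (Basis :: 'p set)) \<subseteq> W \<and> continuous_on W \<sigma> \<and>
         (\<forall>c\<in>\<A>. smooth_on (snd c \<circ> \<sigma>) (W \<inter> \<sigma> -` fst c))}"


section \<open>Filtered probability spaces, Brownian motion, semimartingales\<close>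

(* Time is {0..}; the values at negative times of families indexed by real are irrelevant. *)

definition filtered_prob_space :: "'w measure \<Rightarrow> (real \<Rightarrow> 'w measure) \<Rightarrow> bool" where
  "filtered_prob_space P \<F> \<longleftrightarrow> prob_space P \<and> (\<forall>t\<ge>0. subalgebra P (\<F> t)) \<and>
     (\<forall>s t. 0 \<le> s \<and> s \<le> t \<longrightarrow> sets (\<F> s) \<subseteq> sets (\<F> t))"

(* The usual augmentation.  The usual conditions are not imposed on the given filtration;
   instead, adaptedness and stopping times below refer to its augmentation (under the usual
   conditions this is the given filtration). *)
definition augment :: "'w measure \<Rightarrow> (real \<Rightarrow> 'w measure) \<Rightarrow> real \<Rightarrow> 'w measure" where
  "augment P \<F> t =
     sigma (space P) (\<Inter>s\<in>{t<..}. sigma_sets (space P) (sets (\<F> s) \<union> null_sets P))"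

definition brownian_motion ::
  "'w measure \<Rightarrow> (real \<Rightarrow> 'w measure) \<Rightarrow> (real \<Rightarrow> 'w \<Rightarrow> real ^ 'm) \<Rightarrow> bool" where
  "brownian_motion P \<F> B \<longleftrightarrow>
     (\<forall>t\<ge>0. B t \<in> borel_measurable (\<F> t)) \<and>
     (AE \<omega> in P. B 0 \<omega> = 0 \<and> continuous_on {0..} (\<lambda>t. B t \<omega>)) \<and>
     (\<forall>s t. 0 \<le> s \<and> s < t \<longrightarrow>
        prob_space.indep_set P (sets (\<F> s))
          {(\<lambda>\<omega>. B t \<omega> - B s \<omega>) -` S \<inter> space P | S. S \<in> sets borel} \<and>
        distributed P lborel (\<lambda>\<omega>. B t \<omega> - B s \<omega>)
          (\<lambda>y. ennreal (\<Prod>i\<in>UNIV. normal_density 0 (sqrt (t - s)) (y $ i))))"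

definition stop_time :: "'w measure \<Rightarrow> (real \<Rightarrow> 'w measure) \<Rightarrow> ('w \<Rightarrow> ereal) \<Rightarrow> bool" where
  "stop_time P \<F> \<tau> \<longleftrightarrow> (\<forall>\<omega>\<in>space P. 0 \<le> \<tau> \<omega>) \<and>
     (\<forall>t\<ge>0. {\<omega>\<in>space P. \<tau> \<omega> \<le> ereal t} \<in> sets (\<F> t))"

definition continuous_adapted ::
  "'w measure \<Rightarrow> (real \<Rightarrow> 'w measure) \<Rightarrow> (real \<Rightarrow> 'w \<Rightarrow> real) \<Rightarrow> bool" where
  "continuous_adapted P \<F> N \<longleftrightarrow> (\<forall>t\<ge>0. N t \<in> borel_measurable (\<F> t)) \<and>
     (AE \<omega> in P. continuous_on {0..} (\<lambda>t. N t \<omega>))"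

definition is_martingale ::
  "'w measure \<Rightarrow> (real \<Rightarrow> 'w measure) \<Rightarrow> (real \<Rightarrow> 'w \<Rightarrow> real) \<Rightarrow> bool" where
  "is_martingale P \<F> N \<longleftrightarrow> (\<forall>t\<ge>0. N t \<in> borel_measurable (\<F> t) \<and> integrable P (N t)) \<and>
     (\<forall>s t. 0 \<le> s \<and> s \<le> t \<longrightarrow> (AE \<omega> in P. real_cond_exp P (\<F> s) (N t) \<omega> = N s \<omega>))"

definition continuous_local_martingale ::
  "'w measure \<Rightarrow> (real \<Rightarrow> 'w measure) \<Rightarrow> (real \<Rightarrow> 'w \<Rightarrow> real) \<Rightarrow> bool" where
  "continuous_local_martingale P \<F> N \<longleftrightarrow> continuous_adapted P \<F> N \<and>
     (\<exists>\<tau> :: nat \<Rightarrow> 'w \<Rightarrow> real.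
        (\<forall>n. stop_time P \<F> (\<lambda>\<omega>. ereal (\<tau> n \<omega>))) \<and>
        (AE \<omega> in P. incseq (\<lambda>n. \<tau> n \<omega>) \<and> filterlim (\<lambda>n. \<tau> n \<omega>) at_top sequentially) \<and>
        (\<forall>n. is_martingale P \<F> (\<lambda>t \<omega>. N (min t (\<tau> n \<omega>)) \<omega> - N 0 \<omega>)))"

definition continuous_finite_variation ::
  "'w measure \<Rightarrow> (real \<Rightarrow> 'w measure) \<Rightarrow> (real \<Rightarrow> 'w \<Rightarrow> real) \<Rightarrow> bool" where
  "continuous_finite_variation P \<F> V \<longleftrightarrow> continuous_adapted P \<F> V \<and>
     (AE \<omega> in P. \<forall>T\<ge>0. \<exists>C. \<forall>n (s :: nat \<Rightarrow> real). mono s \<and> range s \<subseteq> {0..T} \<longrightarrow>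
        (\<Sum>i<n. \<bar>V (s (Suc i)) \<omega> - V (s i) \<omega>\<bar>) \<le> C)"

definition continuous_semimartingale ::
  "'w measure \<Rightarrow> (real \<Rightarrow> 'w measure) \<Rightarrow> (real \<Rightarrow> 'w \<Rightarrow> real) \<Rightarrow> bool" where
  "continuous_semimartingale P \<F> Z \<longleftrightarrow> (\<exists>N V. continuous_local_martingale P \<F> N \<and>
     continuous_finite_variation P \<F> V \<and> (\<forall>t\<ge>0. \<forall>\<omega>\<in>space P. Z t \<omega> = N t \<omega> + V t \<omega>))"


section \<open>Stratonovich equations\<close>

definition partition_of :: "real \<Rightarrow> nat \<Rightarrow> (nat \<Rightarrow> real) \<Rightarrow> bool" where
  "partition_of T n s \<longleftrightarrow> s 0 = 0 \<and> s n = T \<and> (\<forall>i<n. s i < s (Suc i))"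

definition trapezoid_sum ::
  "nat \<Rightarrow> (nat \<Rightarrow> real) \<Rightarrow> (real \<Rightarrow> 'w \<Rightarrow> real) \<Rightarrow> (real \<Rightarrow> 'w \<Rightarrow> real) \<Rightarrow> real \<Rightarrow> 'w \<Rightarrow> real" where
  "trapezoid_sum n s Y b t \<omega> =
     (\<Sum>i<n. (Y (min (s i) t) \<omega> + Y (min (s (Suc i)) t) \<omega>) / 2 *
             (b (min (s (Suc i)) t) \<omega> - b (min (s i) t) \<omega>))"

(* I is the Stratonovich integral of Y against b on [0,zeta): the limit of the trapezoidal
   sums, uniformly on compact time intervals in probability, as the mesh tends to 0.
   Measurability of the exceptional events is not presupposed: smallness is required of
   their outer probability.  Only the values of Y and b before zeta enter. *)
definition stratonovich_integral ::
  "'w measure \<Rightarrow> ('w \<Rightarrow> ereal) \<Rightarrow> (real \<Rightarrow> 'w \<Rightarrow> real) \<Rightarrow> (real \<Rightarrow> 'w \<Rightarrow> real) \<Rightarrow>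
     (real \<Rightarrow> 'w \<Rightarrow> real) \<Rightarrow> bool" where
  "stratonovich_integral P \<zeta> Y b I \<longleftrightarrow>
     (\<forall>T>0. \<forall>\<epsilon>>0. \<forall>\<delta>>0. \<exists>\<eta>>0. \<forall>n s.
        partition_of T n s \<and> (\<forall>i<n. s (Suc i) - s i < \<eta>) \<longrightarrow>
        (\<exists>N\<in>sets P. measure P N < \<delta> \<and>
           {\<omega>\<in>space P. \<exists>t. 0 \<le> t \<and> t \<le> T \<and> ereal t < \<zeta> \<omega> \<and>
              \<epsilon> < \<bar>trapezoid_sum n s Y b t \<omega> - I t \<omega>\<bar>} \<subseteq> N))"

type_synonym ('a, 'e, 'm) noise_field = "'a \<Rightarrow> real ^ 'm \<Rightarrow> ('a, 'e) tvec"
type_synonym ('a, 'e) field = "'a \<Rightarrow> ('a, 'e) tvec"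

(* X(x) maps R^m linearly into T_x M, and X : R^m x M -> TM and A : M -> TM are C^2 *)
definition C2_coefficients ::
  "('a, 'e::euclidean_space) chart set \<Rightarrow> ('a, 'e, 'm::finite) noise_field \<Rightarrow> ('a, 'e) field \<Rightarrow> bool" where
  "C2_coefficients \<A> X A \<longleftrightarrow>
     (\<forall>x e. X x e \<in> tangent_space \<A> x) \<and> (\<forall>x c. linear (\<lambda>e. X x e c)) \<and>
     (\<forall>x. A x \<in> tangent_space \<A> x) \<and>
     (\<forall>c\<in>\<A>. Ck_on 2 (\<lambda>(e, p). X (chart_inv c p) e c) (UNIV \<times> snd c ` fst c)) \<and>
     (\<forall>c\<in>\<A>. Ck_on 2 (\<lambda>p. A (chart_inv c p) c) (snd c ` fst c))"

(* A continuous adapted process y on [0,zeta) starting at x which solves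
   dy = X(y) o dB + A(y) dt: for all smooth compactly supported f, f(y) is a semimartingale
   and f(y_t) = f(x) + sum_k int_0^t df(X(y_s) e_k) o dB^k_s + int_0^t df(A(y_s)) ds. *)
definition local_solution ::
  "('a::topological_space, 'e::euclidean_space) chart set \<Rightarrow>
     'w measure \<Rightarrow> (real \<Rightarrow> 'w measure) \<Rightarrow> (real \<Rightarrow> 'w \<Rightarrow> real ^ 'm) \<Rightarrow>
     ('a, 'e, 'm::finite) noise_field \<Rightarrow> ('a, 'e) field \<Rightarrow>
     'a \<Rightarrow> (real \<Rightarrow> 'w \<Rightarrow> 'a) \<Rightarrow> ('w \<Rightarrow> ereal) \<Rightarrow> bool" where
  "local_solution \<A> P \<F> B X A x y \<zeta> \<longleftrightarrow>
     stop_time P (augment P \<F>) \<zeta> \<and>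
     (\<forall>t\<ge>0. \<forall>G. open G \<longrightarrow> {\<omega>\<in>space P. ereal t < \<zeta> \<omega> \<and> y t \<omega> \<in> G} \<in> sets (augment P \<F> t)) \<and>
     (AE \<omega> in P. continuous_on {t. 0 \<le> t \<and> ereal t < \<zeta> \<omega>} (\<lambda>t. y t \<omega>) \<and>
        (0 < \<zeta> \<omega> \<longrightarrow> y 0 \<omega> = x)) \<and>
     (\<forall>f. test_function \<A> f \<longrightarrow>
        (\<exists>Z. continuous_semimartingale P (augment P \<F>) Z \<and>
           (AE \<omega> in P. \<forall>t. 0 \<le> t \<and> ereal t < \<zeta> \<omega> \<longrightarrow> f (y t \<omega>) = Z t \<omega>)) \<and>
        (\<exists>I :: 'm \<Rightarrow> real \<Rightarrow> 'w \<Rightarrow> real.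
           (\<forall>k. stratonovich_integral P \<zeta>
              (\<lambda>s \<omega>. dir_deriv \<A> f (y s \<omega>) (X (y s \<omega>) (axis k 1))) (\<lambda>s \<omega>. B s \<omega> $ k) (I k)) \<and>
           (AE \<omega> in P. \<forall>t. 0 \<le> t \<and> ereal t < \<zeta> \<omega> \<longrightarrow>
              f (y t \<omega>) = f x + (\<Sum>k\<in>UNIV. I k t \<omega>) +
                integral {0..t} (\<lambda>s. dir_deriv \<A> f (y s \<omega>) (A (y s \<omega>))))))"

(* The maximal solution from x: every solution from x is, almost surely, a restriction of it. *)
definition maximal_solution ::
  "('a::topological_space, 'e::euclidean_space) chart set \<Rightarrow>
     'w measure \<Rightarrow> (real \<Rightarrow> 'w measure) \<Rightarrow> (real \<Rightarrow> 'w \<Rightarrow> real ^ 'm) \<Rightarrow>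
     ('a, 'e, 'm::finite) noise_field \<Rightarrow> ('a, 'e) field \<Rightarrow>
     'a \<Rightarrow> (real \<Rightarrow> 'w \<Rightarrow> 'a) \<Rightarrow> ('w \<Rightarrow> ereal) \<Rightarrow> bool" where
  "maximal_solution \<A> P \<F> B X A x y \<xi> \<longleftrightarrow>
     local_solution \<A> P \<F> B X A x y \<xi> \<and>
     (\<forall>y' \<zeta>. local_solution \<A> P \<F> B X A x y' \<zeta> \<longrightarrow>
        (AE \<omega> in P. \<zeta> \<omega> \<le> \<xi> \<omega> \<and> (\<forall>t. 0 \<le> t \<and> ereal t < \<zeta> \<omega> \<longrightarrow> y' t \<omega> = y t \<omega>)))"


section \<open>Partial flows\<close>

definition flow_dom :: "('a \<Rightarrow> 'w \<Rightarrow> ereal) \<Rightarrow> real \<Rightarrow> 'w \<Rightarrow> 'a set" where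
  "flow_dom \<xi> t \<omega> = {x. ereal t < \<xi> x \<omega>}"

(* xi^K *)
definition inf_time :: "('a \<Rightarrow> 'w \<Rightarrow> ereal) \<Rightarrow> 'a set \<Rightarrow> 'w \<Rightarrow> ereal" where
  "inf_time \<xi> K \<omega> = (INF x\<in>K. \<xi> x \<omega>)"

(* Continuity at time t, for C^1 convergence on compacta, of the maps f s with domains D s:
   for compact K in a chart with image under f t in a chart, f s is eventually defined on K
   with image in the latter chart, and tends to f t uniformly on K with its first derivative. *)
definition C1_compact_continuous_at ::
  "('a::topological_space, 'e::euclidean_space) chart set \<Rightarrow>
     (real \<Rightarrow> 'a \<Rightarrow> 'a) \<Rightarrow> (real \<Rightarrow> 'a set) \<Rightarrow> real \<Rightarrow> bool" where
  "C1_compact_continuous_at \<A> f D t \<longleftrightarrow>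
     (\<forall>c\<in>\<A>. \<forall>c'\<in>\<A>. \<forall>K. compact K \<and> K \<subseteq> fst c \<inter> D t \<and> f t ` K \<subseteq> fst c' \<longrightarrow>
        (\<forall>\<epsilon>>0. \<forall>\<^sub>F s in at t within {0..}.
           K \<subseteq> D s \<and> f s ` K \<subseteq> fst c' \<and>
           (\<forall>x\<in>K. dist (snd c' (f s x)) (snd c' (f t x)) < \<epsilon> \<and>
              onorm (\<lambda>v. frechet_derivative (snd c' \<circ> f s \<circ> chart_inv c) (at (snd c x)) v -
                         frechet_derivative (snd c' \<circ> f t \<circ> chart_inv c) (at (snd c x)) v) < \<epsilon>)))"

(* F is the partial solution flow with explosion times xi. *)
definition partial_flow ::
  "('a::topological_space, 'e::euclidean_space) chart set \<Rightarrow> ('a, 'e) metric \<Rightarrow>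
     'w measure \<Rightarrow> (real \<Rightarrow> 'w measure) \<Rightarrow> (real \<Rightarrow> 'w \<Rightarrow> real ^ 'm) \<Rightarrow>
     ('a, 'e, 'm::finite) noise_field \<Rightarrow> ('a, 'e) field \<Rightarrow>
     (real \<Rightarrow> 'a \<Rightarrow> 'w \<Rightarrow> 'a) \<Rightarrow> ('a \<Rightarrow> 'w \<Rightarrow> ereal) \<Rightarrow> bool" where
  "partial_flow \<A> g P \<F> B X A F \<xi> \<longleftrightarrow>
     (\<forall>x. maximal_solution \<A> P \<F> B X A x (\<lambda>t. F t x) (\<xi> x)) \<and>
     (AE \<omega> in P.
        (\<forall>x. 0 < \<xi> x \<omega> \<and> F 0 x \<omega> = x) \<and>
        (\<forall>t\<ge>0. open (flow_dom \<xi> t \<omega>) \<and>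
           C1_diffeo_onto_open \<A> (\<lambda>x. F t x \<omega>) (flow_dom \<xi> t \<omega>) \<and>
           C1_compact_continuous_at \<A> (\<lambda>s x. F s x \<omega>) (\<lambda>s. flow_dom \<xi> s \<omega>) t)) \<and>
     (\<forall>K x0. compact K \<longrightarrow>
        (AE \<omega> in P. inf_time \<xi> K \<omega> < \<infinity> \<longrightarrow>
           ((\<lambda>t. SUP x\<in>K. ereal (rdist \<A> g x0 (F t x \<omega>))) \<longlongrightarrow> \<infinity>)
             (at_left (real_of_ereal (inf_time \<xi> K \<omega>)))))"


section \<open>The stopping times $S_j^K$\<close>

(* The global flow Fi i of the cut-off equation is its partial flow with infinite lifetime. *)
definition cutoff_system ::
  "('a::topological_space, 'e::euclidean_space) chart set \<Rightarrow> ('a, 'e) metric \<Rightarrow>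
     'w measure \<Rightarrow> (real \<Rightarrow> 'w measure) \<Rightarrow> (real \<Rightarrow> 'w \<Rightarrow> real ^ 'm) \<Rightarrow>
     ('a, 'e, 'm::finite) noise_field \<Rightarrow> ('a, 'e) field \<Rightarrow>
     (nat \<Rightarrow> 'a set) \<Rightarrow> (nat \<Rightarrow> 'a \<Rightarrow> real) \<Rightarrow> (nat \<Rightarrow> real \<Rightarrow> 'a \<Rightarrow> 'w \<Rightarrow> 'a) \<Rightarrow> bool" where
  "cutoff_system \<A> g P \<F> B X A U lam Fi \<longleftrightarrow>
     (\<forall>i. open (U i) \<and> compact (closure (U i)) \<and> closure (U i) \<subseteq> U (Suc i)) \<and>
     (\<Union>i. U i) = UNIV \<and>
     (\<forall>i. smooth_real \<A> (lam i) \<and> (\<forall>x\<in>U (i + 1). lam i x = 1) \<and>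
        (\<forall>x. x \<notin> U (i + 2) \<longrightarrow> lam i x = 0)) \<and>
     (\<forall>i. partial_flow \<A> g P \<F> B
        (\<lambda>x e c. lam i x *\<^sub>R X x e c) (\<lambda>x c. lam i x *\<^sub>R A x c) (Fi i) (\<lambda>x \<omega>. \<infinity>))"

(* S_i(x); the infimum of the empty set is infinity *)
definition exit_time ::
  "(nat \<Rightarrow> 'a::topological_space set) \<Rightarrow> (nat \<Rightarrow> real \<Rightarrow> 'a \<Rightarrow> 'w \<Rightarrow> 'a) \<Rightarrow> nat \<Rightarrow>
     'a \<Rightarrow> 'w \<Rightarrow> ereal" where
  "exit_time U Fi i x \<omega> = Inf {ereal t | t. 0 \<le> t \<and> Fi i t x \<omega> \<notin> closure (U i)}"


(* S_j^K *)
definition exit_time_on ::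
  "(nat \<Rightarrow> 'a::topological_space set) \<Rightarrow> (nat \<Rightarrow> real \<Rightarrow> 'a \<Rightarrow> 'w \<Rightarrow> 'a) \<Rightarrow> nat \<Rightarrow>
     'a set \<Rightarrow> 'w \<Rightarrow> ereal" where
  "exit_time_on U Fi j K \<omega> = (INF x\<in>K. exit_time U Fi j x \<omega>)"


section \<open>Strong completeness\<close>

(* xi^K is infinite, so that F itself is the version continuous on [0,oo) x K *)
definition complete_on ::
  "'w measure \<Rightarrow> (real \<Rightarrow> 'a::topological_space \<Rightarrow> 'w \<Rightarrow> 'a) \<Rightarrow> ('a \<Rightarrow> 'w \<Rightarrow> ereal) \<Rightarrow> 'a set \<Rightarrow> bool" where
  "complete_on P F \<xi> K \<longleftrightarrow> (AE \<omega> in P. inf_time \<xi> K \<omega> = \<infinity> \<and>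
     continuous_on ({0..} \<times> K) (\<lambda>(t, x). F t x \<omega>))"

definition strongly_p_complete ::
  "'p::euclidean_space itself \<Rightarrow> ('a::topological_space, 'e::euclidean_space) chart set \<Rightarrow>
     'w measure \<Rightarrow> (real \<Rightarrow> 'a \<Rightarrow> 'w \<Rightarrow> 'a) \<Rightarrow> ('a \<Rightarrow> 'w \<Rightarrow> ereal) \<Rightarrow> bool" where
  "strongly_p_complete p \<A> P F \<xi> \<longleftrightarrow> (\<forall>K\<in>smooth_simplices p \<A>. complete_on P F \<xi> K)"

definition strongly_complete ::
  "'w measure \<Rightarrow> (real \<Rightarrow> 'a::topological_space \<Rightarrow> 'w \<Rightarrow> 'a) \<Rightarrow> ('a \<Rightarrow> 'w \<Rightarrow> ereal) \<Rightarrow> bool" where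
  "strongly_complete P F \<xi> \<longleftrightarrow> complete_on P F \<xi> UNIV"

end

theory Submission
  imports Defs
begin

text \<open>Let \<open>\<sigma>\<close> be a $C^1$ curve with image \<open>K\<close> whose starting point does not explode. Up to the exit time
  $S_j^K$ the partial flow coincides with the cut-off flow, so its image of \<open>\<sigma>\<close> at that time is again a $C^1$ curve, and by
  hypothesis the expected length of this image on $\{S_j^K < t\}$ is bounded along a subsequence of \<open>j\<close>. On
  $\{\xi^K < t\}$ these lengths tend to infinity, because $S_j^K \nearrow \xi^K$ and
  the image of the starting point stays bounded while some other point of the image escapes; by Fatou's lemma this event is null.
  Joining points by chart segments carries non-explosion from \<open>xbar\<close> to every point, hence to every \<open>H\<close> in $K_1^1$.
  In dimension at most two the boundary of a chart ball lies in a set of $K_1^1$, and as long as the image of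
  the boundary stays in a compact set so does the image of the ball, since it can only leave through that boundary.\<close>

section \<open>Manifolds, tangent vectors and curves\<close>

text \<open>Three obstacles shape the argument. Agreement with the cut-off flow comes from
  maximality of the solution, with a null set that depends on the starting point; it is used for a
  countable dense set of points only and carried to all points by continuity of both flows. The
  operator norms need not be measurable, neither in \<open>\<omega>\<close> nor jointly with the
  curve parameter, so expectation and integration along the curve are not exchanged by Fubini. Only
  distances between two points of the image curve are integrated: over parameter intervals shrinking
  to a point their expectation is compared with the bound at that point by a reverse Fatou argument,
  bisection extends the bound to every interval, and sums of distances over uniform grids stand in
  for the length. Exit times are infima over uncountable sets on a space that need not be complete,
  so versions over rational times and parameters, which are measurable and almost surely equal, take
  their place under the integral.\<close>

lemma Ck_on_1_has_derivative:
  "Ck_on (Suc 0) f S \<Longrightarrow> x \<in> S \<Longrightarrow> (f has_derivative frechet_derivative f (at x)) (at x)"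
  by (simp add: frechet_derivative_works)

lemma smooth_on_imp_Ck_on: "smooth_on f S \<Longrightarrow> Ck_on k f S"
  by (simp add: smooth_on_def)

lemma smooth_on_imp_continuous_on: "smooth_on f S \<Longrightarrow> continuous_on S f"
  using smooth_on_imp_Ck_on[of f S 0] by simp

text \<open>\<open>Ck_on\<close> only gives continuity of the derivative in each fixed basis
  direction. Expanding the direction in the basis makes the derivative continuous jointly in the
  point and the vector, as moving tangent vectors require.\<close>

lemma frechet_derivative_tendsto:
  fixes f :: "'a::euclidean_space \<Rightarrow> 'b::real_normed_vector"
  assumes f: "Ck_on (Suc 0) f S" and p: "(p \<longlongrightarrow> p0) G" and u: "(u \<longlongrightarrow> u0) G"
    and S: "\<forall>\<^sub>F t in G. p t \<in> S" "p0 \<in> S"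
  shows "((\<lambda>t. frechet_derivative f (at (p t)) (u t)) \<longlongrightarrow> frechet_derivative f (at p0) u0) G"
proof -
  have lin: "frechet_derivative f (at x) v = (\<Sum>b\<in>Basis. (v \<bullet> b) *\<^sub>R frechet_derivative f (at x) b)"
    if "x \<in> S" for x v
  proof -
    have l: "linear (frechet_derivative f (at x))"
      using f that by (auto intro: linear_frechet_derivative)
    have "frechet_derivative f (at x) v = frechet_derivative f (at x) (\<Sum>b\<in>Basis. (v \<bullet> b) *\<^sub>R b)"
      by (simp add: euclidean_representation)
    also have "\<dots> = (\<Sum>b\<in>Basis. (v \<bullet> b) *\<^sub>R frechet_derivative f (at x) b)"
      by (simp add: linear_sum[OF l] linear_scale[OF l])
    finally show ?thesis .
  qed
  have c: "((\<lambda>t. frechet_derivative f (at (p t)) b) \<longlongrightarrow> frechet_derivative f (at p0) b) G" if "b \<in> Basis" for b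
  proof -
    have "continuous_on S (\<lambda>x. frechet_derivative f (at x) b)" using f that by simp
    from continuous_on_tendsto_compose[OF this p S(2,1)] show ?thesis .
  qed
  have "((\<lambda>t. \<Sum>b\<in>Basis. (u t \<bullet> b) *\<^sub>R frechet_derivative f (at (p t)) b) \<longlongrightarrow>
      (\<Sum>b\<in>Basis. (u0 \<bullet> b) *\<^sub>R frechet_derivative f (at p0) b)) G"
    by (intro tendsto_intros c u)
  moreover have "\<forall>\<^sub>F t in G. (\<Sum>b\<in>Basis. (u t \<bullet> b) *\<^sub>R frechet_derivative f (at (p t)) b) =
      frechet_derivative f (at (p t)) (u t)"
    using S(1) by eventually_elim (simp add: lin[symmetric])
  ultimately show ?thesis
    by (subst lin[OF S(2)]) (rule Lim_transform_eventually)
qed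

section \<open>Charts, coordinate changes and tangent vectors\<close>

locale manifold =
  fixes \<A> :: "('a::{t2_space, second_countable_topology}, 'e::euclidean_space) chart set"
  assumes smooth_manifold: "smooth_manifold \<A>"
begin

lemma chart_exists: obtains c where "c \<in> \<A>" "x \<in> fst c"
proof -
  have "(\<Union>c\<in>\<A>. fst c) = UNIV" using smooth_manifold by (simp add: smooth_manifold_def)
  then have "x \<in> (\<Union>c\<in>\<A>. fst c)" by simp
  then show ?thesis using that by blast
qed

lemma chart_at: "chart_at \<A> x \<in> \<A>" "x \<in> fst (chart_at \<A> x)"
proof -
  have "\<exists>c. c \<in> \<A> \<and> x \<in> fst c" by (rule chart_exists[of x]) blast
  then have "chart_at \<A> x \<in> \<A> \<and> x \<in> fst (chart_at \<A> x)"
    unfolding chart_at_def by (rule someI_ex)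
  then show "chart_at \<A> x \<in> \<A>" "x \<in> fst (chart_at \<A> x)" by auto
qed

lemma
  assumes "c \<in> \<A>"
  shows open_chart: "open (fst c)" and open_chart_image: "open (snd c ` fst c)"
    and chart_homeomorphism: "homeomorphism (fst c) (snd c ` fst c) (snd c) (chart_inv c)"
  using smooth_manifold assms by (auto simp: smooth_manifold_def)

lemma chart_inverse: "c \<in> \<A> \<Longrightarrow> x \<in> fst c \<Longrightarrow> chart_inv c (snd c x) = x"
  using chart_homeomorphism[of c] by (auto simp: homeomorphism_def)

lemma inverse_chart: "c \<in> \<A> \<Longrightarrow> p \<in> snd c ` fst c \<Longrightarrow> snd c (chart_inv c p) = p"
  using chart_homeomorphism[of c] by (auto simp: homeomorphism_def)

lemma chart_inv_in: "c \<in> \<A> \<Longrightarrow> p \<in> snd c ` fst c \<Longrightarrow> chart_inv c p \<in> fst c"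
  by (metis inv_into_into)

lemma continuous_on_chart: "c \<in> \<A> \<Longrightarrow> continuous_on (fst c) (snd c)"
  using chart_homeomorphism[of c] by (auto simp: homeomorphism_def)

lemma continuous_on_chart_inv: "c \<in> \<A> \<Longrightarrow> continuous_on (snd c ` fst c) (chart_inv c)"
  using chart_homeomorphism[of c] by (auto simp: homeomorphism_def)

lemma open_chart_image_subset:
  assumes "c \<in> \<A>" "open V" "V \<subseteq> fst c" shows "open (snd c ` V)"
proof -
  have "snd c ` V = (snd c ` fst c) \<inter> chart_inv c -` V"
    using assms chart_inverse[OF assms(1)] inverse_chart[OF assms(1)] by (auto simp: image_iff)
  then show ?thesis
    using continuous_on_open_vimage[OF open_chart_image[OF assms(1)], of "chart_inv c"]
      continuous_on_chart_inv[OF assms(1)] assms(2) by (simp add: Int_commute)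
qed

lemma open_chart_inv_image:
  assumes "c \<in> \<A>" "open V" "V \<subseteq> snd c ` fst c" shows "open (chart_inv c ` V)"
proof -
  have "chart_inv c ` V = fst c \<inter> snd c -` V"
    using assms chart_inverse[OF assms(1)] inverse_chart[OF assms(1)] chart_inv_in[OF assms(1)] 
    by (auto simp: image_iff) (metis subset_iff)+
  then show ?thesis
    using continuous_on_open_vimage[OF open_chart[OF assms(1)], of "snd c"]
      continuous_on_chart[OF assms(1)] assms(2) by (simp add: Int_commute)
qed

lemma transition_has_derivative:
  assumes "c \<in> \<A>" "c' \<in> \<A>" "x \<in> fst c" "x \<in> fst c'"
  shows "((snd c' \<circ> chart_inv c) has_derivative transition_deriv c c' x) (at (snd c x))"
proof -
  have "smooth_on (snd c' \<circ> chart_inv c) (snd c ` (fst c \<inter> fst c'))"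
    using smooth_manifold assms by (auto simp: smooth_manifold_def)
  from Ck_on_1_has_derivative[OF smooth_on_imp_Ck_on[OF this]] assms show ?thesis
    by (auto simp: transition_deriv_def)
qed

lemma eventually_chart_inv:
  assumes "c \<in> \<A>" "x \<in> fst c" "open V" "x \<in> V"
  shows "\<forall>\<^sub>F p in nhds (snd c x). p \<in> snd c ` fst c \<and> chart_inv c p \<in> V"
proof -
  have "snd c ` (fst c \<inter> V) \<subseteq> {p. p \<in> snd c ` fst c \<and> chart_inv c p \<in> V}"
    using chart_inverse[OF assms(1)] by auto
  moreover have "open (snd c ` (fst c \<inter> V))"
    using assms(1) open_Int[OF open_chart[OF assms(1)] assms(3)] by (rule open_chart_image_subset) simp
  ultimately show ?thesis using assms unfolding eventually_nhds by blast
qed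

text \<open>Chain rule with the transition map. The functions compared agree only near
  \<open>snd c' x\<close>, which is enough for derivatives.\<close>

lemma has_derivative_change_chart:
  assumes c: "c \<in> \<A>" "x \<in> fst c" and c': "c' \<in> \<A>" "x \<in> fst c'"
    and h: "((h \<circ> chart_inv c) has_derivative D) (at (snd c x))"
  shows "((h \<circ> chart_inv c') has_derivative (\<lambda>u. D (transition_deriv c' c x u))) (at (snd c' x))"
proof -
  have "((h \<circ> chart_inv c) has_derivative D) (at ((snd c \<circ> chart_inv c') (snd c' x)))"
    using h chart_inverse c' by simp
  from has_derivative_compose[OF transition_has_derivative[OF c'(1) c(1) c'(2) c(2)] this]
  have *: "((\<lambda>p. (h \<circ> chart_inv c) ((snd c \<circ> chart_inv c') p)) has_derivative
     (\<lambda>u. D (transition_deriv c' c x u))) (at (snd c' x))" .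
  have "\<forall>\<^sub>F p in nhds (snd c' x). (h \<circ> chart_inv c) ((snd c \<circ> chart_inv c') p) = (h \<circ> chart_inv c') p"
    using eventually_chart_inv[OF c' open_chart[OF c(1)] c(2)]
    by eventually_elim (auto simp: chart_inverse[OF c(1)])
  then show ?thesis
    by (intro has_derivative_transform_eventually[OF *]) (auto simp: eventually_nhds_conv_at)
qed

text \<open>Both sides are derivatives of the same coordinate change at the same point. This
  identity is what makes \<open>tvec_of\<close> a genuine tangent vector.\<close>

lemma transition_deriv_cocycle:
  assumes "c \<in> \<A>" "x \<in> fst c" "c' \<in> \<A>" "x \<in> fst c'" "c'' \<in> \<A>" "x \<in> fst c''"
  shows "transition_deriv c' c'' x (transition_deriv c c' x u) = transition_deriv c c'' x u"
  using has_derivative_unique[OF has_derivative_change_chart[OF assms(3,4,1,2)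
      transition_has_derivative[OF assms(3,5,4,6)]] transition_has_derivative[OF assms(1,5,2,6)]]
  by (rule fun_cong)

lemma transition_deriv_same [simp]:
  assumes "c \<in> \<A>" "x \<in> fst c" shows "transition_deriv c c x u = u"
proof -
  have "\<forall>\<^sub>F p in nhds (snd c x). p = (snd c \<circ> chart_inv c) p"
    using eventually_chart_inv[OF assms open_UNIV UNIV_I]
    by eventually_elim (auto simp: inverse_chart[OF assms(1)] chart_inverse[OF assms(1)])
  then have "((snd c \<circ> chart_inv c) has_derivative (\<lambda>u. u)) (at (snd c x))"
    by (intro has_derivative_transform_eventually[OF has_derivative_ident]) (auto simp: eventually_nhds_conv_at)
  from has_derivative_unique[OF transition_has_derivative[OF assms(1,1,2,2)] this] show ?thesis by simp
qed

lemma transition_deriv_linear: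
  assumes "c \<in> \<A>" "c' \<in> \<A>" "x \<in> fst c" "x \<in> fst c'"
  shows "bounded_linear (transition_deriv c c' x)"
  using transition_has_derivative[OF assms] by (rule has_derivative_bounded_linear)

lemma tvec_of_chart: "c \<in> \<A> \<Longrightarrow> x \<in> fst c \<Longrightarrow> tvec_of \<A> c x u c = u"
  by (simp add: tvec_of_def)

lemma tvec_of_tangent: "c \<in> \<A> \<Longrightarrow> x \<in> fst c \<Longrightarrow> tvec_of \<A> c x u \<in> tangent_space \<A> x"
  by (auto simp: tangent_space_def tvec_of_def transition_deriv_cocycle)

lemma tangent_space_transition:
  assumes "v \<in> tangent_space \<A> x" "c \<in> \<A>" "c' \<in> \<A>" "x \<in> fst c" "x \<in> fst c'"
  shows "transition_deriv c c' x (v c) = v c'"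
proof -
  have "\<forall>c\<in>\<A>. \<forall>c'\<in>\<A>. x \<in> fst c \<and> x \<in> fst c' \<longrightarrow> v c' = transition_deriv c c' x (v c)"
    using assms(1) unfolding tangent_space_def by (rule CollectE) (erule conjunct1)
  from bspec[OF bspec[OF this assms(2)] assms(3)] assms(4,5) show ?thesis by (simp only:)
qed

lemma tangent_space_outside:
  assumes "v \<in> tangent_space \<A> x" "\<not> (c \<in> \<A> \<and> x \<in> fst c)" shows "v c = 0"
proof -
  have "\<forall>c. \<not> (c \<in> \<A> \<and> x \<in> fst c) \<longrightarrow> v c = 0"
    using assms(1) unfolding tangent_space_def by (rule CollectE) (erule conjunct2)
  with assms(2) show ?thesis by blast
qed

lemma tangent_eq_tvec_of:
  assumes "v \<in> tangent_space \<A> x" "c \<in> \<A>" "x \<in> fst c" shows "v = tvec_of \<A> c x (v c)"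
proof
  fix c' show "v c' = tvec_of \<A> c x (v c) c'"
    using tangent_space_transition[OF assms(1,2) _ assms(3)] tangent_space_outside[OF assms(1)]
    by (simp add: tvec_of_def)
qed

lemma tangent_space_scale:
  assumes "v \<in> tangent_space \<A> x" shows "(\<lambda>c. r *\<^sub>R v c) \<in> tangent_space \<A> x"
proof -
  have "r *\<^sub>R v c' = transition_deriv c c' x (r *\<^sub>R v c)"
    if "c \<in> \<A>" "c' \<in> \<A>" "x \<in> fst c" "x \<in> fst c'" for c c'
    using bounded_linear.linear[OF transition_deriv_linear[OF that]] tangent_space_transition[OF assms that]
    by (simp add: linear_scale)
  then show ?thesis
    using tangent_space_outside[OF assms] unfolding tangent_space_def by (intro CollectI conjI) (blast, metis scaleR_zero_right)
qed

lemma tangent_space_0: "(\<lambda>c. 0) \<in> tangent_space \<A> x"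
proof -
  obtain c where c: "c \<in> \<A>" "x \<in> fst c" by (rule chart_exists)
  show ?thesis using tangent_space_scale[OF tvec_of_tangent[OF c], of 0] by simp
qed

lemma tvec_of_linear:
  assumes "c \<in> \<A>" "x \<in> fst c"
  shows "tvec_of \<A> c x (a *\<^sub>R u + b *\<^sub>R w) = (\<lambda>c'. a *\<^sub>R tvec_of \<A> c x u c' + b *\<^sub>R tvec_of \<A> c x w c')"
proof -
  have "transition_deriv c c' x (a *\<^sub>R u + b *\<^sub>R w) = a *\<^sub>R transition_deriv c c' x u + b *\<^sub>R transition_deriv c c' x w"
    if "c' \<in> \<A>" "x \<in> fst c'" for c'
    using bounded_linear.linear[OF transition_deriv_linear[OF assms(1) that(1) assms(2) that(2)]]
    by (simp add: linear_add linear_scale)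
  then show ?thesis by (auto simp: tvec_of_def fun_eq_iff)
qed

text \<open>\<open>C1_curve\<close> makes demands in every chart; checking one chart around each
  point suffices. The chain rule with the transition map transfers the derivative, and joint
  continuity of the transition derivatives transfers the continuity of the velocity.\<close>

lemma C1_curveI:
  assumes l: "0 < l" and \<sigma>: "continuous_on {0..l} \<sigma>"
    and v: "\<And>t. t \<in> {0..l} \<Longrightarrow> v t \<in> tangent_space \<A> (\<sigma> t)"
    and loc: "\<And>t. t \<in> {0..l} \<Longrightarrow> \<exists>c\<in>\<A>. \<sigma> t \<in> fst c \<and>
      ((snd c \<circ> \<sigma>) has_vector_derivative v t c) (at t within {0..l}) \<and>
      ((\<lambda>s. v s c) \<longlongrightarrow> v t c) (at t within {0..l})"
  shows "C1_curve \<A> l \<sigma> v"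
proof -
  have A: "((snd c \<circ> \<sigma>) has_vector_derivative v t c) (at t within {0..l})" (is ?A)
    and B: "((\<lambda>s. v s c) \<longlongrightarrow> v t c) (at t within {0..l})" (is ?B)
    if c: "c \<in> \<A>" and t: "t \<in> {0..l}" and \<sigma>t: "\<sigma> t \<in> fst c" for c t
  proof -
    obtain c1 where c1: "c1 \<in> \<A>" "\<sigma> t \<in> fst c1"
      and d: "((snd c1 \<circ> \<sigma>) has_vector_derivative v t c1) (at t within {0..l})"
      and cont: "((\<lambda>s. v s c1) \<longlongrightarrow> v t c1) (at t within {0..l})"
      using loc[OF t] by auto
    have lim: "(\<sigma> \<longlongrightarrow> \<sigma> t) (at t within {0..l})"
      using \<sigma> t by (auto simp: continuous_on)
    have ev: "\<forall>\<^sub>F s in at t within {0..l}. \<sigma> s \<in> fst c \<inter> fst c1"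
      using topological_tendstoD[OF lim] open_chart c c1 \<sigma>t by blast
    have evt: "\<forall>\<^sub>F s in at t within {0..l}. s \<in> {0..l}"
      by (simp add: eventually_at_topological) (metis open_UNIV UNIV_I)
    have td: "transition_deriv c1 c (\<sigma> s) (v s c1) = v s c" if "s \<in> {0..l}" "\<sigma> s \<in> fst c \<inter> fst c1" for s
      using tangent_space_transition[OF v[OF that(1)] c1(1) c] that(2) by simp
    have "((snd c \<circ> chart_inv c1) has_derivative transition_deriv c1 c (\<sigma> t)) (at ((snd c1 \<circ> \<sigma>) t) within (snd c1 \<circ> \<sigma>) ` {0..l})"
      using has_derivative_at_withinI[OF transition_has_derivative[OF c1(1) c c1(2) \<sigma>t]] by simp
    from diff_chain_within[OF d[unfolded has_vector_derivative_def] this]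
    have "((\<lambda>s. snd c (chart_inv c1 (snd c1 (\<sigma> s)))) has_vector_derivative v t c) (at t within {0..l})"
      using bounded_linear.linear[OF transition_deriv_linear[OF c1(1) c c1(2) \<sigma>t]] td[OF t] c1 \<sigma>t
      by (simp add: has_vector_derivative_def o_def linear_scale)
    moreover have "\<forall>\<^sub>F s in at t within {0..l}. snd c (chart_inv c1 (snd c1 (\<sigma> s))) = (snd c \<circ> \<sigma>) s"
      using ev by eventually_elim (simp add: chart_inverse[OF c1(1)])
    ultimately show ?A
      unfolding has_vector_derivative_def
      by (rule has_derivative_transform_eventually) (use t in \<open>auto simp: chart_inverse c1\<close>)
    have "smooth_on (snd c \<circ> chart_inv c1) (snd c1 ` (fst c1 \<inter> fst c))"
      using smooth_manifold c1 c by (auto simp: smooth_manifold_def)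
    note sm = smooth_on_imp_Ck_on[OF this, of "Suc 0"]
    have "((\<lambda>s. snd c1 (\<sigma> s)) \<longlongrightarrow> snd c1 (\<sigma> t)) (at t within {0..l})"
      using continuous_on_tendsto_compose[OF continuous_on_chart[OF c1(1)] lim c1(2)] ev
      by (metis (mono_tags, lifting) IntD2 eventually_mono)
    moreover have "\<forall>\<^sub>F s in at t within {0..l}. snd c1 (\<sigma> s) \<in> snd c1 ` (fst c1 \<inter> fst c)"
      using ev by eventually_elim auto
    ultimately have "((\<lambda>s. transition_deriv c1 c (\<sigma> s) (v s c1)) \<longlongrightarrow> transition_deriv c1 c (\<sigma> t) (v t c1)) (at t within {0..l})"
      unfolding transition_deriv_def using c1(2) \<sigma>t by (intro frechet_derivative_tendsto[OF sm _ cont]) auto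
    moreover have "\<forall>\<^sub>F s in at t within {0..l}. transition_deriv c1 c (\<sigma> s) (v s c1) = v s c"
      using ev evt by eventually_elim (simp add: td)
    ultimately show ?B
      using td[OF t] c1 \<sigma>t by (simp add: Lim_transform_eventually)
  qed
  then show ?thesis
    unfolding C1_curve_def
  proof (intro conjI ballI impI)
    fix c assume c: "c \<in> \<A>"
    show "continuous_on {t \<in> {0..l}. \<sigma> t \<in> fst c} (\<lambda>t. v t c)"
      unfolding continuous_on
    proof
      fix t assume "t \<in> {t \<in> {0..l}. \<sigma> t \<in> fst c}"
      then have "((\<lambda>s. v s c) \<longlongrightarrow> v t c) (at t within {0..l})" using B[OF c] by simp
      then show "((\<lambda>s. v s c) \<longlongrightarrow> v t c) (at t within {t \<in> {0..l}. \<sigma> t \<in> fst c})"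
        by (rule tendsto_within_subset) blast
    qed
  qed (simp_all add: l \<sigma> v A)
qed

text \<open>The source of all concrete curves: coordinate segments and the circle around a chart
  ball are instances.\<close>

lemma chart_path_C1_curve:
  assumes c: "c \<in> \<A>" and l: "0 < l" and \<gamma>: "\<gamma> ` {0..l} \<subseteq> snd c ` fst c"
    and d: "\<And>t. t \<in> {0..l} \<Longrightarrow> (\<gamma> has_vector_derivative \<gamma>' t) (at t within {0..l})"
    and cont: "continuous_on {0..l} \<gamma>'"
  shows "C1_curve \<A> l (chart_inv c \<circ> \<gamma>) (\<lambda>t. tvec_of \<A> c (chart_inv c (\<gamma> t)) (\<gamma>' t))"
proof (rule C1_curveI[OF l])
  have "continuous_on {0..l} \<gamma>"
    using d has_vector_derivative_continuous by (fastforce simp: continuous_on_eq_continuous_within)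
  then show "continuous_on {0..l} (chart_inv c \<circ> \<gamma>)"
    by (intro continuous_on_compose continuous_on_subset[OF continuous_on_chart_inv[OF c] \<gamma>])
next
  fix t assume t: "t \<in> {0..l}"
  have in_c: "chart_inv c (\<gamma> s) \<in> fst c" if "s \<in> {0..l}" for s
    by (rule chart_inv_in[OF c]) (use \<gamma> that in blast)
  show "tvec_of \<A> c (chart_inv c (\<gamma> t)) (\<gamma>' t) \<in> tangent_space \<A> ((chart_inv c \<circ> \<gamma>) t)"
    using tvec_of_tangent[OF c in_c[OF t]] by simp
  have "((snd c \<circ> (chart_inv c \<circ> \<gamma>)) has_vector_derivative \<gamma>' t) (at t within {0..l})"
  proof (rule has_vector_derivative_transform[OF t _ d[OF t]])
    fix s assume "s \<in> {0..l}"
    then have "\<gamma> s \<in> snd c ` fst c" using \<gamma> by blast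
    then show "(snd c \<circ> (chart_inv c \<circ> \<gamma>)) s = \<gamma> s" by (simp add: inverse_chart[OF c])
  qed
  moreover have "((\<lambda>s. tvec_of \<A> c (chart_inv c (\<gamma> s)) (\<gamma>' s) c) \<longlongrightarrow> \<gamma>' t) (at t within {0..l})"
  proof (rule Lim_transform_within)
    show "(\<gamma>' \<longlongrightarrow> \<gamma>' t) (at t within {0..l})" using cont t by (auto simp: continuous_on)
    show "0 < (1::real)" by simp
  qed (simp add: tvec_of_chart[OF c in_c])
  ultimately show "\<exists>c'\<in>\<A>. (chart_inv c \<circ> \<gamma>) t \<in> fst c' \<and>
      ((snd c' \<circ> (chart_inv c \<circ> \<gamma>)) has_vector_derivative tvec_of \<A> c (chart_inv c (\<gamma> t)) (\<gamma>' t) c') (at t within {0..l}) \<and>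
      ((\<lambda>s. tvec_of \<A> c (chart_inv c (\<gamma> s)) (\<gamma>' s) c') \<longlongrightarrow> tvec_of \<A> c (chart_inv c (\<gamma> t)) (\<gamma>' t) c') (at t within {0..l})"
    using c in_c[OF t] by (intro bexI[of _ c]) (auto simp: tvec_of_chart)
qed

text \<open>\<open>C1_curve\<close> always starts at time 0, so a piece of a curve has to be shifted
  before its length can bound a distance.\<close>

lemma C1_curve_shift:
  assumes \<sigma>: "C1_curve \<A> l \<sigma> v" and ab: "0 \<le> a" "a < b" "b \<le> l"
  shows "C1_curve \<A> (b - a) (\<lambda>t. \<sigma> (a + t)) (\<lambda>t. v (a + t))"
proof -
  have im: "(\<lambda>t. a + t) ` {0..b - a} \<subseteq> {0..l}" using ab by auto
  have cs: "continuous_on {0..b - a} (\<lambda>t. \<sigma> (a + t))"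
  proof (rule continuous_on_compose2[OF _ _ im])
    show "continuous_on {0..l} \<sigma>" using \<sigma> by (simp add: C1_curve_def)
  qed (intro continuous_intros)
  have "((snd c \<circ> (\<lambda>t. \<sigma> (a + t))) has_vector_derivative v (a + t) c) (at t within {0..b - a})"
    if "c \<in> \<A>" "t \<in> {0..b-a}" "\<sigma> (a + t) \<in> fst c" for c t
  proof -
    have "((snd c \<circ> \<sigma>) has_vector_derivative v (a + t) c) (at (a + t) within (\<lambda>t. a + t) ` {0..b-a})"
      using \<sigma> that im unfolding C1_curve_def by (blast intro: has_vector_derivative_within_subset)
    moreover have "((\<lambda>t. a + t) has_vector_derivative 1) (at t within {0..b-a})"
      by (auto intro!: derivative_eq_intros)
    ultimately show ?thesis
      using vector_diff_chain_within[of "\<lambda>t. a + t" 1 t "{0..b-a}" "snd c \<circ> \<sigma>" "v (a + t) c"]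
      by (simp add: o_def)
  qed
  moreover have "continuous_on {t\<in>{0..b - a}. \<sigma> (a + t) \<in> fst c} (\<lambda>t. v (a + t) c)" if "c \<in> \<A>" for c
  proof (rule continuous_on_compose2[of "{t\<in>{0..l}. \<sigma> t \<in> fst c}" "\<lambda>t. v t c"])
    show "continuous_on {t \<in> {0..l}. \<sigma> t \<in> fst c} (\<lambda>t. v t c)" using \<sigma> that by (simp add: C1_curve_def)
  qed (use im in \<open>auto intro!: continuous_intros\<close>)
  ultimately show ?thesis
    using \<sigma> ab im cs unfolding C1_curve_def by (auto simp: image_subset_iff)
qed

lemma tendsto_in_chart:
  assumes "c \<in> \<A>" "(x \<longlongrightarrow> x0) G" "x0 \<in> fst c"
  shows "\<forall>\<^sub>F t in G. x t \<in> fst c" "((\<lambda>t. snd c (x t)) \<longlongrightarrow> snd c x0) G"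
proof -
  show ev: "\<forall>\<^sub>F t in G. x t \<in> fst c"
    using topological_tendstoD[OF assms(2) open_chart[OF assms(1)] assms(3)] .
  show "((\<lambda>t. snd c (x t)) \<longlongrightarrow> snd c x0) G"
    using continuous_on_tendsto_compose[OF continuous_on_chart[OF assms(1)] assms(2,3) ev] .
qed

end

section \<open>Riemannian length and distance\<close>

context manifold begin

text \<open>\<open>tangent_map\<close> is computed in the arbitrarily chosen chart
  \<open>chart_at\<close>; uniqueness of derivatives shows that every chart around the point gives
  the same vector.\<close>

lemma
  assumes f: "Ck_map_on (Suc 0) \<A> f W" "open W" "x \<in> W"
    and c: "c \<in> \<A>" "x \<in> fst c" and c': "c' \<in> \<A>" "f x \<in> fst c'"
  shows Ck_map_on_has_derivative: "((snd c' \<circ> f \<circ> chart_inv c) has_derivative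
      frechet_derivative (snd c' \<circ> f \<circ> chart_inv c) (at (snd c x))) (at (snd c x))"
    and tangent_map_chart: "v \<in> tangent_space \<A> x \<Longrightarrow>
      tangent_map \<A> f x v c' = frechet_derivative (snd c' \<circ> f \<circ> chart_inv c) (at (snd c x)) (v c)"
proof -
  have d: "((snd c' \<circ> f \<circ> chart_inv c) has_derivative
      frechet_derivative (snd c' \<circ> f \<circ> chart_inv c) (at (snd c x))) (at (snd c x))"
    if "c \<in> \<A>" "x \<in> fst c" for c
  proof (rule Ck_on_1_has_derivative)
    show "Ck_on (Suc 0) (snd c' \<circ> f \<circ> chart_inv c) (snd c ` (fst c \<inter> W \<inter> f -` fst c'))"
      using f(1) that(1) c'(1) unfolding Ck_map_on_def by blast
    show "snd c x \<in> snd c ` (fst c \<inter> W \<inter> f -` fst c')" using f(3) that(2) c'(2) by blast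
  qed
  show "((snd c' \<circ> f \<circ> chart_inv c) has_derivative
      frechet_derivative (snd c' \<circ> f \<circ> chart_inv c) (at (snd c x))) (at (snd c x))"
    by (rule d[OF c])
  assume v: "v \<in> tangent_space \<A> x"
  let ?d = "chart_at \<A> x"
  have "frechet_derivative (snd c' \<circ> f \<circ> chart_inv ?d) (at (snd ?d x)) =
      (\<lambda>u. frechet_derivative (snd c' \<circ> f \<circ> chart_inv c) (at (snd c x)) (transition_deriv ?d c x u))"
    using has_derivative_change_chart[OF c chart_at, of "snd c' \<circ> f"] d[OF c] d[OF chart_at]
    by (metis has_derivative_unique)
  then show "tangent_map \<A> f x v c' = frechet_derivative (snd c' \<circ> f \<circ> chart_inv c) (at (snd c x)) (v c)"
    using tangent_space_transition[OF v chart_at(1) c(1) chart_at(2) c(2)] c'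
    by (simp add: tangent_map_def Let_def)
qed

lemma tangent_map_tangent:
  assumes f: "Ck_map_on (Suc 0) \<A> f W" "open W" "x \<in> W" and v: "v \<in> tangent_space \<A> x"
  shows "tangent_map \<A> f x v \<in> tangent_space \<A> (f x)"
proof -
  obtain c where c: "c \<in> \<A>" "x \<in> fst c" by (rule chart_exists)
  have "tangent_map \<A> f x v c2 = transition_deriv c1 c2 (f x) (tangent_map \<A> f x v c1)"
    if c1: "c1 \<in> \<A>" "f x \<in> fst c1" and c2: "c2 \<in> \<A>" "f x \<in> fst c2" for c1 c2
  proof -
    have cf: "continuous_on W f" using f(1) by (simp add: Ck_map_on_def)
    let ?D = "frechet_derivative (snd c1 \<circ> f \<circ> chart_inv c) (at (snd c x))"
    have "((snd c2 \<circ> chart_inv c1) has_derivative transition_deriv c1 c2 (f x)) (at ((snd c1 \<circ> f \<circ> chart_inv c) (snd c x)))"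
      using transition_has_derivative[OF c1(1) c2(1) c1(2) c2(2)] by (simp add: chart_inverse[OF c])
    from has_derivative_compose[OF Ck_map_on_has_derivative[OF f c c1] this]
    have *: "((\<lambda>p. (snd c2 \<circ> chart_inv c1) ((snd c1 \<circ> f \<circ> chart_inv c) p)) has_derivative
      (\<lambda>u. transition_deriv c1 c2 (f x) (?D u))) (at (snd c x))" .
    have "open (W \<inter> f -` fst c1)"
      using continuous_on_open_vimage[OF f(2)] cf open_chart[OF c1(1)] by (auto simp: Int_commute)
    then have "\<forall>\<^sub>F p in nhds (snd c x). p \<in> snd c ` fst c \<and> chart_inv c p \<in> W \<inter> f -` fst c1"
      using f(3) c1(2) by (intro eventually_chart_inv[OF c]) auto
    then have "\<forall>\<^sub>F p in nhds (snd c x). (snd c2 \<circ> chart_inv c1) ((snd c1 \<circ> f \<circ> chart_inv c) p) =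
        (snd c2 \<circ> f \<circ> chart_inv c) p"
      by eventually_elim (simp add: chart_inverse[OF c1(1)])
    then have "((snd c2 \<circ> f \<circ> chart_inv c) has_derivative
      (\<lambda>u. transition_deriv c1 c2 (f x) (?D u))) (at (snd c x))"
      using eventually_nhds_x_imp_x[of _ "snd c x"]
      by (intro has_derivative_transform_eventually[OF *]) (auto simp: eventually_nhds_conv_at)
    from has_derivative_unique[OF Ck_map_on_has_derivative[OF f c c2] this]
    show ?thesis
      by (simp add: tangent_map_chart[OF f c c1 v] tangent_map_chart[OF f c c2 v])
  qed
  moreover have "tangent_map \<A> f x v c = 0" if "\<not> (c \<in> \<A> \<and> f x \<in> fst c)" for c
    using that unfolding tangent_map_def by (simp only: if_False)
  ultimately show ?thesis unfolding tangent_space_def by blast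
qed

text \<open>In fixed charts this is joint continuity of a derivative in point and direction; the
  charts stay valid because the base points converge. It serves the velocity of an image curve as
  well as the compactness argument for the operator norm.\<close>

lemma tangent_map_tendsto:
  assumes f: "Ck_map_on (Suc 0) \<A> f W" "open W"
    and x: "(x \<longlongrightarrow> x0) G" "x0 \<in> W" and c: "c \<in> \<A>" "x0 \<in> fst c" and c': "c' \<in> \<A>" "f x0 \<in> fst c'"
    and v: "((\<lambda>t. v t c) \<longlongrightarrow> v0 c) G" "\<forall>\<^sub>F t in G. v t \<in> tangent_space \<A> (x t)"
    and v0: "v0 \<in> tangent_space \<A> x0"
  shows "((\<lambda>t. tangent_map \<A> f (x t) (v t) c') \<longlongrightarrow> tangent_map \<A> f x0 v0 c') G"
proof -
  have cf: "continuous_on W f" using f(1) by (simp add: Ck_map_on_def)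
  have "open (W \<inter> f -` fst c')"
    using continuous_on_open_vimage[OF f(2)] cf open_chart[OF c'(1)] by (auto simp: Int_commute)
  from topological_tendstoD[OF x(1) this]
  have ev: "\<forall>\<^sub>F t in G. x t \<in> W \<inter> f -` fst c'" using x(2) c'(2) by simp
  note evc = tendsto_in_chart[OF c(1) x(1) c(2)]
  have "((\<lambda>t. frechet_derivative (snd c' \<circ> f \<circ> chart_inv c) (at (snd c (x t))) (v t c)) \<longlongrightarrow>
      frechet_derivative (snd c' \<circ> f \<circ> chart_inv c) (at (snd c x0)) (v0 c)) G"
  proof (rule frechet_derivative_tendsto)
    show "Ck_on (Suc 0) (snd c' \<circ> f \<circ> chart_inv c) (snd c ` (fst c \<inter> W \<inter> f -` fst c'))"
      using f(1) c(1) c'(1) unfolding Ck_map_on_def by blast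
    show "\<forall>\<^sub>F t in G. snd c (x t) \<in> snd c ` (fst c \<inter> W \<inter> f -` fst c')"
      using ev evc(1) by eventually_elim auto
    show "snd c x0 \<in> snd c ` (fst c \<inter> W \<inter> f -` fst c')" using x(2) c(2) c'(2) by blast
  qed (fact evc v)+
  moreover have "\<forall>\<^sub>F t in G. frechet_derivative (snd c' \<circ> f \<circ> chart_inv c) (at (snd c (x t))) (v t c) =
      tangent_map \<A> f (x t) (v t) c'"
    using ev evc(1) v(2)
  proof eventually_elim
    case (elim t)
    then show ?case by (subst tangent_map_chart[OF f, where c = c]) (use c c' in auto)
  qed
  ultimately show ?thesis
    unfolding tangent_map_chart[OF f x(2) c c' v0] by (rule Lim_transform_eventually)
qed

lemma C1_curve_image:
  assumes f: "Ck_map_on (Suc 0) \<A> f W" "open W"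
    and \<sigma>: "C1_curve \<A> l \<sigma> v" "\<sigma> ` {0..l} \<subseteq> W"
  shows "C1_curve \<A> l (\<lambda>t. f (\<sigma> t)) (\<lambda>t. tangent_map \<A> f (\<sigma> t) (v t))"
proof (rule C1_curveI)
  have cs: "continuous_on {0..l} \<sigma>" and l: "0 < l" using \<sigma>(1) by (simp_all add: C1_curve_def)
  have v: "v t \<in> tangent_space \<A> (\<sigma> t)" if "t \<in> {0..l}" for t using that \<sigma>(1) unfolding C1_curve_def by blast
  have cf: "continuous_on W f" using f(1) by (simp add: Ck_map_on_def)
  show "0 < l" by fact
  show "continuous_on {0..l} (\<lambda>t. f (\<sigma> t))"
    by (rule continuous_on_compose2[OF cf cs \<sigma>(2)])
  fix t assume t: "t \<in> {0..l}"
  have W: "\<sigma> t \<in> W" using \<sigma>(2) t by blast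
  show "tangent_map \<A> f (\<sigma> t) (v t) \<in> tangent_space \<A> (f (\<sigma> t))"
    by (rule tangent_map_tangent[OF f W v[OF t]])
  obtain c where c: "c \<in> \<A>" "\<sigma> t \<in> fst c" by (rule chart_exists)
  obtain c' where c': "c' \<in> \<A>" "f (\<sigma> t) \<in> fst c'" by (rule chart_exists)
  have lim: "(\<sigma> \<longlongrightarrow> \<sigma> t) (at t within {0..l})" using cs t by (auto simp: continuous_on)
  have d: "((snd c \<circ> \<sigma>) has_vector_derivative v t c) (at t within {0..l})"
    using \<sigma>(1) c t unfolding C1_curve_def by blast
  let ?D = "frechet_derivative (snd c' \<circ> f \<circ> chart_inv c) (at (snd c (\<sigma> t)))"
  have D: "((snd c' \<circ> f \<circ> chart_inv c) has_derivative ?D) (at (snd c (\<sigma> t)))"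
    by (rule Ck_map_on_has_derivative[OF f W c c'])
  have "((snd c' \<circ> f \<circ> chart_inv c) has_derivative ?D) (at ((snd c \<circ> \<sigma>) t) within (snd c \<circ> \<sigma>) ` {0..l})"
    using has_derivative_at_withinI[OF D] by simp
  from diff_chain_within[OF d[unfolded has_vector_derivative_def] this]
  have "((\<lambda>s. snd c' (f (chart_inv c (snd c (\<sigma> s))))) has_vector_derivative tangent_map \<A> f (\<sigma> t) (v t) c') (at t within {0..l})"
    using has_derivative_linear[OF D]
    by (simp add: has_vector_derivative_def o_def linear_scale tangent_map_chart[OF f W c c' v[OF t]])
  moreover have "\<forall>\<^sub>F s in at t within {0..l}. snd c' (f (chart_inv c (snd c (\<sigma> s)))) = (snd c' \<circ> (\<lambda>t. f (\<sigma> t))) s"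
    using tendsto_in_chart(1)[OF c(1) lim c(2)] by eventually_elim (simp add: chart_inverse[OF c(1)])
  ultimately have "((snd c' \<circ> (\<lambda>t. f (\<sigma> t))) has_vector_derivative tangent_map \<A> f (\<sigma> t) (v t) c') (at t within {0..l})"
    unfolding has_vector_derivative_def
    by (rule has_derivative_transform_eventually) (use t c in \<open>auto simp: chart_inverse\<close>)
  moreover have "((\<lambda>s. tangent_map \<A> f (\<sigma> s) (v s) c') \<longlongrightarrow> tangent_map \<A> f (\<sigma> t) (v t) c') (at t within {0..l})"
  proof (rule tangent_map_tendsto[OF f lim W c c'])
    have ev: "\<forall>\<^sub>F s in at t within {0..l}. s \<in> {0..l} \<and> \<sigma> s \<in> fst c"
      using tendsto_in_chart(1)[OF c(1) lim c(2)] by (auto simp: eventually_at_filter elim: eventually_mono)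
    then show "\<forall>\<^sub>F s in at t within {0..l}. v s \<in> tangent_space \<A> (\<sigma> s)"
      by eventually_elim (simp add: v)
    have co: "continuous_on {t \<in> {0..l}. \<sigma> t \<in> fst c} (\<lambda>t. v t c)"
      using \<sigma>(1) c unfolding C1_curve_def by blast
    have "((\<lambda>s. v s c) \<longlongrightarrow> v t c) (at t within {0..l})"
      by (rule continuous_on_tendsto_compose[OF co tendsto_ident_at]) (use t c ev in auto)
    then show "((\<lambda>s. v s c) \<longlongrightarrow> v t c) (at t within {0..l})" .
  qed (fact v[OF t])
  ultimately show "\<exists>c\<in>\<A>. f (\<sigma> t) \<in> fst c \<and>
      ((snd c \<circ> (\<lambda>t. f (\<sigma> t))) has_vector_derivative tangent_map \<A> f (\<sigma> t) (v t) c) (at t within {0..l}) \<and>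
      ((\<lambda>s. tangent_map \<A> f (\<sigma> s) (v s) c) \<longlongrightarrow> tangent_map \<A> f (\<sigma> t) (v t) c) (at t within {0..l})"
    using c' by blast
qed

end

locale riemannian = manifold \<A>
  for \<A> :: "('a::{t2_space, second_countable_topology}, 'e::euclidean_space) chart set" +
  fixes g :: "('a, 'e) metric"
  assumes metric: "riemannian_metric \<A> g" and connected: "connected (UNIV :: 'a set)"
begin

section \<open>Norms and metric coefficients in coordinates\<close>

lemma metric_sym: "u \<in> tangent_space \<A> x \<Longrightarrow> v \<in> tangent_space \<A> x \<Longrightarrow> g x u v = g x v u"
  using metric unfolding riemannian_metric_def by blast

lemma metric_linear:
  "u \<in> tangent_space \<A> x \<Longrightarrow> v \<in> tangent_space \<A> x \<Longrightarrow> w \<in> tangent_space \<A> x \<Longrightarrow>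
    g x (\<lambda>c. a *\<^sub>R u c + b *\<^sub>R v c) w = a * g x u w + b * g x v w"
  using metric unfolding riemannian_metric_def by blast

lemma metric_scale:
  assumes "u \<in> tangent_space \<A> x" "w \<in> tangent_space \<A> x"
  shows "g x (\<lambda>c. a *\<^sub>R u c) w = a * g x u w"
  using metric_linear[OF assms(1,1,2), of a 0] by simp

lemma metric_pos: "u \<in> tangent_space \<A> x \<Longrightarrow> u \<noteq> (\<lambda>c. 0) \<Longrightarrow> 0 < g x u u"
  using metric unfolding riemannian_metric_def by blast

lemma metric_nonneg:
  assumes "u \<in> tangent_space \<A> x" shows "0 \<le> g x u u"
proof (cases "u = (\<lambda>c. 0)")
  case True
  then show ?thesis using metric_scale[OF assms assms, of 0] by simp
qed (use metric_pos[OF assms] in auto)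

lemma gnorm_nonneg: "u \<in> tangent_space \<A> x \<Longrightarrow> 0 \<le> gnorm g x u"
  by (simp add: gnorm_def metric_nonneg)

lemma gnorm_scale:
  assumes "u \<in> tangent_space \<A> x" shows "gnorm g x (\<lambda>c. r *\<^sub>R u c) = \<bar>r\<bar> * gnorm g x u"
proof -
  have "g x (\<lambda>c. r *\<^sub>R u c) (\<lambda>c. r *\<^sub>R u c) = r\<^sup>2 * g x u u"
    using metric_scale[OF assms tangent_space_scale[OF assms], of r r]
      metric_sym[OF assms tangent_space_scale[OF assms], of r] metric_scale[OF assms assms, of r]
    by (simp add: power2_eq_square)
  then show ?thesis by (simp add: gnorm_def real_sqrt_mult)
qed

lemma gnorm_pos: "u \<in> tangent_space \<A> x \<Longrightarrow> u \<noteq> (\<lambda>c. 0) \<Longrightarrow> 0 < gnorm g x u"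
  by (simp add: gnorm_def metric_pos)

text \<open>On basis vectors these are the classical coefficients g_ij of the metric in the chart
  \<open>c\<close>. \<open>riemannian_metric\<close> states smoothness for constant coordinate
  vectors only, so continuity of the metric along moving vectors is reduced to these
  functions.\<close>

definition metric_coeff :: "('a, 'e) chart \<Rightarrow> 'e \<Rightarrow> 'e \<Rightarrow> 'e \<Rightarrow> real" where
  "metric_coeff c p u v = g (chart_inv c p) (tvec_of \<A> c (chart_inv c p) u) (tvec_of \<A> c (chart_inv c p) v)"

lemma metric_coeff_continuous:
  "c \<in> \<A> \<Longrightarrow> continuous_on (snd c ` fst c) (\<lambda>p. metric_coeff c p u v)"
  using metric unfolding riemannian_metric_def metric_coeff_def
  by (intro smooth_on_imp_continuous_on) blast

lemma metric_coeff_linear: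
  assumes c: "c \<in> \<A>" "p \<in> snd c ` fst c"
  shows "linear (\<lambda>u. metric_coeff c p u v)" "metric_coeff c p u v = metric_coeff c p v u"
proof -
  note cc = c(1) chart_inv_in[OF c]
  show "metric_coeff c p u v = metric_coeff c p v u"
    unfolding metric_coeff_def by (rule metric_sym) (rule tvec_of_tangent[OF cc])+
  have "metric_coeff c p (a *\<^sub>R u + b *\<^sub>R w) v = a * metric_coeff c p u v + b * metric_coeff c p w v" for a b u w
    unfolding metric_coeff_def tvec_of_linear[OF cc]
    by (rule metric_linear) (rule tvec_of_tangent[OF cc])+
  from this[of 1 _ 1] this[of _ _ 0] show "linear (\<lambda>u. metric_coeff c p u v)"
    by (intro linearI) auto
qed

lemma metric_expand:
  assumes c: "c \<in> \<A>" "x \<in> fst c" and v: "v \<in> tangent_space \<A> x"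
  shows "g x v v = (\<Sum>i\<in>Basis. \<Sum>j\<in>Basis. (v c \<bullet> i) * (v c \<bullet> j) * metric_coeff c (snd c x) i j)"
proof -
  have p: "snd c x \<in> snd c ` fst c" using c by simp
  note l = metric_coeff_linear[OF c(1) p]
  have e: "metric_coeff c (snd c x) u w = (\<Sum>i\<in>Basis. (u \<bullet> i) * metric_coeff c (snd c x) i w)" for u w
  proof -
    have "metric_coeff c (snd c x) u w = metric_coeff c (snd c x) (\<Sum>i\<in>Basis. (u \<bullet> i) *\<^sub>R i) w"
      by (simp add: euclidean_representation)
    then show ?thesis by (simp add: linear_sum[OF l(1)] linear_scale[OF l(1)])
  qed
  have "g x v v = metric_coeff c (snd c x) (v c) (v c)"
    using tangent_eq_tvec_of[OF v c] by (simp add: metric_coeff_def chart_inverse[OF c])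
  also have "\<dots> = (\<Sum>i\<in>Basis. (v c \<bullet> i) * metric_coeff c (snd c x) i (v c))" by (rule e)
  also have "\<dots> = (\<Sum>i\<in>Basis. (v c \<bullet> i) * (\<Sum>j\<in>Basis. (v c \<bullet> j) * metric_coeff c (snd c x) j i))"
    by (subst l(2), subst e) simp
  also have "\<dots> = (\<Sum>i\<in>Basis. \<Sum>j\<in>Basis. (v c \<bullet> i) * (v c \<bullet> j) * metric_coeff c (snd c x) i j)"
    by (simp add: sum_distrib_left mult.assoc l(2)[of _ "_::'e"])
  finally show ?thesis .
qed

text \<open>In the expansion \<open>metric_expand\<close> the base point enters only through
  finitely many coefficients, each of them continuous; the vector enters polynomially.\<close>

lemma gnorm_tendsto:
  assumes x: "(x \<longlongrightarrow> x0) G" and c: "c \<in> \<A>" "x0 \<in> fst c"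
    and v: "\<forall>\<^sub>F t in G. v t \<in> tangent_space \<A> (x t)" "((\<lambda>t. v t c) \<longlongrightarrow> v0 c) G"
    and v0: "v0 \<in> tangent_space \<A> x0"
  shows "((\<lambda>t. gnorm g (x t) (v t)) \<longlongrightarrow> gnorm g x0 v0) G"
proof -
  note evc = tendsto_in_chart[OF c(1) x c(2)]
  have "((\<lambda>t. metric_coeff c (snd c (x t)) i j) \<longlongrightarrow> metric_coeff c (snd c x0) i j) G" for i j
    by (rule continuous_on_tendsto_compose[OF metric_coeff_continuous[OF c(1)] evc(2)])
      (use c(2) evc(1) in \<open>auto elim: eventually_mono\<close>)
  then have "((\<lambda>t. \<Sum>i\<in>Basis. \<Sum>j\<in>Basis. (v t c \<bullet> i) * (v t c \<bullet> j) * metric_coeff c (snd c (x t)) i j)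
    \<longlongrightarrow> (\<Sum>i\<in>Basis. \<Sum>j\<in>Basis. (v0 c \<bullet> i) * (v0 c \<bullet> j) * metric_coeff c (snd c x0) i j)) G"
    by (intro tendsto_intros v)
  moreover have "\<forall>\<^sub>F t in G. (\<Sum>i\<in>Basis. \<Sum>j\<in>Basis. (v t c \<bullet> i) * (v t c \<bullet> j) * metric_coeff c (snd c (x t)) i j) =
      g (x t) (v t) (v t)"
    using evc(1) v(1) by eventually_elim (simp add: metric_expand[OF c(1)])
  ultimately have "((\<lambda>t. g (x t) (v t) (v t)) \<longlongrightarrow> g x0 v0 v0) G"
    unfolding metric_expand[OF c v0] by (rule Lim_transform_eventually)
  then show ?thesis unfolding gnorm_def by (rule tendsto_real_sqrt)
qed

lemma gnorm_C1_curve_continuous: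
  assumes \<sigma>: "C1_curve \<A> l \<sigma> v"
  shows "continuous_on {0..l} (\<lambda>t. gnorm g (\<sigma> t) (v t))"
  unfolding continuous_on
proof
  fix t assume t: "t \<in> {0..l}"
  have lim: "(\<sigma> \<longlongrightarrow> \<sigma> t) (at t within {0..l})"
    using \<sigma> t by (auto simp: continuous_on C1_curve_def)
  have v: "v t \<in> tangent_space \<A> (\<sigma> t)" if "t \<in> {0..l}" for t
    using that \<sigma> unfolding C1_curve_def by blast
  obtain c where c: "c \<in> \<A>" "\<sigma> t \<in> fst c" by (rule chart_exists)
  have ev: "\<forall>\<^sub>F s in at t within {0..l}. s \<in> {0..l} \<and> \<sigma> s \<in> fst c"
    using tendsto_in_chart(1)[OF c(1) lim c(2)] by (auto simp: eventually_at_filter elim: eventually_mono)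
  have co: "continuous_on {t \<in> {0..l}. \<sigma> t \<in> fst c} (\<lambda>t. v t c)"
    using \<sigma> c unfolding C1_curve_def by blast
  show "((\<lambda>t. gnorm g (\<sigma> t) (v t)) \<longlongrightarrow> gnorm g (\<sigma> t) (v t)) (at t within {0..l})"
  proof (rule gnorm_tendsto[OF lim c])
    show "\<forall>\<^sub>F s in at t within {0..l}. v s \<in> tangent_space \<A> (\<sigma> s)"
      using ev by eventually_elim (simp add: v)
    show "((\<lambda>s. v s c) \<longlongrightarrow> v t c) (at t within {0..l})"
      by (rule continuous_on_tendsto_compose[OF co tendsto_ident_at]) (use t c ev in auto)
  qed (fact v[OF t])
qed

lemma C1_curve_velocity: "C1_curve \<A> l \<sigma> v \<Longrightarrow> t \<in> {0..l} \<Longrightarrow> v t \<in> tangent_space \<A> (\<sigma> t)"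
  unfolding C1_curve_def by blast

section \<open>Curve length and the distance it induces\<close>

lemma joined_by_length_nonneg: "joined_by_length \<A> g x y L \<Longrightarrow> 0 \<le> L"
proof (induction rule: joined_by_length.induct)
  case (1 l \<sigma> v)
  show ?case
    by (rule integral_nonneg[OF integrable_continuous_real[OF gnorm_C1_curve_continuous[OF 1]]])
      (rule gnorm_nonneg[OF C1_curve_velocity[OF 1]])
qed simp

lemma rdist_le: "joined_by_length \<A> g x y L \<Longrightarrow> rdist \<A> g x y \<le> L"
  unfolding rdist_def using joined_by_length_nonneg by (intro cInf_lower bdd_belowI[of _ 0]) auto

text \<open>An actual curve on [0,1] is kept instead of \<open>joined_by_length\<close>, because
  chaining through a connected space needs curves to which the nonexplosion argument
  applies.\<close>

definition short_segment :: "real \<Rightarrow> 'a \<Rightarrow> 'a \<Rightarrow> bool" where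
  "short_segment \<epsilon> y z \<longleftrightarrow> (\<exists>\<sigma> v. C1_curve \<A> 1 \<sigma> v \<and> \<sigma> 0 = y \<and> \<sigma> 1 = z \<and>
      integral {0..1} (\<lambda>t. gnorm g (\<sigma> t) (v t)) < \<epsilon>)"

text \<open>The norm of the vector with coordinates \<open>u\<close> at the point with coordinates
  \<open>p\<close> is jointly continuous and vanishes at \<open>u = 0\<close>. So it is below
  \<open>\<epsilon> / 2\<close> for \<open>p\<close> near \<open>snd c x\<close> and
  \<open>u\<close> near 0, and coordinate segments inside a small ball have such velocities.\<close>

lemma short_segment_nbhd:
  assumes "0 < \<epsilon>"
  obtains N where "open N" "x \<in> N" "\<And>y z. y \<in> N \<Longrightarrow> z \<in> N \<Longrightarrow> short_segment \<epsilon> y z"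
proof -
  obtain c where c: "c \<in> \<A>" "x \<in> fst c" by (rule chart_exists)
  let ?p = "snd c x" and ?G = "nhds (snd c x) \<times>\<^sub>F nhds (0::'e)"
  have fst: "filterlim fst (nhds ?p) ?G" by (rule filterlim_fst)
  have snd: "filterlim snd (nhds (0::'e)) ?G" by (rule filterlim_snd)
  have evp: "\<forall>\<^sub>F t in ?G. fst t \<in> snd c ` fst c"
    using topological_tendstoD[OF fst open_chart_image[OF c(1)]] c(2) by blast
  have lim: "((\<lambda>t. chart_inv c (fst t)) \<longlongrightarrow> x) ?G"
    using continuous_on_tendsto_compose[OF continuous_on_chart_inv[OF c(1)] fst _ evp] c
    by (simp add: chart_inverse)
  have t: "tvec_of \<A> c (chart_inv c p) u \<in> tangent_space \<A> (chart_inv c p)" if "p \<in> snd c ` fst c" for p u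
    by (rule tvec_of_tangent[OF c(1) chart_inv_in[OF c(1) that]])
  have "((\<lambda>t. gnorm g (chart_inv c (fst t)) (tvec_of \<A> c (chart_inv c (fst t)) (snd t))) \<longlongrightarrow> gnorm g x (\<lambda>c. 0)) ?G"
  proof (rule gnorm_tendsto[OF lim c])
    show "\<forall>\<^sub>F t in ?G. tvec_of \<A> c (chart_inv c (fst t)) (snd t) \<in> tangent_space \<A> (chart_inv c (fst t))"
      using evp by eventually_elim (rule t)
    show "((\<lambda>t. tvec_of \<A> c (chart_inv c (fst t)) (snd t) c) \<longlongrightarrow> 0) ?G"
      by (rule Lim_transform_eventually[OF snd])
        (use evp in \<open>eventually_elim, simp add: tvec_of_chart[OF c(1) chart_inv_in[OF c(1)]]\<close>)
  qed (rule tangent_space_0)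
  moreover have "gnorm g x (\<lambda>c. 0) < \<epsilon> / 2"
    using gnorm_scale[OF tangent_space_0, of x 0] assms by simp
  ultimately have "\<forall>\<^sub>F t in ?G. gnorm g (chart_inv c (fst t)) (tvec_of \<A> c (chart_inv c (fst t)) (snd t)) < \<epsilon> / 2"
    by (rule order_tendstoD(2))
  then obtain P Q where PQ: "eventually P (nhds ?p)" "eventually Q (nhds 0)"
    "\<And>p u. P p \<Longrightarrow> Q u \<Longrightarrow> gnorm g (chart_inv c p) (tvec_of \<A> c (chart_inv c p) u) < \<epsilon> / 2"
    unfolding eventually_prod_filter by auto
  have "\<forall>\<^sub>F p in nhds ?p. p \<in> snd c ` fst c"
    using eventually_nhds_in_open[OF open_chart_image[OF c(1)]] c(2) by blast
  from eventually_conj[OF PQ(1) this] obtain d1 where d1: "0 < d1" "\<And>p. dist p ?p < d1 \<Longrightarrow> P p \<and> p \<in> snd c ` fst c"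
    by (auto simp: eventually_nhds_metric)
  from PQ(2) obtain d2 where d2: "0 < d2" "\<And>u::'e. dist u 0 < d2 \<Longrightarrow> Q u"
    by (auto simp: eventually_nhds_metric)
  \<comment> \<open>\<open>d1\<close> keeps the segment where the estimate holds; half of
    \<open>d2\<close> keeps the difference of two points of the ball below
    \<open>d2\<close>.\<close>
  define r where "r = min d1 (d2 / 2)"
  have r: "0 < r" using d1 d2 by (simp add: r_def)
  have sub: "ball ?p r \<subseteq> snd c ` fst c" using d1 by (auto simp: r_def dist_commute)
  show ?thesis
  proof
    show "open (chart_inv c ` ball ?p r)" using open_chart_inv_image[OF c(1) open_ball sub] .
    show "x \<in> chart_inv c ` ball ?p r"
      using r chart_inverse[OF c] by (intro image_eqI[of _ _ ?p]) auto
    fix y z assume "y \<in> chart_inv c ` ball ?p r" "z \<in> chart_inv c ` ball ?p r"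
    then obtain p q where p: "p \<in> ball ?p r" "y = chart_inv c p" and q: "q \<in> ball ?p r" "z = chart_inv c q"
      by auto
    define \<gamma> where "\<gamma> t = p + t *\<^sub>R (q - p)" for t :: real
    have \<gamma>: "\<gamma> t \<in> ball ?p r" if "t \<in> {0..1}" for t
    proof -
      have "(1 - t) *\<^sub>R p + t *\<^sub>R q \<in> ball ?p r"
        using that p q by (intro convexD[OF convex_ball]) auto
      then show ?thesis by (simp add: \<gamma>_def algebra_simps)
    qed
    have C: "C1_curve \<A> 1 (chart_inv c \<circ> \<gamma>) (\<lambda>t. tvec_of \<A> c (chart_inv c (\<gamma> t)) (q - p))"
      by (rule chart_path_C1_curve[OF c(1)])
        (use \<gamma> sub in \<open>auto simp: \<gamma>_def[abs_def] intro!: derivative_eq_intros\<close>)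
    have "dist p q < d2"
      using p q dist_triangle_half_r[of ?p p d2 q] by (auto simp: r_def dist_commute)
    then have Q: "Q (q - p)" by (intro d2) (simp add: dist_norm norm_minus_commute)
    have "integral {0..1} (\<lambda>t. gnorm g ((chart_inv c \<circ> \<gamma>) t) (tvec_of \<A> c (chart_inv c (\<gamma> t)) (q - p))) \<le>
      integral {0..1} (\<lambda>t::real. \<epsilon> / 2)"
    proof (rule integral_le[OF integrable_continuous_real[OF gnorm_C1_curve_continuous[OF C]]])
      fix t :: real assume "t \<in> {0..1}"
      then have "P (\<gamma> t)" using \<gamma>[of t] d1(2)[of "\<gamma> t"] by (simp add: r_def dist_commute)
      from PQ(3)[OF this Q]
      show "gnorm g ((chart_inv c \<circ> \<gamma>) t) (tvec_of \<A> c (chart_inv c (\<gamma> t)) (q - p)) \<le> \<epsilon> / 2"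
        by simp
    qed (rule integrable_const_ivl)
    also have "\<dots> < \<epsilon>" using assms by simp
    finally show "short_segment \<epsilon> y z"
      unfolding short_segment_def using C p q by (intro exI[of _ "chart_inv c \<circ> \<gamma>"] exI[of _ "\<lambda>t. tvec_of \<A> c (chart_inv c (\<gamma> t)) (q - p)"])
        (auto simp: \<gamma>_def)
  qed
qed

text \<open>Near each point short segments join any two points in either direction, so
  \<open>R\<close> is constant there; hence \<open>R\<close> and its negation both define open sets.
  The same induction gives finiteness of the distance and spreads nonexplosion from one point to
  all.\<close>

lemma connected_segment_induct:
  assumes x: "R x"
    and step: "\<And>\<sigma> v. C1_curve \<A> 1 \<sigma> v \<Longrightarrow> R (\<sigma> 0) \<Longrightarrow> R (\<sigma> 1)"
  shows "R y"
proof (rule ccontr)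
  assume y: "\<not> R y"
  have N: "\<exists>N. open N \<and> x \<in> N \<and> (\<forall>y\<in>N. \<forall>z\<in>N. R y \<longrightarrow> R z)" for x
  proof -
    obtain N where N: "open N" "x \<in> N" "\<And>y z. y \<in> N \<Longrightarrow> z \<in> N \<Longrightarrow> short_segment 1 y z"
      by (rule short_segment_nbhd[where x = x, OF zero_less_one]) blast
    have "R z" if "short_segment 1 y z" "R y" for y z
      using that step unfolding short_segment_def by blast
    then have "\<forall>y\<in>N. \<forall>z\<in>N. R y \<longrightarrow> R z" using N(3) by blast
    with N(1,2) show ?thesis by (intro exI[of _ N] conjI)
  qed
  have "\<exists>N. open N \<and> x \<in> N \<and> N \<subseteq> {z. R z}" if "x \<in> {z. R z}" for x
    using N[of x] that by (elim exE) (rule exI, auto)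
  then have "open {z. R z}" by (subst open_subopen) blast
  moreover have "\<exists>N. open N \<and> x \<in> N \<and> N \<subseteq> {z. \<not> R z}" if "x \<in> {z. \<not> R z}" for x
    using N[of x] that by (elim exE) (rule exI, auto)
  then have "open {z. \<not> R z}" by (subst open_subopen) blast
  ultimately show False
    using connectedD[OF connected, of "{z. R z}" "{z. \<not> R z}"] x y by auto
qed

text \<open>Without this the infimum defining \<open>rdist\<close> could run over the empty set and
  would carry no information.\<close>

lemma joined_exists: "\<exists>L. joined_by_length \<A> g x y L"
proof (rule connected_segment_induct[where R = "\<lambda>y. \<exists>L. joined_by_length \<A> g x y L"])
  obtain N where "open N" "x \<in> N" "\<And>y z. y \<in> N \<Longrightarrow> z \<in> N \<Longrightarrow> short_segment 1 y z"
    by (rule short_segment_nbhd[where x = x, OF zero_less_one]) blast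
  then have "short_segment 1 x x" by blast
  then show "\<exists>L. joined_by_length \<A> g x x L"
    unfolding short_segment_def
  proof (elim exE conjE)
    fix \<sigma> v assume s: "C1_curve \<A> 1 \<sigma> v" "\<sigma> 0 = x" "\<sigma> 1 = x"
    show ?thesis using joined_by_length.intros(1)[OF s(1), of g] s(2,3) by auto
  qed
next
  fix \<sigma> v assume "C1_curve \<A> 1 \<sigma> v" "\<exists>L. joined_by_length \<A> g x (\<sigma> 0) L"
  then show "\<exists>L. joined_by_length \<A> g x (\<sigma> 1) L"
    using joined_by_length.intros(2)[OF _ joined_by_length.intros(1)] by blast
qed

lemma rdist_nonneg: "0 \<le> rdist \<A> g x y"
  unfolding rdist_def using joined_exists joined_by_length_nonneg by (intro cInf_greatest) auto

lemma rdist_approx: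
  assumes "0 < \<epsilon>" obtains L where "joined_by_length \<A> g x y L" "L < rdist \<A> g x y + \<epsilon>"
proof -
  have "\<exists>L\<in>{L. joined_by_length \<A> g x y L}. L < rdist \<A> g x y + \<epsilon>"
    unfolding rdist_def using joined_exists joined_by_length_nonneg assms
    by (intro cInf_lessD) auto
  then show ?thesis using that by auto
qed

lemma rdist_triangle: "rdist \<A> g x z \<le> rdist \<A> g x y + rdist \<A> g y z"
proof (rule field_le_epsilon)
  fix \<epsilon> :: real assume "0 < \<epsilon>"
  obtain L where L: "joined_by_length \<A> g x y L" "L < rdist \<A> g x y + \<epsilon> / 2"
    by (rule rdist_approx[of "\<epsilon> / 2" x y]) (use \<open>0 < \<epsilon>\<close> in simp_all)
  obtain L' where L': "joined_by_length \<A> g y z L'" "L' < rdist \<A> g y z + \<epsilon> / 2"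
    by (rule rdist_approx[of "\<epsilon> / 2" y z]) (use \<open>0 < \<epsilon>\<close> in simp_all)
  show "rdist \<A> g x z \<le> rdist \<A> g x y + rdist \<A> g y z + \<epsilon>"
    using rdist_le[OF joined_by_length.intros(2)[OF L(1) L'(1)]] L(2) L'(2) by simp
qed

lemma rdist_locally_small:
  assumes "0 < \<epsilon>"
  obtains N where "open N" "x \<in> N" "\<And>y z. y \<in> N \<Longrightarrow> z \<in> N \<Longrightarrow> rdist \<A> g y z < \<epsilon>"
proof -
  obtain N where N: "open N" "x \<in> N" "\<And>y z. y \<in> N \<Longrightarrow> z \<in> N \<Longrightarrow> short_segment \<epsilon> y z"
    by (rule short_segment_nbhd[where x = x, OF assms]) blast
  have "rdist \<A> g y z < \<epsilon>" if "y \<in> N" "z \<in> N" for y z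
  proof -
    have "short_segment \<epsilon> y z" using N(3) that by blast
    then obtain \<sigma> v where s: "C1_curve \<A> 1 \<sigma> v" "\<sigma> 0 = y" "\<sigma> 1 = z" "integral {0..1} (\<lambda>t. gnorm g (\<sigma> t) (v t)) < \<epsilon>"
      unfolding short_segment_def by blast
    show ?thesis using rdist_le[OF joined_by_length.intros(1)[OF s(1)]] s(2-4) by simp
  qed
  with N(1,2) show ?thesis by (rule that)
qed

lemma rdist_self [simp]: "rdist \<A> g x x = 0"
proof (rule antisym[OF field_le_epsilon rdist_nonneg])
  fix \<epsilon> :: real assume "0 < \<epsilon>"
  from rdist_locally_small[OF this, of x] show "rdist \<A> g x x \<le> 0 + \<epsilon>" by (metis add_0 less_imp_le)
qed

text \<open>Distances are small near \<open>x0\<close> and near \<open>y0\<close>, and the triangle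
  inequality does the rest. The local bounds are taken in both orders, so symmetry of
  \<open>rdist\<close> is not invoked. Continuity is in the manifold topology, whence bounds on
  compact sets and Borel measurability.\<close>

lemma continuous_rdist: "continuous_on UNIV (\<lambda>(x, y). rdist \<A> g x y)"
  unfolding continuous_on_eq_continuous_at[OF open_UNIV]
proof (clarify)
  fix x0 y0
  show "isCont (\<lambda>(x, y). rdist \<A> g x y) (x0, y0)"
    unfolding isCont_def
  proof (rule tendstoI)
    fix \<epsilon> :: real assume "0 < \<epsilon>"
    then have e: "0 < \<epsilon> / 2" by simp
    obtain N where N: "open N" "x0 \<in> N" "\<And>y z. y \<in> N \<Longrightarrow> z \<in> N \<Longrightarrow> rdist \<A> g y z < \<epsilon> / 2"
      by (rule rdist_locally_small[where x = x0, OF e]) blast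
    obtain N' where N': "open N'" "y0 \<in> N'" "\<And>y z. y \<in> N' \<Longrightarrow> z \<in> N' \<Longrightarrow> rdist \<A> g y z < \<epsilon> / 2"
      by (rule rdist_locally_small[where x = y0, OF e]) blast
    have "\<forall>\<^sub>F p in nhds (x0, y0). p \<in> N \<times> N'"
      using N N' by (intro eventually_nhds_in_open open_Times) auto
    then have "\<forall>\<^sub>F p in at (x0, y0). p \<in> N \<times> N'" by (simp add: eventually_nhds_conv_at)
    then show "\<forall>\<^sub>F p in at (x0, y0). dist (case p of (x, y) \<Rightarrow> rdist \<A> g x y) (case (x0, y0) of (x, y) \<Rightarrow> rdist \<A> g x y) < \<epsilon>"
    proof eventually_elim
      case (elim p)
      then obtain x y where p: "p = (x, y)" "x \<in> N" "y \<in> N'" by auto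
      show ?case
        using rdist_triangle[of x y x0] rdist_triangle[of x0 y y0] rdist_triangle[of x0 y0 x] rdist_triangle[of x y0 y]
          N(3)[OF p(2) N(2)] N(3)[OF N(2) p(2)] N'(3)[OF p(3) N'(2)] N'(3)[OF N'(2) p(3)]
        by (simp add: p(1) dist_real_def abs_less_iff)
    qed
  qed
qed

lemma rdist_bounded_on_compact:
  assumes "compact C" obtains b where "\<And>y. y \<in> C \<Longrightarrow> rdist \<A> g x0 y \<le> b"
proof -
  have "continuous_on C (\<lambda>y. rdist \<A> g x0 y)"
    using continuous_on_compose2[OF continuous_rdist
        continuous_on_Pair[OF continuous_on_const[of C x0] continuous_on_id] subset_UNIV] by simp
  from compact_continuous_image[OF this assms] have "bounded ((\<lambda>y. rdist \<A> g x0 y) ` C)"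
    by (rule compact_imp_bounded)
  then obtain b where "\<forall>y\<in>C. norm (rdist \<A> g x0 y) \<le> b" by (auto simp: bounded_iff)
  then show ?thesis by (intro that[of b]) (auto dest: bspec)
qed

text \<open>The piece of the curve between \<open>a\<close> and \<open>b\<close> is an admissible
  curve after a shift in time; the degenerate case is separate because a curve needs a positive
  parameter length.\<close>

lemma rdist_le_integral:
  assumes \<sigma>: "C1_curve \<A> l \<sigma> v" and ab: "0 \<le> a" "a \<le> b" "b \<le> l"
  shows "rdist \<A> g (\<sigma> a) (\<sigma> b) \<le> integral {a..b} (\<lambda>t. gnorm g (\<sigma> t) (v t))"
proof (cases "a = b")
  case False
  then have "C1_curve \<A> (b - a) (\<lambda>t. \<sigma> (a + t)) (\<lambda>t. v (a + t))"
    using ab by (intro C1_curve_shift[OF \<sigma>]) auto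
  from rdist_le[OF joined_by_length.intros(1)[OF this]]
  have "rdist \<A> g (\<sigma> a) (\<sigma> b) \<le> integral {0..b - a} (\<lambda>t. gnorm g (\<sigma> (a + t)) (v (a + t)))" by simp
  also have "\<dots> = integral {a..b} (\<lambda>t. gnorm g (\<sigma> t) (v t))"
    using integral_shift_real_ivl[of a a b "\<lambda>t. gnorm g (\<sigma> t) (v t)"] by (simp add: add.commute)
  finally show ?thesis .
qed simp

text \<open>The supremum defining the operator norm is finite because the unit ball is compact.\<close>

lemma gnorm_tangent_map_le:
  assumes f: "Ck_map_on (Suc 0) \<A> f W" "open W" "x \<in> W" and v: "v \<in> tangent_space \<A> x"
  shows "gnorm g (f x) (tangent_map \<A> f x v) \<le> tangent_opnorm \<A> g f x * gnorm g x v"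
proof -
  obtain c where c: "c \<in> \<A>" "x \<in> fst c" by (rule chart_exists)
  obtain c' where c': "c' \<in> \<A>" "f x \<in> fst c'" by (rule chart_exists)
  let ?t = "tvec_of \<A> c x"
  have t: "?t u \<in> tangent_space \<A> x" for u by (rule tvec_of_tangent[OF c])
  have tl: "((\<lambda>u. ?t u c) \<longlongrightarrow> ?t u0 c) (at u0 within S)" for u0 S
    by (simp add: tvec_of_chart[OF c] tendsto_ident_at)
  have "continuous_on (sphere 0 1) (\<lambda>u. gnorm g x (?t u))"
    unfolding continuous_on using t by (intro ballI gnorm_tendsto[OF tendsto_const c] tl always_eventually allI)
  moreover have "sphere (0::'e) 1 \<noteq> {}" by (simp)
  ultimately obtain u0 where u0: "u0 \<in> sphere 0 1" "\<And>u. u \<in> sphere 0 1 \<Longrightarrow> gnorm g x (?t u0) \<le> gnorm g x (?t u)"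
    using continuous_attains_inf[OF compact_sphere] by metis
  \<comment> \<open>The least norm on the coordinate unit sphere: the Riemannian norm dominates
    \<open>m\<close> times the coordinate norm, so the Riemannian unit ball lies in the coordinate
    ball of radius \<open>1 / m\<close>.\<close>
  define m where "m = gnorm g x (?t u0)"
  have "?t u0 c \<noteq> 0" using u0(1) by (auto simp: tvec_of_chart[OF c])
  then have m: "0 < m" unfolding m_def using gnorm_pos[OF t] by metis
  have lower: "m * norm (w c) \<le> gnorm g x w" if w: "w \<in> tangent_space \<A> x" for w
  proof (cases "w c = 0")
    case False
    then have "m \<le> gnorm g x (?t (w c /\<^sub>R norm (w c)))" unfolding m_def by (intro u0(2)) simp
    also have "?t (w c /\<^sub>R norm (w c)) = (\<lambda>c'. inverse (norm (w c)) *\<^sub>R ?t (w c) c')"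
      using tvec_of_linear[OF c, of "inverse (norm (w c))" "w c" 0 0] by simp
    also have "?t (w c) = w" using tangent_eq_tvec_of[OF w c] by simp
    finally show ?thesis using False by (simp add: gnorm_scale[OF w] field_simps)
  qed (use gnorm_nonneg[OF w] in simp)
  have fx: "((\<lambda>u. gnorm g (f x) (tangent_map \<A> f x (?t u))) \<longlongrightarrow> gnorm g (f x) (tangent_map \<A> f x (?t u0))) (at u0 within S)" for u0 S
    by (rule gnorm_tendsto[OF tendsto_const c'] always_eventually allI tangent_map_tangent[OF f] t
        tangent_map_tendsto[OF f(1,2) tendsto_const f(3) c c'] tl)+
  then have "continuous_on (cball 0 (1 / m)) (\<lambda>u. gnorm g (f x) (tangent_map \<A> f x (?t u)))"
    by (simp add: continuous_on)
  from compact_imp_bounded[OF compact_continuous_image[OF this compact_cball]]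
  obtain b where b0: "\<forall>y\<in>(\<lambda>u. gnorm g (f x) (tangent_map \<A> f x (?t u))) ` cball 0 (1 / m). norm y \<le> b"
    unfolding bounded_iff by blast
  have b: "gnorm g (f x) (tangent_map \<A> f x (?t u)) \<le> b" if "u \<in> cball 0 (1 / m)" for u
    using bspec[OF b0 imageI[OF that]] by simp
  have bdd: "bdd_above ((\<lambda>v. gnorm g (f x) (tangent_map \<A> f x v)) ` {v \<in> tangent_space \<A> x. gnorm g x v \<le> 1})"
  proof (rule bdd_aboveI2)
    fix w assume w: "w \<in> {v \<in> tangent_space \<A> x. gnorm g x v \<le> 1}"
    then have "m * norm (w c) \<le> 1" using lower[of w] by simp
    then have "w c \<in> cball 0 (1 / m)" using m by (simp add: field_simps)
    from b[OF this] show "gnorm g (f x) (tangent_map \<A> f x w) \<le> b"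
      using tangent_eq_tvec_of[OF _ c, of w] w by simp
  qed
  have unit: "gnorm g (f x) (tangent_map \<A> f x w) \<le> tangent_opnorm \<A> g f x" if "w \<in> tangent_space \<A> x" "gnorm g x w \<le> 1" for w
    unfolding tangent_opnorm_def using that by (intro cSUP_upper bdd) auto
  have scale: "tangent_map \<A> f x (\<lambda>c. r *\<^sub>R v c) = (\<lambda>c. r *\<^sub>R tangent_map \<A> f x v c)" for r
  proof
    fix d show "tangent_map \<A> f x (\<lambda>c. r *\<^sub>R v c) d = r *\<^sub>R tangent_map \<A> f x v d"
    proof (cases "d \<in> \<A> \<and> f x \<in> fst d")
      case True
      then have d: "d \<in> \<A>" "f x \<in> fst d" by auto
      show ?thesis
        using linear_scale[OF has_derivative_linear[OF Ck_map_on_has_derivative[OF f c d]]]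
        by (simp add: tangent_map_chart[OF f c d v] tangent_map_chart[OF f c d tangent_space_scale[OF v]])
    qed (auto simp: tangent_map_def)
  qed
  show ?thesis
  proof (cases "v = (\<lambda>c. 0)")
    case True
    have "gnorm g x v = 0" using gnorm_scale[OF v, of 0] True by simp
    moreover have "gnorm g (f x) (tangent_map \<A> f x v) = 0"
      using gnorm_scale[OF tangent_map_tangent[OF f v], of 0] scale[of 0] True by simp
    ultimately show ?thesis by simp
  next
    case False
    then have n: "0 < gnorm g x v" by (rule gnorm_pos[OF v])
    let ?r = "inverse (gnorm g x v)"
    have "gnorm g (f x) (tangent_map \<A> f x (\<lambda>c. ?r *\<^sub>R v c)) \<le> tangent_opnorm \<A> g f x"
      by (rule unit[OF tangent_space_scale[OF v]]) (use n gnorm_scale[OF v, of ?r] in simp)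
    then show ?thesis
      unfolding scale gnorm_scale[OF tangent_map_tangent[OF f v]] using n by (simp add: field_simps)
  qed
qed

end

section \<open>Paths of a partial flow\<close>

context manifold begin

section \<open>Coordinate balls, and joint continuity of the flow in time and space\<close>

lemma chart_cball:
  assumes "c \<in> \<A>" "x \<in> fst c" "open V" "x \<in> V"
  obtains r where "0 < r" "cball (snd c x) r \<subseteq> snd c ` fst c" "chart_inv c ` cball (snd c x) r \<subseteq> V"
proof -
  obtain e where e: "0 < e" "\<And>p. dist p (snd c x) < e \<Longrightarrow> p \<in> snd c ` fst c \<and> chart_inv c p \<in> V"
    using eventually_chart_inv[OF assms] unfolding eventually_nhds_metric by blast
  have "p \<in> snd c ` fst c \<and> chart_inv c p \<in> V" if "p \<in> cball (snd c x) (e / 2)" for p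
    by (rule e(2)) (use that e(1) in \<open>simp add: dist_commute\<close>)
  then show ?thesis using e(1) by (intro that[of "e / 2"]) auto
qed

lemma chart_ball:
  assumes "c \<in> \<A>" "x \<in> fst c" "0 < r" "cball (snd c x) r \<subseteq> snd c ` fst c"
  shows "open (chart_inv c ` ball (snd c x) r)" "x \<in> chart_inv c ` ball (snd c x) r"
    "connected (chart_inv c ` ball (snd c x) r)" "compact (chart_inv c ` cball (snd c x) r)"
proof -
  have sub: "ball (snd c x) r \<subseteq> snd c ` fst c" using assms(4) ball_subset_cball by blast
  show "open (chart_inv c ` ball (snd c x) r)" by (rule open_chart_inv_image[OF assms(1) open_ball sub])
  show "x \<in> chart_inv c ` ball (snd c x) r"
    using assms chart_inverse[OF assms(1,2)] by (intro image_eqI[of _ _ "snd c x"]) auto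
  show "connected (chart_inv c ` ball (snd c x) r)"
    by (rule connected_continuous_image[OF continuous_on_subset[OF continuous_on_chart_inv[OF assms(1)] sub] connected_ball])
  show "compact (chart_inv c ` cball (snd c x) r)"
    by (rule compact_continuous_image[OF continuous_on_subset[OF continuous_on_chart_inv[OF assms(1)] assms(4)] compact_cball])
qed

text \<open>The clauses that \<open>partial_flow\<close> imposes on almost every path, for one fixed
  path, so that the arguments about the flow become deterministic.\<close>

definition pathwise_flow :: "(real \<Rightarrow> 'a \<Rightarrow> 'a) \<Rightarrow> ('a \<Rightarrow> ereal) \<Rightarrow> bool" where
  "pathwise_flow f \<zeta> \<longleftrightarrow> (\<forall>x. 0 < \<zeta> x \<and> f 0 x = x) \<and>
     (\<forall>t\<ge>0. open {x. ereal t < \<zeta> x} \<and> C1_diffeo_onto_open \<A> (f t) {x. ereal t < \<zeta> x} \<and>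
        C1_compact_continuous_at \<A> f (\<lambda>s. {x. ereal s < \<zeta> x}) t)"

text \<open>On a compact coordinate ball around \<open>x0\<close> the maps at times near
  \<open>t0\<close> are uniformly close to \<open>f t0\<close>, and \<open>f t0\<close> itself is
  continuous; each contributes \<open>r / 2\<close> in the target chart. The domain condition comes
  with the convergence.\<close>

lemma pathwise_flow_nbhd:
  assumes f: "pathwise_flow f \<zeta>" and t0: "0 \<le> t0" "ereal t0 < \<zeta> x0" and V: "open V" "f t0 x0 \<in> V"
  obtains T N where "open T" "t0 \<in> T" "open N" "x0 \<in> N"
    "\<And>s x. s \<in> T \<Longrightarrow> 0 \<le> s \<Longrightarrow> x \<in> N \<Longrightarrow> ereal s < \<zeta> x \<and> f s x \<in> V"
proof -
  let ?D = "\<lambda>s. {x. ereal s < \<zeta> x}"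
  have D: "open (?D t0)" and diffeo: "C1_diffeo_onto_open \<A> (f t0) (?D t0)"
    and cc: "C1_compact_continuous_at \<A> f ?D t0"
    using f t0(1) unfolding pathwise_flow_def by blast+
  have cont: "continuous_on (?D t0) (f t0)"
    using diffeo unfolding C1_diffeo_onto_open_def Ck_map_on_def by blast
  obtain c where c: "c \<in> \<A>" "x0 \<in> fst c" by (rule chart_exists)
  obtain c' where c': "c' \<in> \<A>" "f t0 x0 \<in> fst c'" by (rule chart_exists)
  obtain r where r: "0 < r" "cball (snd c' (f t0 x0)) r \<subseteq> snd c' ` fst c'"
    "chart_inv c' ` cball (snd c' (f t0 x0)) r \<subseteq> V"
    by (rule chart_cball[OF c' V])
  let ?B = "\<lambda>r. chart_inv c' ` ball (snd c' (f t0 x0)) r"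
  have r2: "0 < r / 2" "cball (snd c' (f t0 x0)) (r / 2) \<subseteq> snd c' ` fst c'"
    using r(1,2) subset_cball[of "r / 2" r "snd c' (f t0 x0)"] by auto
  note B = chart_ball[OF c' r2]
  define O' where "O' = ?D t0 \<inter> f t0 -` ?B (r / 2)"
  have "open O'" unfolding O'_def
    using continuous_on_open_vimage[OF D] cont B(1) by (metis Int_commute)
  moreover have "x0 \<in> O'" using t0(2) B(2) by (simp add: O'_def)
  ultimately obtain q where q: "0 < q" "cball (snd c x0) q \<subseteq> snd c ` fst c" "chart_inv c ` cball (snd c x0) q \<subseteq> O'"
    by (rule chart_cball[OF c])
  note N = chart_ball[OF c q(1,2)]
  let ?K = "chart_inv c ` cball (snd c x0) q"
  have inc': "f t0 x \<in> fst c'" if "x \<in> ?K" for x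
  proof -
    have "f t0 x \<in> ?B (r / 2)" using q(3) that by (auto simp: O'_def)
    then obtain p where "p \<in> ball (snd c' (f t0 x0)) (r / 2)" "f t0 x = chart_inv c' p" by blast
    moreover from this(1) have "p \<in> snd c' ` fst c'" by (intro subsetD[OF r2(2)]) simp
    ultimately show ?thesis using chart_inv_in[OF c'(1), of p] by simp
  qed
  have near: "dist (snd c' (f t0 x)) (snd c' (f t0 x0)) < r / 2" if "x \<in> ?K" for x
  proof -
    have "f t0 x \<in> ?B (r / 2)" using q(3) that by (auto simp: O'_def)
    then obtain p where p: "p \<in> ball (snd c' (f t0 x0)) (r / 2)" "f t0 x = chart_inv c' p" by blast
    moreover from this(1) have "p \<in> snd c' ` fst c'" by (intro subsetD[OF r2(2)]) simp
    ultimately have "snd c' (f t0 x) = p" using inverse_chart[OF c'(1), of p] by simp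
    then show ?thesis using p by (simp add: dist_commute)
  qed
  have good: "y \<in> V" if "y \<in> fst c'" "dist (snd c' y) (snd c' (f t0 x0)) < r" for y
  proof -
    have "y = chart_inv c' (snd c' y)" using chart_inverse[OF c'(1) that(1)] by simp
    then show ?thesis using r(3) that(2) by (auto simp: dist_commute intro!: subsetD[OF r(3)] image_eqI[of _ _ "snd c' y"])
  qed
  have Kc: "?K \<subseteq> fst c \<inter> ?D t0"
    using q(2,3) chart_inv_in[OF c(1)] by (auto simp: O'_def)
  have fK: "f t0 ` ?K \<subseteq> fst c'" using inc' by blast
  from cc[unfolded C1_compact_continuous_at_def, rule_format, OF c(1) c'(1), of ?K "r / 2"] N(4) Kc fK r2(1)
  have "\<forall>\<^sub>F s in at t0 within {0..}. ?K \<subseteq> ?D s \<and> f s ` ?K \<subseteq> fst c' \<and>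
      (\<forall>x\<in>?K. dist (snd c' (f s x)) (snd c' (f t0 x)) < r / 2)"
    by (auto elim!: eventually_mono)
  then obtain T where T: "open T" "t0 \<in> T" "\<And>s. s \<in> T \<Longrightarrow> s \<noteq> t0 \<Longrightarrow> 0 \<le> s \<Longrightarrow>
      ?K \<subseteq> ?D s \<and> f s ` ?K \<subseteq> fst c' \<and> (\<forall>x\<in>?K. dist (snd c' (f s x)) (snd c' (f t0 x)) < r / 2)"
    unfolding eventually_at_topological by auto
  show ?thesis
  proof (rule that[OF T(1,2) N(1,2)])
    fix s x assume s: "s \<in> T" "0 \<le> s" and "x \<in> chart_inv c ` ball (snd c x0) q"
    then have x: "x \<in> ?K" using ball_subset_cball by blast
    \<comment> \<open>The convergence is along times different from \<open>t0\<close>, so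
      \<open>s = t0\<close> is checked directly.\<close>
    have "?K \<subseteq> ?D s \<and> f s ` ?K \<subseteq> fst c' \<and> (\<forall>x\<in>?K. dist (snd c' (f s x)) (snd c' (f t0 x)) < r / 2)"
      using T(3)[of s] s Kc fK r2(1) by (cases "s = t0") auto
    then have "ereal s < \<zeta> x" "f s x \<in> fst c'" "dist (snd c' (f s x)) (snd c' (f t0 x)) < r / 2"
      using x by auto
    moreover from this(3) near[OF x] have "dist (snd c' (f s x)) (snd c' (f t0 x0)) < r"
      using dist_triangle_half_r[of "snd c' (f t0 x)" "snd c' (f s x)" r "snd c' (f t0 x0)"] by (simp add: dist_commute)
    ultimately show "ereal s < \<zeta> x \<and> f s x \<in> V" using good by simp
  qed
qed

text \<open>Times are real but only nonnegative ones carry information, so the relatively open set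
  of pairs is given as the trace of an open set of the whole product, ready for the tube
  lemma.\<close>

lemma pathwise_flow_open:
  assumes f: "pathwise_flow f \<zeta>" and V: "open V"
  obtains O' where "open O'" "\<And>t x. 0 \<le> t \<Longrightarrow> (t, x) \<in> O' \<longleftrightarrow> ereal t < \<zeta> x \<and> f t x \<in> V"
proof -
  define \<T> where "\<T> = {T \<times> N | T N. open T \<and> open N \<and> (\<forall>s\<in>T. 0 \<le> s \<longrightarrow> (\<forall>x\<in>N. ereal s < \<zeta> x \<and> f s x \<in> V))}"
  have "open (\<Union>\<T>)" by (auto simp: \<T>_def open_Times)
  moreover have "(t, x) \<in> \<Union>\<T> \<longleftrightarrow> ereal t < \<zeta> x \<and> f t x \<in> V" if t: "0 \<le> t" for t x
  proof
    assume "(t, x) \<in> \<Union>\<T>"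
    then show "ereal t < \<zeta> x \<and> f t x \<in> V" using t unfolding \<T>_def by blast
  next
    assume "ereal t < \<zeta> x \<and> f t x \<in> V"
    then obtain T N where "open T" "t \<in> T" "open N" "x \<in> N"
      "\<And>s x. s \<in> T \<Longrightarrow> 0 \<le> s \<Longrightarrow> x \<in> N \<Longrightarrow> ereal s < \<zeta> x \<and> f s x \<in> V"
      using pathwise_flow_nbhd[OF f t _ V, of x] by blast
    then show "(t, x) \<in> \<Union>\<T>" unfolding \<T>_def by blast
  qed
  ultimately show ?thesis by (rule that)
qed

lemma pathwise_flow_continuous:
  assumes f: "pathwise_flow f \<zeta>"
  shows "continuous_on {(t, x). 0 \<le> t \<and> ereal t < \<zeta> x} (\<lambda>(t, x). f t x)"
  unfolding continuous_on_topological
proof (intro ballI allI impI)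
  fix p V assume p: "p \<in> {(t, x). 0 \<le> t \<and> ereal t < \<zeta> x}" and V: "open V" "(case p of (t, x) \<Rightarrow> f t x) \<in> V"
  obtain O' where O': "open O'" "\<And>t x. 0 \<le> t \<Longrightarrow> (t, x) \<in> O' \<longleftrightarrow> ereal t < \<zeta> x \<and> f t x \<in> V"
    using pathwise_flow_open[OF f V(1)] by blast
  show "\<exists>A. open A \<and> p \<in> A \<and> (\<forall>y\<in>{(t, x). 0 \<le> t \<and> ereal t < \<zeta> x}. y \<in> A \<longrightarrow> (case y of (t, x) \<Rightarrow> f t x) \<in> V)"
    using O' p V(2) by (intro exI[of _ O']) auto
qed

lemma pathwise_flow_tube_time:
  assumes f: "pathwise_flow f \<zeta>" and V: "open V" and K: "compact K" and t: "0 \<le> t"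
    and fK: "\<And>x. x \<in> K \<Longrightarrow> ereal t < \<zeta> x \<and> f t x \<in> V"
  obtains \<delta> where "0 < \<delta>" "\<And>s x. 0 \<le> s \<Longrightarrow> \<bar>s - t\<bar> < \<delta> \<Longrightarrow> x \<in> K \<Longrightarrow> ereal s < \<zeta> x \<and> f s x \<in> V"
proof -
  obtain O' where O': "open O'" "\<And>t x. 0 \<le> t \<Longrightarrow> (t, x) \<in> O' \<longleftrightarrow> ereal t < \<zeta> x \<and> f t x \<in> V"
    using pathwise_flow_open[OF f V] by blast
  have "{t} \<times> K \<subseteq> O'" using O'(2)[OF t] fK by auto
  from Elementary_Topology.tube_lemma[OF K O'(1) this]
  obtain T where T: "t \<in> T" "open T" "T \<times> K \<subseteq> O'" by blast
  from T(1,2) obtain \<delta> where "0 < \<delta>" "\<And>s. dist s t < \<delta> \<Longrightarrow> s \<in> T" by (meson open_dist)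
  then show ?thesis using T(3) O'(2) by (intro that[of \<delta>]) (auto simp: dist_real_def)
qed

text \<open>The tube is taken around \<open>x\<close> over the compact time interval; swapping
  coordinates puts the compact factor where the tube lemma expects it.\<close>

lemma pathwise_flow_tube_space:
  assumes f: "pathwise_flow f \<zeta>" and V: "open V"
    and fx: "\<And>s. 0 \<le> s \<Longrightarrow> s \<le> t \<Longrightarrow> ereal s < \<zeta> x \<and> f s x \<in> V"
  obtains N where "open N" "x \<in> N" "\<And>s y. 0 \<le> s \<Longrightarrow> s \<le> t \<Longrightarrow> y \<in> N \<Longrightarrow> ereal s < \<zeta> y \<and> f s y \<in> V"
proof -
  obtain O' where O': "open O'" "\<And>t x. 0 \<le> t \<Longrightarrow> (t, x) \<in> O' \<longleftrightarrow> ereal t < \<zeta> x \<and> f t x \<in> V"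
    using pathwise_flow_open[OF f V] by blast
  have swap: "open (prod.swap -` O')" using O'(1) by (rule open_vimage) (intro continuous_on_swap)
  have "{x} \<times> {0..t} \<subseteq> prod.swap -` O'" using O'(2) fx by auto
  from Elementary_Topology.tube_lemma[OF compact_Icc swap this]
  obtain N where N: "x \<in> N" "open N" "N \<times> {0..t} \<subseteq> prod.swap -` O'" by blast
  show ?thesis
  proof (rule that[OF N(2,1)])
    fix s y assume s: "0 \<le> s" "s \<le> t" "y \<in> N"
    then have "(y, s) \<in> prod.swap -` O'" by (intro subsetD[OF N(3)]) simp
    then show "ereal s < \<zeta> y \<and> f s y \<in> V" using O'(2)[OF s(1)] by simp
  qed
qed

text \<open>Survival of each point beyond \<open>t\<close> could still leave the infimum equal to
  \<open>t\<close>; compactness gives a common margin \<open>\<delta>\<close>.\<close>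

lemma pathwise_flow_less_INF:
  assumes f: "pathwise_flow f \<zeta>" and K: "compact K" and t: "0 \<le> t" and fK: "\<And>x. x \<in> K \<Longrightarrow> ereal t < \<zeta> x"
  shows "ereal t < (INF x\<in>K. \<zeta> x)"
proof -
  obtain \<delta> where d: "0 < \<delta>" "\<And>s x. 0 \<le> s \<Longrightarrow> \<bar>s - t\<bar> < \<delta> \<Longrightarrow> x \<in> K \<Longrightarrow> ereal s < \<zeta> x \<and> f s x \<in> UNIV"
    using pathwise_flow_tube_time[OF f open_UNIV K t] fK by blast
  have "ereal t < ereal (t + \<delta> / 2)" using d(1) by simp
  also have "\<dots> \<le> (INF x\<in>K. \<zeta> x)"
    using d t by (intro INF_greatest less_imp_le) auto
  finally show ?thesis .
qed

lemma pathwise_flow_INF_pos: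
  assumes f: "pathwise_flow f \<zeta>" and K: "compact K" shows "0 < (INF x\<in>K. \<zeta> x)"
  using pathwise_flow_less_INF[OF f K, of 0] f by (simp add: pathwise_flow_def zero_ereal_def)

text \<open>Agreement is known only for starting points in the dense set \<open>Q\<close>. If the
  flows differed at \<open>x\<close>, disjoint neighbourhoods of the two values and continuity in
  the starting point would make them differ at all nearby points, among them some \<open>q\<close>
  in \<open>Q\<close> whose path under \<open>h\<close> also stays in \<open>V\<close> up to
  \<open>t\<close>.\<close>

lemma pathwise_flow_agree:
  assumes f: "pathwise_flow f \<zeta>" and h: "pathwise_flow h (\<lambda>x. \<infinity>)" and V: "open V"
    and Q: "\<And>X. open X \<Longrightarrow> X \<noteq> {} \<Longrightarrow> \<exists>q\<in>Q. q \<in> X"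
    and agree: "\<And>q t s. q \<in> Q \<Longrightarrow> (\<And>s. 0 \<le> s \<Longrightarrow> s < t \<Longrightarrow> h s q \<in> V) \<Longrightarrow> 0 \<le> s \<Longrightarrow> s < t \<Longrightarrow> f s q = h s q"
    and x: "\<And>s. 0 \<le> s \<Longrightarrow> s \<le> t \<Longrightarrow> h s x \<in> V"
    and s: "0 \<le> s" "s < t" "ereal s < \<zeta> x"
  shows "f s x = h s x"
proof (rule ccontr)
  assume "f s x \<noteq> h s x"
  then obtain A B where AB: "open A" "open B" "f s x \<in> A" "h s x \<in> B" "A \<inter> B = {}"
    using hausdorff[of "f s x" "h s x"] by blast
  obtain T1 N1 where 1: "s \<in> T1" "open N1" "x \<in> N1" "\<And>s x. s \<in> T1 \<Longrightarrow> 0 \<le> s \<Longrightarrow> x \<in> N1 \<Longrightarrow> ereal s < \<zeta> x \<and> f s x \<in> A"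
    by (rule pathwise_flow_nbhd[OF f s(1,3) AB(1,3)]) blast
  obtain T2 N2 where 2: "s \<in> T2" "open N2" "x \<in> N2" "\<And>s x. s \<in> T2 \<Longrightarrow> 0 \<le> s \<Longrightarrow> x \<in> N2 \<Longrightarrow> ereal s < \<infinity> \<and> h s x \<in> B"
    by (rule pathwise_flow_nbhd[OF h s(1) _ AB(2,4)]) (simp, blast)
  obtain N3 where 3: "open N3" "x \<in> N3" "\<And>s y. 0 \<le> s \<Longrightarrow> s \<le> t \<Longrightarrow> y \<in> N3 \<Longrightarrow> ereal s < \<infinity> \<and> h s y \<in> V"
    by (rule pathwise_flow_tube_space[OF h V, of t x]) (use x in simp, blast)
  have "open (N1 \<inter> N2 \<inter> N3)" "N1 \<inter> N2 \<inter> N3 \<noteq> {}" using 1 2 3 by auto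
  then obtain q where q: "q \<in> Q" "q \<in> N1" "q \<in> N2" "q \<in> N3" using Q by blast
  have "f s q = h s q" by (rule agree[OF q(1) _ s(1,2)]) (use 3(3) q(4) in auto)
  with 1(4)[OF 1(1) s(1) q(2)] 2(4)[OF 2(1) s(1) q(3)] AB(5) show False by auto
qed

end

context riemannian begin

text \<open>Before \<open>S\<close> the cut-off flow \<open>h\<close> stays in the compact set
  \<open>C\<close>, where distances from \<open>x0\<close> are bounded. Were the explosion time of
  \<open>K\<close> at most \<open>S\<close>, the flow \<open>f\<close> would equal \<open>h\<close>
  up to explosion and the distances could not tend to infinity. The open set \<open>V\<close> around
  \<open>C\<close> leaves room to pass to neighbouring starting points.\<close>

lemma exit_before_explosion:
  assumes f: "pathwise_flow f \<zeta>" and h: "pathwise_flow h (\<lambda>x. \<infinity>)" and V: "open V"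
    and Q: "\<And>X. open X \<Longrightarrow> X \<noteq> {} \<Longrightarrow> \<exists>q\<in>Q. q \<in> X"
    and agree: "\<And>q t s. q \<in> Q \<Longrightarrow> (\<And>s. 0 \<le> s \<Longrightarrow> s < t \<Longrightarrow> h s q \<in> V) \<Longrightarrow> 0 \<le> s \<Longrightarrow> s < t \<Longrightarrow> f s q = h s q"
    and C: "compact C" "C \<subseteq> V" and K: "compact K" "K \<noteq> {}"
    and explosion: "(INF x\<in>K. \<zeta> x) < \<infinity> \<Longrightarrow>
      ((\<lambda>t. SUP x\<in>K. ereal (rdist \<A> g x0 (f t x))) \<longlongrightarrow> \<infinity>) (at_left (real_of_ereal (INF x\<in>K. \<zeta> x)))"
    and S: "S = (INF x\<in>K. Inf {ereal t |t. 0 \<le> t \<and> h t x \<notin> C})"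
  shows "\<And>s x. 0 \<le> s \<Longrightarrow> ereal s \<le> S \<Longrightarrow> x \<in> K \<Longrightarrow> ereal s < \<zeta> x \<and> f s x = h s x"
    and "0 \<le> S" and "S < \<infinity> \<Longrightarrow> S < (INF x\<in>K. \<zeta> x)"
proof -
  define Z where "Z = (INF x\<in>K. \<zeta> x)"
  have Z0: "0 < Z" unfolding Z_def by (rule pathwise_flow_INF_pos[OF f K(1)])
  have Zle: "Z \<le> \<zeta> x" if "x \<in> K" for x unfolding Z_def using that by (rule INF_lower)
  show S0: "0 \<le> S" unfolding S by (intro INF_greatest Inf_greatest) auto
  have hC: "h s x \<in> C" if "0 \<le> s" "ereal s < S" "x \<in> K" for s x
  proof (rule ccontr)
    assume "h s x \<notin> C"
    then have "Inf {ereal t |t. 0 \<le> t \<and> h t x \<notin> C} \<le> ereal s" using that(1) by (intro Inf_lower) auto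
    moreover have "S \<le> Inf {ereal t |t. 0 \<le> t \<and> h t x \<notin> C}" unfolding S using that(3) by (rule INF_lower)
    ultimately show False using that(2) by simp
  qed
  have fh: "f s x = h s x" if "0 \<le> s" "ereal s < S" "ereal s < \<zeta> x" "x \<in> K" for s x
  proof -
    note xK = that(4) and sz = that(3) and s0 = that(1) and sS = that(2)
    \<comment> \<open>Agreement is stated strictly before a time up to which the path stays in
      \<open>V\<close>, so a time \<open>t\<close> between \<open>s\<close> and \<open>S\<close> is
      inserted.\<close>
    obtain t where t: "ereal s < ereal t" "ereal t < S"
      using ereal_dense2[OF sS] by blast
    have hV: "h u x \<in> V" if "0 \<le> u" "u \<le> t" for u
    proof -
      have "ereal u \<le> ereal t" using that(2) by simp
      then have "ereal u < S" using t(2) by (rule le_less_trans)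
      then show ?thesis using hC[OF that(1) _ xK] C(2) by blast
    qed
    show ?thesis by (rule pathwise_flow_agree[OF f h V Q agree hV s0 _ sz]) (use t(1) in simp_all)
  qed
  have SZ: "S < Z" if ZI: "Z < \<infinity>"
  proof (rule ccontr)
    assume "\<not> S < Z"
    then have ZS: "Z \<le> S" by simp
    obtain T where T: "Z = ereal T" using ZI Z0 by (cases Z) auto
    then have T0: "0 < T" using Z0 by simp
    obtain b where b: "\<And>y. y \<in> C \<Longrightarrow> rdist \<A> g x0 y \<le> b" using rdist_bounded_on_compact[OF C(1)] by blast
    have "((\<lambda>t. SUP x\<in>K. ereal (rdist \<A> g x0 (f t x))) \<longlongrightarrow> \<infinity>) (at_left T)"
      using explosion ZI T unfolding Z_def by simp
    then have "\<forall>\<^sub>F t in at_left T. ereal b < (SUP x\<in>K. ereal (rdist \<A> g x0 (f t x)))"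
      by (rule order_tendstoD(1)) simp
    moreover have "\<forall>\<^sub>F t in at_left T. t \<in> {0<..<T}" by (rule eventually_at_left_real[OF T0])
    ultimately obtain s where s: "ereal b < (SUP x\<in>K. ereal (rdist \<A> g x0 (f s x)))" "s \<in> {0<..<T}"
      by (metis (mono_tags, lifting) eventually_conj eventually_happens trivial_limit_at_left_real)
    have "rdist \<A> g x0 (f s x) \<le> b" if "x \<in> K" for x
    proof -
      have "ereal s < Z" using s(2) T by simp
      then have "ereal s < S" "ereal s < \<zeta> x" using ZS Zle[OF that] by auto
      then have "f s x \<in> C" using fh[of s x] hC[of s x] that s(2) by simp
      then show ?thesis by (rule b)
    qed
    then have "(SUP x\<in>K. ereal (rdist \<A> g x0 (f s x))) \<le> ereal b" by (intro SUP_least) simp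
    with s(1) show False by simp
  qed
  show SZ': "S < (INF x\<in>K. \<zeta> x)" if "S < \<infinity>"
    using that SZ unfolding Z_def[symmetric] by (cases "Z < \<infinity>") (auto simp: less_top)
  fix s x assume s: "0 \<le> s" "ereal s \<le> S" "x \<in> K"
  have sz: "ereal s < \<zeta> x"
  proof (cases "S < \<infinity>")
    case True
    have "ereal s \<le> S" by fact
    also have "S < \<zeta> x" using SZ'[OF True] Zle[OF s(3)] unfolding Z_def by (rule less_le_trans)
    finally show ?thesis .
  next
    case False
    then have "\<not> Z < \<infinity>" using SZ by (metis less_trans)
    then have "\<zeta> x = \<infinity>" using Zle[OF s(3)] by (simp add: less_top top_ereal_def)
    then show ?thesis by simp
  qed
  have "f s x = h s x"
  proof (cases "s = 0")
    case True
    then show ?thesis using f h by (simp add: pathwise_flow_def)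
  next
    case False
    then have s0: "0 < s" using s by simp
    \<comment> \<open>At \<open>s = S\<close> only earlier times are covered by \<open>fh\<close>;
      equality follows by continuity from the left.\<close>
    show ?thesis
    proof (rule ccontr)
      assume "f s x \<noteq> h s x"
      then obtain A B where AB: "open A" "open B" "f s x \<in> A" "h s x \<in> B" "A \<inter> B = {}"
        using hausdorff[of "f s x" "h s x"] by blast
      obtain T1 N1 where 1: "open T1" "s \<in> T1" "x \<in> N1" "\<And>s x. s \<in> T1 \<Longrightarrow> 0 \<le> s \<Longrightarrow> x \<in> N1 \<Longrightarrow> ereal s < \<zeta> x \<and> f s x \<in> A"
        by (rule pathwise_flow_nbhd[OF f s(1) sz AB(1,3)]) blast
      obtain T2 N2 where 2: "open T2" "s \<in> T2" "x \<in> N2" "\<And>s x. s \<in> T2 \<Longrightarrow> 0 \<le> s \<Longrightarrow> x \<in> N2 \<Longrightarrow> ereal s < \<infinity> \<and> h s x \<in> B"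
        by (rule pathwise_flow_nbhd[OF h s(1) _ AB(2,4)]) (simp, blast)
      have "\<forall>\<^sub>F u in at_left s. u \<in> T1 \<inter> T2"
        using 1(1,2) 2(1,2) by (intro eventually_at_topological[THEN iffD2] exI[of _ "T1 \<inter> T2"]) auto
      moreover have "\<forall>\<^sub>F u in at_left s. u \<in> {0<..<s}" by (rule eventually_at_left_real[OF s0])
      ultimately obtain u where u: "u \<in> T1 \<inter> T2" "u \<in> {0<..<s}"
        by (metis (mono_tags, lifting) eventually_conj eventually_happens trivial_limit_at_left_real)
      have "ereal u < ereal s" using u(2) by simp
      then have "ereal u < S" using s(2) by (rule less_le_trans)
      then have "f u x = h u x" using u 1(4)[of u x] 1(3) by (intro fh[OF _ _ _ s(3)]) auto
      with 1(4)[of u x] 2(4)[of u x] 1(3) 2(3) u AB(5) show False by auto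
    qed
  qed
  with sz show "ereal s < \<zeta> x \<and> f s x = h s x" by simp
qed

text \<open>The image of \<open>{0..t} \<times> K\<close> under the flow is compact, hence inside
  \<open>U j\<close> for all large \<open>j\<close>. If \<open>S j\<close> were smaller than
  \<open>t\<close>, the cut-off flow would map all of \<open>K\<close> into the open set
  \<open>U j\<close> at the time \<open>S j\<close>, hence also shortly afterwards, and the exit
  would come later.\<close>

lemma exit_times_exhaust:
  assumes f: "pathwise_flow f \<zeta>" and h: "\<And>j. pathwise_flow (h j) (\<lambda>x. \<infinity>)"
    and U: "\<And>j. open (U j)" "\<And>j. U j \<subseteq> U (Suc j)" "(\<Union>j. U j) = UNIV"
    and K: "compact K"
    and S: "\<And>j. S j = (INF x\<in>K. Inf {ereal t |t. 0 \<le> t \<and> h j t x \<notin> closure (U j)})"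
    and agree: "\<And>j s x. 0 \<le> s \<Longrightarrow> ereal s \<le> S j \<Longrightarrow> x \<in> K \<Longrightarrow> ereal s < \<zeta> x \<and> f s x = h j s x"
    and t: "0 \<le> t" "ereal t < (INF x\<in>K. \<zeta> x)"
  shows "\<forall>\<^sub>F j in sequentially. ereal t \<le> S j"
proof -
  have inc: "U i \<subseteq> U j" if "i \<le> j" for i j
    using U(2) that by (rule lift_Suc_mono_le)
  have tz: "ereal s < \<zeta> x" if "s \<le> t" "x \<in> K" for s x
  proof -
    have "ereal s \<le> ereal t" using that by simp
    also have "\<dots> < \<zeta> x" using t(2) INF_lower[OF that(2)] by (rule less_le_trans)
    finally show ?thesis .
  qed
  have "continuous_on ({0..t} \<times> K) (\<lambda>(t, x). f t x)"
    by (rule continuous_on_subset[OF pathwise_flow_continuous[OF f]]) (use tz in auto)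
  then have comp: "compact ((\<lambda>(t, x). f t x) ` ({0..t} \<times> K))"
    by (rule compact_continuous_image) (intro compact_Times compact_Icc K)
  obtain J where J: "finite J" "(\<lambda>(t, x). f t x) ` ({0..t} \<times> K) \<subseteq> (\<Union>j\<in>J. U j)"
    by (rule compactE_image[OF comp, of UNIV U]) (use U(1,3) in auto)
  define m where "m = Max (insert 0 J)"
  have fU: "f s x \<in> U j" if "0 \<le> s" "s \<le> t" "x \<in> K" "m \<le> j" for s x j
  proof -
    have "f s x \<in> (\<lambda>(t, x). f t x) ` ({0..t} \<times> K)"
      using that by (intro image_eqI[of _ _ "(s, x)"]) auto
    then obtain i where "i \<in> J" "f s x \<in> U i" using J(2) by blast
    moreover from this have "i \<le> j" using J(1) that(4) Max_ge[of "insert 0 J" i] unfolding m_def by auto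
    ultimately show ?thesis using inc by blast
  qed
  have "ereal t \<le> S j" if mj: "m \<le> j" for j
  proof (rule ccontr)
    assume "\<not> ereal t \<le> S j"
    then have lt: "S j < ereal t" by simp
    have S0: "0 \<le> S j" unfolding S by (intro INF_greatest Inf_greatest) auto
    then obtain s where s: "S j = ereal s" "0 \<le> s" "s < t" using lt by (cases "S j") auto
    have "ereal s < \<infinity> \<and> h j s x \<in> U j" if "x \<in> K" for x
      using agree[OF s(2) _ that, of j] s fU[of s x j] that mj by simp
    then obtain \<delta> where d: "0 < \<delta>" "\<And>u x. 0 \<le> u \<Longrightarrow> \<bar>u - s\<bar> < \<delta> \<Longrightarrow> x \<in> K \<Longrightarrow> ereal u < \<infinity> \<and> h j u x \<in> U j"
      using pathwise_flow_tube_time[OF h U(1) K s(2)] by metis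
    have "h j u x \<in> closure (U j)" if u: "0 \<le> u" "u < s + \<delta>" "x \<in> K" for u x
    proof (cases "u < s")
      case True
      show ?thesis
      proof (rule ccontr)
        assume "h j u x \<notin> closure (U j)"
        then have "Inf {ereal t |t. 0 \<le> t \<and> h j t x \<notin> closure (U j)} \<le> ereal u" using u(1) by (intro Inf_lower) auto
        moreover have "S j \<le> Inf {ereal t |t. 0 \<le> t \<and> h j t x \<notin> closure (U j)}" unfolding S using u(3) by (rule INF_lower)
        ultimately have "S j \<le> ereal u" by (rule order_trans[rotated])
        then show False using True s(1) by simp
      qed
    next
      case False
      then show ?thesis using d(2)[of u x] u closure_subset by auto
    qed
    then have "ereal (s + \<delta>) \<le> S j"
      unfolding S by (intro INF_greatest Inf_greatest) (force simp: not_less[symmetric])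
    then show False using s(1) d(1) by simp
  qed
  then show ?thesis by (auto simp: eventually_sequentially)
qed

end

section \<open>Solutions stopped on leaving a closed set\<close>

lemma space_augment [simp]: "space (augment P \<F> t) = space P"
  by (simp add: augment_def space_measure_of_conv)

text \<open>An intersection of sigma-algebras is one already, so the outer \<open>sigma\<close> in
  \<open>augment\<close> adds nothing.\<close>

lemma sets_augment:
  assumes "\<And>s. t < s \<Longrightarrow> sets (\<F> s) \<subseteq> sets P"
  shows "sets (augment P \<F> t) = (\<Inter>s\<in>{t<..}. sigma_sets (space P) (sets (\<F> s) \<union> null_sets P))"
proof -
  let ?G = "\<lambda>s. sets (\<F> s) \<union> null_sets P"
  let ?I = "\<Inter>s\<in>{t<..}. sigma_sets (space P) (?G s)"
  have G: "?G s \<subseteq> Pow (space P)" if "t < s" for s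
    using assms[OF that] sets.space_closed[of P] by auto
  have sub: "sigma_sets (space P) (?G s) \<subseteq> Pow (space P)" if "t < s" for s
    using G[OF that] by (rule sigma_sets_into_sp[THEN PowI, THEN subsetI])
  have "?I \<subseteq> Pow (space P)" using INT_lower[of "t + 1" "{t<..}"] sub[of "t + 1"] by (rule order_trans) simp_all
  then have "sets (augment P \<F> t) = sigma_sets (space P) ?I"
    by (simp add: augment_def)
  also have "\<dots> = ?I"
  proof (rule antisym)
    show "sigma_sets (space P) ?I \<subseteq> ?I"
    proof (rule INT_greatest)
      fix s assume "s \<in> {t<..}"
      then have "sigma_sets (space P) ?I \<subseteq> sigma_sets (space P) (sigma_sets (space P) (?G s))"
        by (intro sigma_sets_mono) auto
      also have "\<dots> = sigma_sets (space P) (?G s)"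
        using G \<open>s \<in> {t<..}\<close> by (intro sigma_sets_sigma_sets_eq) auto
      finally show "sigma_sets (space P) ?I \<subseteq> sigma_sets (space P) (?G s)" .
    qed
  qed auto
  finally show ?thesis .
qed

text \<open>As \<open>P\<close> need not be complete and the paths are continuous only almost surely, the exit time itself
  need not be a stopping time of the augmented filtration; its version over rational times is one.\<close>

definition rational_exit :: "'a set \<Rightarrow> (real \<Rightarrow> 'w \<Rightarrow> 'a) \<Rightarrow> 'w \<Rightarrow> ereal" where
  "rational_exit C y \<omega> = (INF r\<in>{r\<in>\<rat>. 0 \<le> r \<and> y r \<omega> \<notin> C}. ereal r)"

lemma rational_exit_ge:
  assumes "\<And>u. 0 \<le> u \<Longrightarrow> u < t \<Longrightarrow> y u \<omega> \<in> C" shows "ereal t \<le> rational_exit C y \<omega>"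
  unfolding rational_exit_def using assms by (intro INF_greatest) (force simp: not_less[symmetric])

text \<open>The complement of a closed set is open, so a continuous path outside \<open>C\<close> at
  time \<open>s\<close> is still outside at rational times just after \<open>s\<close>, which can be
  taken before the supposed exit.\<close>

lemma before_rational_exit:
  fixes y :: "real \<Rightarrow> 'w \<Rightarrow> 'a::topological_space"
  assumes cont: "continuous_on {0..} (\<lambda>t. y t \<omega>)" and C: "closed C"
    and s: "0 \<le> s" "ereal s < rational_exit C y \<omega>"
  shows "y s \<omega> \<in> C"
proof (rule ccontr)
  assume "y s \<omega> \<notin> C"
  then obtain A where A: "open A" "s \<in> A" "\<forall>u\<in>{0..}. u \<in> A \<longrightarrow> y u \<omega> \<in> - C"
    using cont C s(1) unfolding continuous_on_topological by (metis ComplI atLeast_iff open_Compl)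
  obtain e where e: "0 < e" "\<And>u. dist u s < e \<Longrightarrow> u \<in> A" using A(1,2) by (meson open_dist)
  obtain t where t: "ereal s < ereal t" "ereal t < rational_exit C y \<omega>"
    using ereal_dense2[OF s(2)] by blast
  obtain r where r: "r \<in> \<rat>" "s < r" "r < min t (s + e)"
    using Rats_dense_in_real[of s "min t (s + e)"] t(1) e(1) by auto
  have "y r \<omega> \<notin> C" using A(3) e(2)[of r] r s(1) by (auto simp: dist_real_def)
  then have "rational_exit C y \<omega> \<le> ereal r"
    unfolding rational_exit_def using r s(1) by (intro INF_lower) auto
  also have "\<dots> < ereal t" using r by simp
  finally show False using t(2) by simp
qed

locale filtration =
  fixes P :: "'w measure" and \<F> :: "real \<Rightarrow> 'w measure"
  assumes filtered: "filtered_prob_space P \<F>"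
begin

sublocale prob_space P using filtered by (simp add: filtered_prob_space_def)

lemma filtration_subset: "0 \<le> t \<Longrightarrow> sets (\<F> t) \<subseteq> sets P"
  using filtered by (simp add: filtered_prob_space_def subalgebra_def)

lemma sets_augment_filtration:
  "0 \<le> t \<Longrightarrow> sets (augment P \<F> t) = (\<Inter>s\<in>{t<..}. sigma_sets (space P) (sets (\<F> s) \<union> null_sets P))"
  by (rule sets_augment) (simp add: filtration_subset)

lemma augment_mono:
  assumes "0 \<le> s" "s \<le> t" shows "sets (augment P \<F> s) \<subseteq> sets (augment P \<F> t)"
  using assms by (simp add: sets_augment_filtration) (intro INF_superset_mono, auto)

lemma augment_right_continuous:
  assumes "0 \<le> t" "\<And>s. t < s \<Longrightarrow> E \<in> sets (augment P \<F> s)" shows "E \<in> sets (augment P \<F> t)"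
proof -
  have "E \<in> sigma_sets (space P) (sets (\<F> s) \<union> null_sets P)" if "t < s" for s
    using assms(2)[of "(s + t) / 2"] that assms(1) by (simp add: sets_augment_filtration)
  then show ?thesis using assms(1) by (simp add: sets_augment_filtration)
qed

lemma augment_subset: "0 \<le> t \<Longrightarrow> sets (augment P \<F> t) \<subseteq> sets P"
proof -
  assume t: "0 \<le> t"
  then have "sets (augment P \<F> t) \<subseteq> sigma_sets (space P) (sets (\<F> (t + 1)) \<union> null_sets P)"
    by (auto simp: sets_augment_filtration)
  also have "\<dots> \<subseteq> sets P"
    using filtration_subset[of "t + 1"] t by (intro sets.sigma_sets_subset) auto
  finally show ?thesis .
qed

text \<open>The exit time is at most \<open>t\<close> exactly if it is below every rational
  \<open>q\<close> in \<open>{t<..<s}\<close>, and being below \<open>q\<close> means a rational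
  visit to the complement of \<open>C\<close> before \<open>q\<close>. This event belongs to the
  augmented filtration at each \<open>s > t\<close>, and right continuity brings it down to
  \<open>t\<close>.\<close>

lemma stop_time_rational_exit:
  fixes y :: "real \<Rightarrow> 'w \<Rightarrow> 'a::topological_space"
  assumes y: "\<And>t G. 0 \<le> t \<Longrightarrow> open G \<Longrightarrow> {\<omega>\<in>space P. y t \<omega> \<in> G} \<in> sets (augment P \<F> t)" and C: "closed C"
  shows "stop_time P (augment P \<F>) (rational_exit C y)"
  unfolding stop_time_def
proof (intro conjI ballI allI impI)
  fix \<omega> show "0 \<le> rational_exit C y \<omega>"
    unfolding rational_exit_def by (intro INF_greatest) auto
next
  fix t :: real assume t: "0 \<le> t"
  show "{\<omega> \<in> space P. rational_exit C y \<omega> \<le> ereal t} \<in> sets (augment P \<F> t)"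
  proof (rule augment_right_continuous[OF t])
    fix s assume s: "t < s"
    have eq: "rational_exit C y \<omega> \<le> ereal t \<longleftrightarrow>
        (\<forall>q\<in>\<rat> \<inter> {t<..<s}. \<exists>r\<in>\<rat> \<inter> {0..<q}. y r \<omega> \<in> - C)" for \<omega>
    proof -
      have "rational_exit C y \<omega> \<le> ereal t \<longleftrightarrow> (\<forall>q\<in>\<rat> \<inter> {t<..<s}. rational_exit C y \<omega> < ereal q)"
      proof (intro iffI ballI)
        fix q assume "rational_exit C y \<omega> \<le> ereal t" "q \<in> \<rat> \<inter> {t<..<s}"
        then show "rational_exit C y \<omega> < ereal q" by (auto intro: le_less_trans)
      next
        assume *: "\<forall>q\<in>\<rat> \<inter> {t<..<s}. rational_exit C y \<omega> < ereal q"
        show "rational_exit C y \<omega> \<le> ereal t"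
        proof (rule ccontr)
          assume "\<not> rational_exit C y \<omega> \<le> ereal t"
          then obtain u where u: "ereal t < ereal u" "ereal u < rational_exit C y \<omega>"
            using ereal_dense2[of "ereal t" "rational_exit C y \<omega>"] by (auto simp: not_le)
          obtain q where "q \<in> \<rat>" "t < q" "q < min s u"
            using Rats_dense_in_real[of t "min s u"] u(1) s by auto
          with * have "rational_exit C y \<omega> < ereal q" by auto
          also have "ereal q < ereal u" using \<open>q < min s u\<close> by simp
          finally show False using u(2) by simp
        qed
      qed
      moreover have "rational_exit C y \<omega> < ereal q \<longleftrightarrow> (\<exists>r\<in>\<rat> \<inter> {0..<q}. y r \<omega> \<in> - C)" for q
        unfolding rational_exit_def INF_less_iff by auto
      ultimately show ?thesis by simp
    qed
    have "{\<omega> \<in> space P. y r \<omega> \<in> - C} \<in> sets (augment P \<F> s)" if "0 \<le> r" "r < s" for r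
      using y[OF that(1) open_Compl[OF C]] augment_mono[of r s] that by auto
    then have 1: "{\<omega> \<in> space (augment P \<F> s). y r \<omega> \<in> - C} \<in> sets (augment P \<F> s)" if "0 \<le> r" "r < s" for r
      using that by simp
    have "{\<omega> \<in> space (augment P \<F> s). \<forall>q\<in>\<rat> \<inter> {t<..<s}. \<exists>r\<in>\<rat> \<inter> {0..<q}. y r \<omega> \<in> - C} \<in> sets (augment P \<F> s)"
      by (intro sets.sets_Collect_countable_All' sets.sets_Collect_countable_Ex' countable_Int1 countable_rat 1) auto
    then show "{\<omega> \<in> space P. rational_exit C y \<omega> \<le> ereal t} \<in> sets (augment P \<F> s)"
      by (simp add: eq)
  qed
qed

text \<open>Before the exit the path lies in \<open>C\<close>, where both pairs of coefficients
  coincide. The same semimartingale and the same integrals \<open>I\<close> work, since the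
  trapezoidal sums at time \<open>t\<close> see the path only at times up to
  \<open>t\<close>.\<close>

lemma local_solution_cutoff:
  fixes B :: "real \<Rightarrow> 'w \<Rightarrow> real ^ 'm::finite" and y :: "real \<Rightarrow> 'w \<Rightarrow> 'a::topological_space"
    and \<A> :: "('a, 'e::euclidean_space) chart set"
  assumes sol: "local_solution \<A> P \<F> B (\<lambda>x e c. lam x *\<^sub>R X x e c) (\<lambda>x c. lam x *\<^sub>R A x c) x y (\<lambda>\<omega>. \<infinity>)"
    and C: "closed C" and lam: "\<And>z. z \<in> C \<Longrightarrow> lam z = 1"
  shows "local_solution \<A> P \<F> B X A x y (rational_exit C y)"
proof -
  let ?\<zeta> = "rational_exit C y" and ?X = "\<lambda>x e c. lam x *\<^sub>R X x e c" and ?A = "\<lambda>x c. lam x *\<^sub>R A x c"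
  have adapted: "{\<omega>\<in>space P. y t \<omega> \<in> G} \<in> sets (augment P \<F> t)" if "0 \<le> t" "open G" for t G
    using sol that unfolding local_solution_def by auto
  have stop: "stop_time P (augment P \<F>) ?\<zeta>" by (rule stop_time_rational_exit[OF adapted C])
  have "AE \<omega> in P. continuous_on {t. 0 \<le> t \<and> ereal t < \<infinity>} (\<lambda>t. y t \<omega>) \<and> (0 < (\<infinity>::ereal) \<longrightarrow> y 0 \<omega> = x)"
    using sol unfolding local_solution_def by blast
  moreover have "{t. 0 \<le> t \<and> ereal t < \<infinity>} = {0..}" by auto
  ultimately have cont: "AE \<omega> in P. continuous_on {0..} (\<lambda>t. y t \<omega>) \<and> y 0 \<omega> = x" by simp
  have X: "?X (y s \<omega>) = X (y s \<omega>)" and A: "?A (y s \<omega>) = A (y s \<omega>)"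
    if "continuous_on {0..} (\<lambda>t. y t \<omega>)" "0 \<le> s" "ereal s < ?\<zeta> \<omega>" for s \<omega>
    using lam[OF before_rational_exit[of y \<omega>, OF that(1) C that(2,3)]] by simp_all
  \<comment> \<open>The null set of discontinuous paths is fixed once; it is added to each
    exceptional set \<open>N\<close> of the integral without changing its measure.\<close>
  obtain N0 where N0: "N0 \<in> null_sets P" "\<And>\<omega>. \<omega> \<in> space P \<Longrightarrow> \<omega> \<notin> N0 \<Longrightarrow> continuous_on {0..} (\<lambda>t. y t \<omega>)"
    using cont by (elim AE_E) (auto simp: null_sets_def subset_eq)
  have "{\<omega>\<in>space P. ereal t < ?\<zeta> \<omega> \<and> y t \<omega> \<in> G} \<in> sets (augment P \<F> t)" if t: "0 \<le> t" "open G" for t G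
  proof -
    have "{\<omega>\<in>space P. ereal t < ?\<zeta> \<omega> \<and> y t \<omega> \<in> G} =
        {\<omega>\<in>space P. y t \<omega> \<in> G} - {\<omega>\<in>space P. ?\<zeta> \<omega> \<le> ereal t}" by auto
    moreover have "{\<omega>\<in>space P. ?\<zeta> \<omega> \<le> ereal t} \<in> sets (augment P \<F> t)"
      using stop t(1) by (simp add: stop_time_def)
    ultimately show ?thesis using adapted[OF t] by (simp add: sets.Diff)
  qed
  moreover have "AE \<omega> in P. continuous_on {t. 0 \<le> t \<and> ereal t < ?\<zeta> \<omega>} (\<lambda>t. y t \<omega>) \<and> (0 < ?\<zeta> \<omega> \<longrightarrow> y 0 \<omega> = x)"
    using cont by (rule eventually_mono) (auto intro: continuous_on_subset)
  moreover have "(\<exists>Z. continuous_semimartingale P (augment P \<F>) Z \<and>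
           (AE \<omega> in P. \<forall>t. 0 \<le> t \<and> ereal t < ?\<zeta> \<omega> \<longrightarrow> f (y t \<omega>) = Z t \<omega>)) \<and>
        (\<exists>I :: 'm \<Rightarrow> real \<Rightarrow> 'w \<Rightarrow> real.
           (\<forall>k. stratonovich_integral P ?\<zeta>
              (\<lambda>s \<omega>. dir_deriv \<A> f (y s \<omega>) (X (y s \<omega>) (axis k 1))) (\<lambda>s \<omega>. B s \<omega> $ k) (I k)) \<and>
           (AE \<omega> in P. \<forall>t. 0 \<le> t \<and> ereal t < ?\<zeta> \<omega> \<longrightarrow>
              f (y t \<omega>) = f x + (\<Sum>k\<in>UNIV. I k t \<omega>) +
                integral {0..t} (\<lambda>s. dir_deriv \<A> f (y s \<omega>) (A (y s \<omega>)))))"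
    if f: "test_function \<A> f" for f
  proof -
    obtain Z where Z: "continuous_semimartingale P (augment P \<F>) Z"
      "AE \<omega> in P. \<forall>t. 0 \<le> t \<and> ereal t < \<infinity> \<longrightarrow> f (y t \<omega>) = Z t \<omega>"
      using sol f unfolding local_solution_def by blast
    obtain I :: "'m \<Rightarrow> real \<Rightarrow> 'w \<Rightarrow> real" where
      I: "\<And>k. stratonovich_integral P (\<lambda>\<omega>. \<infinity>)
              (\<lambda>s \<omega>. dir_deriv \<A> f (y s \<omega>) (?X (y s \<omega>) (axis k 1))) (\<lambda>s \<omega>. B s \<omega> $ k) (I k)"
      and eq: "AE \<omega> in P. \<forall>t. 0 \<le> t \<and> ereal t < \<infinity> \<longrightarrow>
              f (y t \<omega>) = f x + (\<Sum>k\<in>UNIV. I k t \<omega>) +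
                integral {0..t} (\<lambda>s. dir_deriv \<A> f (y s \<omega>) (?A (y s \<omega>)))"
      using sol f unfolding local_solution_def by blast
    have "stratonovich_integral P ?\<zeta>
              (\<lambda>s \<omega>. dir_deriv \<A> f (y s \<omega>) (X (y s \<omega>) (axis k 1))) (\<lambda>s \<omega>. B s \<omega> $ k) (I k)" for k
      unfolding stratonovich_integral_def
    proof (intro allI impI)
      let ?Y = "\<lambda>s \<omega>. dir_deriv \<A> f (y s \<omega>) (X (y s \<omega>) (axis k 1))"
      let ?Y' = "\<lambda>s \<omega>. dir_deriv \<A> f (y s \<omega>) (?X (y s \<omega>) (axis k 1))"
      let ?b = "\<lambda>s \<omega>. B s \<omega> $ k"
      fix T \<epsilon> \<delta> :: real assume pos: "0 < T" "0 < \<epsilon>" "0 < \<delta>"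
      obtain \<eta> where \<eta>: "0 < \<eta>" and *: "\<forall>n s. partition_of T n s \<and> (\<forall>i<n. s (Suc i) - s i < \<eta>) \<longrightarrow>
         (\<exists>N\<in>sets P. measure P N < \<delta> \<and> {\<omega>\<in>space P. \<exists>t. 0 \<le> t \<and> t \<le> T \<and> ereal t < \<infinity> \<and>
              \<epsilon> < \<bar>trapezoid_sum n s ?Y' ?b t \<omega> - I k t \<omega>\<bar>} \<subseteq> N)"
        using I[of k, unfolded stratonovich_integral_def, rule_format, OF pos] by blast
      show "\<exists>\<eta>>0. \<forall>n s. partition_of T n s \<and> (\<forall>i<n. s (Suc i) - s i < \<eta>) \<longrightarrow>
         (\<exists>N\<in>sets P. measure P N < \<delta> \<and> {\<omega>\<in>space P. \<exists>t. 0 \<le> t \<and> t \<le> T \<and> ereal t < ?\<zeta> \<omega> \<and>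
              \<epsilon> < \<bar>trapezoid_sum n s ?Y ?b t \<omega> - I k t \<omega>\<bar>} \<subseteq> N)"
      proof (intro exI[of _ \<eta>] conjI \<eta> allI impI)
        fix n s assume ps: "partition_of T n s \<and> (\<forall>i<n. s (Suc i) - s i < \<eta>)"
        obtain N where N: "N \<in> sets P" "measure P N < \<delta>" "{\<omega>\<in>space P. \<exists>t. 0 \<le> t \<and> t \<le> T \<and> ereal t < \<infinity> \<and>
              \<epsilon> < \<bar>trapezoid_sum n s ?Y' ?b t \<omega> - I k t \<omega>\<bar>} \<subseteq> N"
          using *[rule_format, OF ps] by blast
        have s0: "0 \<le> s i" if "i \<le> n" for i
          using that
        proof (induction i)
          case (Suc i)
          moreover have "s i < s (Suc i)" using ps Suc.prems by (simp add: partition_of_def)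
          ultimately show ?case by simp
        qed (use ps in \<open>simp add: partition_of_def\<close>)
        have tr: "trapezoid_sum n s ?Y ?b t \<omega> = trapezoid_sum n s ?Y' ?b t \<omega>"
          if "\<omega> \<in> space P" "\<omega> \<notin> N0" "0 \<le> t" "ereal t < ?\<zeta> \<omega>" for t \<omega>
        proof -
          have "?Y (min (s i) t) \<omega> = ?Y' (min (s i) t) \<omega>" if "i \<le> n" for i
          proof -
            have "ereal (min (s i) t) \<le> ereal t" by simp
            then have "ereal (min (s i) t) < ?\<zeta> \<omega>" using \<open>ereal t < ?\<zeta> \<omega>\<close> by (rule le_less_trans)
            then have "?X (y (min (s i) t) \<omega>) = X (y (min (s i) t) \<omega>)"
              using s0[OF that] \<open>0 \<le> t\<close> by (intro X[OF N0(2)[OF \<open>\<omega> \<in> space P\<close> \<open>\<omega> \<notin> N0\<close>]]) auto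
            from fun_cong[OF this, of "axis k 1"] show ?thesis by (simp only:)
          qed
          then show ?thesis unfolding trapezoid_sum_def by (intro sum.cong) auto
        qed
        have "{\<omega>\<in>space P. \<exists>t. 0 \<le> t \<and> t \<le> T \<and> ereal t < ?\<zeta> \<omega> \<and>
              \<epsilon> < \<bar>trapezoid_sum n s ?Y ?b t \<omega> - I k t \<omega>\<bar>} \<subseteq> N \<union> N0"
        proof
          fix \<omega> assume "\<omega> \<in> {\<omega>\<in>space P. \<exists>t. 0 \<le> t \<and> t \<le> T \<and> ereal t < ?\<zeta> \<omega> \<and>
              \<epsilon> < \<bar>trapezoid_sum n s ?Y ?b t \<omega> - I k t \<omega>\<bar>}"
          then obtain t where t: "\<omega> \<in> space P" "0 \<le> t" "t \<le> T" "ereal t < ?\<zeta> \<omega>"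
              "\<epsilon> < \<bar>trapezoid_sum n s ?Y ?b t \<omega> - I k t \<omega>\<bar>" by blast
          show "\<omega> \<in> N \<union> N0"
          proof (cases "\<omega> \<in> N0")
            case False
            then have "\<epsilon> < \<bar>trapezoid_sum n s ?Y' ?b t \<omega> - I k t \<omega>\<bar>" using t tr by simp
            then have "\<omega> \<in> N" using t(1-3) by (intro subsetD[OF N(3)]) auto
            then show ?thesis by simp
          qed simp
        qed
        moreover have "N \<union> N0 \<in> sets P" using N(1) N0(1) by auto
        moreover have "measure P (N \<union> N0) < \<delta>"
          using N(1,2) N0(1) by (simp add: measure_Un_null_set)
        ultimately show "\<exists>N\<in>sets P. measure P N < \<delta> \<and> {\<omega>\<in>space P. \<exists>t. 0 \<le> t \<and> t \<le> T \<and> ereal t < ?\<zeta> \<omega> \<and>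
              \<epsilon> < \<bar>trapezoid_sum n s ?Y ?b t \<omega> - I k t \<omega>\<bar>} \<subseteq> N" by blast
      qed
    qed
    moreover have "AE \<omega> in P. \<forall>t. 0 \<le> t \<and> ereal t < ?\<zeta> \<omega> \<longrightarrow>
              f (y t \<omega>) = f x + (\<Sum>k\<in>UNIV. I k t \<omega>) +
                integral {0..t} (\<lambda>s. dir_deriv \<A> f (y s \<omega>) (A (y s \<omega>)))"
      using eq cont
    proof eventually_elim
      case (elim \<omega>)
      show ?case
      proof (intro allI impI)
        fix t assume t: "0 \<le> t \<and> ereal t < ?\<zeta> \<omega>"
        have "integral {0..t} (\<lambda>s. dir_deriv \<A> f (y s \<omega>) (?A (y s \<omega>))) =
            integral {0..t} (\<lambda>s. dir_deriv \<A> f (y s \<omega>) (A (y s \<omega>)))"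
        proof (rule integral_cong)
          fix s assume s: "s \<in> {0..t}"
          then have "ereal s \<le> ereal t" by simp
          then have "ereal s < ?\<zeta> \<omega>" using t by (blast intro: le_less_trans)
          then show "dir_deriv \<A> f (y s \<omega>) (?A (y s \<omega>)) = dir_deriv \<A> f (y s \<omega>) (A (y s \<omega>))"
            using A[of \<omega> s] elim(2) s by simp
        qed
        then show "f (y t \<omega>) = f x + (\<Sum>k\<in>UNIV. I k t \<omega>) +
                integral {0..t} (\<lambda>s. dir_deriv \<A> f (y s \<omega>) (A (y s \<omega>)))"
          using elim(1) t by simp
      qed
    qed
    moreover have "AE \<omega> in P. \<forall>t. 0 \<le> t \<and> ereal t < ?\<zeta> \<omega> \<longrightarrow> f (y t \<omega>) = Z t \<omega>"
      using Z(2) by (rule eventually_mono) auto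
    ultimately show ?thesis using Z(1) by blast
  qed
  ultimately show ?thesis unfolding local_solution_def using stop by blast
qed

text \<open>Maximality includes uniqueness: the stopped cut-off solution is a solution from
  \<open>x\<close>, hence a restriction of \<open>z\<close>. The null set depends on
  \<open>x\<close>.\<close>

lemma maximal_solution_cutoff:
  fixes B :: "real \<Rightarrow> 'w \<Rightarrow> real ^ 'm::finite" and y :: "real \<Rightarrow> 'w \<Rightarrow> 'a::topological_space"
    and \<A> :: "('a, 'e::euclidean_space) chart set"
  assumes max: "maximal_solution \<A> P \<F> B X A x z \<xi>"
    and sol: "local_solution \<A> P \<F> B (\<lambda>x e c. lam x *\<^sub>R X x e c) (\<lambda>x c. lam x *\<^sub>R A x c) x y (\<lambda>\<omega>. \<infinity>)"
    and C: "closed C" and lam: "\<And>z. z \<in> C \<Longrightarrow> lam z = 1"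
  shows "AE \<omega> in P. \<forall>t s. (\<forall>u. 0 \<le> u \<and> u < t \<longrightarrow> y u \<omega> \<in> C) \<and> 0 \<le> s \<and> s < t \<longrightarrow> z s \<omega> = y s \<omega>"
proof -
  have "local_solution \<A> P \<F> B X A x y (rational_exit C y)"
    by (rule local_solution_cutoff[OF sol C lam])
  with max have "AE \<omega> in P. rational_exit C y \<omega> \<le> \<xi> \<omega> \<and>
      (\<forall>t. 0 \<le> t \<and> ereal t < rational_exit C y \<omega> \<longrightarrow> y t \<omega> = z t \<omega>)"
    unfolding maximal_solution_def by blast
  then show ?thesis
  proof (rule eventually_mono, intro allI impI)
    fix \<omega> t s
    assume *: "rational_exit C y \<omega> \<le> \<xi> \<omega> \<and> (\<forall>t. 0 \<le> t \<and> ereal t < rational_exit C y \<omega> \<longrightarrow> y t \<omega> = z t \<omega>)"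
      and s: "(\<forall>u. 0 \<le> u \<and> u < t \<longrightarrow> y u \<omega> \<in> C) \<and> 0 \<le> s \<and> s < t"
    have "ereal s < ereal t" using s by simp
    also have "\<dots> \<le> rational_exit C y \<omega>" using s by (intro rational_exit_ge) auto
    finally show "z s \<omega> = y s \<omega>" using * s by simp
  qed
qed

end

section \<open>Expected length of a random curve\<close>

text \<open>The weights \<open>w s\<close> (operator norms in the application) are not assumed measurable. For them the integral is a lower
  integral, which still bounds the integral of any measurable minorant.\<close>

locale random_increments = prob_space P for P :: "'w measure" +
  fixes l :: real and \<rho> :: "real \<Rightarrow> real \<Rightarrow> 'w \<Rightarrow> real" and w :: "real \<Rightarrow> 'w \<Rightarrow> ennreal" and C :: real
  assumes l: "0 < l" and C: "0 \<le> C"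
    and \<rho>_measurable: "\<And>a b. 0 \<le> a \<Longrightarrow> a \<le> b \<Longrightarrow> b \<le> l \<Longrightarrow> \<rho> a b \<in> borel_measurable P"
    and \<rho>_nonneg: "AE \<omega> in P. \<forall>a b. 0 \<le> a \<and> a \<le> b \<and> b \<le> l \<longrightarrow> 0 \<le> \<rho> a b \<omega>"
    and \<rho>_Lipschitz: "AE \<omega> in P. \<exists>R. \<forall>a b. 0 \<le> a \<and> a \<le> b \<and> b \<le> l \<longrightarrow> \<rho> a b \<omega> \<le> R * (b - a)"
    and \<rho>_triangle: "AE \<omega> in P. \<forall>a b c. 0 \<le> a \<and> a \<le> b \<and> b \<le> c \<and> c \<le> l \<longrightarrow> \<rho> a c \<omega> \<le> \<rho> a b \<omega> + \<rho> b c \<omega>"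
    and \<rho>_local: "\<And>s. s \<in> {0..l} \<Longrightarrow> AE \<omega> in P. \<forall>\<epsilon>>0. \<exists>d>0. \<forall>a b. 0 \<le> a \<and> a \<le> s \<and> s \<le> b \<and> b \<le> l \<and> b - a < d \<longrightarrow>
      ennreal (\<rho> a b \<omega>) \<le> (w s \<omega> + ennreal \<epsilon>) * ennreal (b - a)"
    and w: "\<And>s. s \<in> {0..l} \<Longrightarrow> (\<integral>\<^sup>+\<omega>. w s \<omega> \<partial>P) \<le> ennreal C"
begin

text \<open>On the event of level \<open>n\<close> the difference quotients are bounded by
  \<open>n\<close>, and almost every \<open>\<omega>\<close> belongs to all events of large level.
  Rational endpoints keep the event measurable.\<close>

definition Lipschitz_event :: "nat \<Rightarrow> 'w set" where
  "Lipschitz_event n = {\<omega>\<in>space P. \<forall>p\<in>\<rat> \<inter> {0..l}. \<forall>q\<in>\<rat> \<inter> {p..l}. \<rho> p q \<omega> \<le> real n * (q - p)}"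

lemma Lipschitz_event_measurable [measurable]: "Lipschitz_event n \<in> sets P"
proof -
  have "{\<omega>\<in>space P. \<rho> p q \<omega> \<le> real n * (q - p)} \<in> sets P" if "p \<in> \<rat> \<inter> {0..l}" "q \<in> \<rat> \<inter> {p..l}" for p q
  proof -
    have [measurable]: "\<rho> p q \<in> borel_measurable P" using that by (intro \<rho>_measurable) auto
    show ?thesis by measurable
  qed
  then show ?thesis unfolding Lipschitz_event_def
    by (intro sets.sets_Collect_countable_All' countable_Int1 countable_rat) auto
qed

text \<open>The endpoints are moved inward to rationals within distance \<open>d\<close>. The two
  end pieces are controlled by the constant \<open>R\<close> of the path, which may exceed
  \<open>n\<close>, and cost at most \<open>e / 2\<close> each.\<close>

lemma Lipschitz_eventD:
  assumes R: "\<forall>a b. 0 \<le> a \<and> a \<le> b \<and> b \<le> l \<longrightarrow> \<rho> a b \<omega> \<le> R * (b - a)"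
    and tri: "\<forall>a b c. 0 \<le> a \<and> a \<le> b \<and> b \<le> c \<and> c \<le> l \<longrightarrow> \<rho> a c \<omega> \<le> \<rho> a b \<omega> + \<rho> b c \<omega>"
    and \<omega>: "\<omega> \<in> Lipschitz_event n" and ab: "0 \<le> a" "a < b" "b \<le> l"
  shows "\<rho> a b \<omega> \<le> real n * (b - a)"
proof (rule field_le_epsilon)
  fix e :: real assume e: "0 < e"
  define d where "d = min ((b - a) / 2) (e / (2 * (\<bar>R\<bar> + 1)))"
  have d: "0 < d" "a + d \<le> b - d" "\<bar>R\<bar> * d \<le> e / 2"
  proof -
    show "0 < d" using e ab by (simp add: d_def)
    have "d \<le> (b - a) / 2" unfolding d_def by (rule min.cobounded1)
    then show "a + d \<le> b - d" by (simp add: field_simps)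
    have "\<bar>R\<bar> * d \<le> (\<bar>R\<bar> + 1) * (e / (2 * (\<bar>R\<bar> + 1)))"
      using \<open>0 < d\<close> by (intro mult_mono) (auto simp: d_def)
    also have "\<dots> = e / 2" by (simp add: field_simps)
    finally show "\<bar>R\<bar> * d \<le> e / 2" .
  qed
  obtain p where p: "p \<in> \<rat>" "a < p" "p < a + d" using Rats_dense_in_real[of a "a + d"] d by auto
  obtain q where q: "q \<in> \<rat>" "b - d < q" "q < b" using Rats_dense_in_real[of "b - d" b] d by auto
  have "\<rho> a b \<omega> \<le> \<rho> a p \<omega> + \<rho> p b \<omega>" "\<rho> p b \<omega> \<le> \<rho> p q \<omega> + \<rho> q b \<omega>"
    using tri p q ab d by auto
  moreover have "\<rho> a p \<omega> \<le> R * (p - a)" "\<rho> q b \<omega> \<le> R * (b - q)"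
    using R p q ab d by auto
  moreover have "\<rho> p q \<omega> \<le> real n * (q - p)"
    using \<omega> p q ab d unfolding Lipschitz_event_def by auto
  moreover have "R * (p - a) \<le> \<bar>R\<bar> * d" "R * (b - q) \<le> \<bar>R\<bar> * d"
    using p q by (auto intro!: mult_mono)
  moreover have "real n * (q - p) \<le> real n * (b - a)" using p q by (intro mult_left_mono) auto
  ultimately show "\<rho> a b \<omega> \<le> real n * (b - a) + e" using d(3) by simp
qed

text \<open>Intervals are bisected down to a point, where the reverse Fatou lemma applies because the
  difference quotients are bounded on the event.\<close>

lemma expectation_on_event:
  assumes \<epsilon>: "0 < \<epsilon>" and ab: "0 \<le> a0" "a0 \<le> b0" "b0 \<le> l"
  shows "(\<integral>\<^sup>+\<omega>. ennreal (\<rho> a0 b0 \<omega>) * indicator (Lipschitz_event n) \<omega> \<partial>P) \<le> ennreal ((C + \<epsilon>) * (b0 - a0))"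
proof -
  let ?\<psi> = "\<lambda>a b. \<integral>\<^sup>+\<omega>. ennreal (\<rho> a b \<omega>) * indicator (Lipschitz_event n) \<omega> \<partial>P"
  \<comment> \<open>The guards are part of the statement because the bisection principle
    \<open>Bolzano\<close> ranges over all real intervals, including those that leave
    \<open>{0..l}\<close>.\<close>
  have "0 \<le> a0 \<and> b0 \<le> l \<longrightarrow> ?\<psi> a0 b0 \<le> ennreal ((C + \<epsilon>) * (b0 - a0))"
    using ab(2)
  proof (rule Bolzano)
    fix a b c
    assume 1: "0 \<le> a \<and> b \<le> l \<longrightarrow> ?\<psi> a b \<le> ennreal ((C + \<epsilon>) * (b - a))"
      and 2: "0 \<le> b \<and> c \<le> l \<longrightarrow> ?\<psi> b c \<le> ennreal ((C + \<epsilon>) * (c - b))" and abc: "a \<le> b" "b \<le> c"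
    show "0 \<le> a \<and> c \<le> l \<longrightarrow> ?\<psi> a c \<le> ennreal ((C + \<epsilon>) * (c - a))"
    proof
      assume ac: "0 \<le> a \<and> c \<le> l"
      have [measurable]: "\<rho> a b \<in> borel_measurable P" "\<rho> b c \<in> borel_measurable P"
        using ac abc by (auto intro: \<rho>_measurable)
      have "?\<psi> a c \<le> (\<integral>\<^sup>+\<omega>. ennreal (\<rho> a b \<omega>) * indicator (Lipschitz_event n) \<omega> +
          ennreal (\<rho> b c \<omega>) * indicator (Lipschitz_event n) \<omega> \<partial>P)"
      proof (rule nn_integral_mono_AE)
        show "AE \<omega> in P. ennreal (\<rho> a c \<omega>) * indicator (Lipschitz_event n) \<omega> \<le>
          ennreal (\<rho> a b \<omega>) * indicator (Lipschitz_event n) \<omega> + ennreal (\<rho> b c \<omega>) * indicator (Lipschitz_event n) \<omega>"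
          using \<rho>_triangle \<rho>_nonneg
        proof eventually_elim
          case (elim \<omega>)
          have "ennreal (\<rho> a c \<omega>) \<le> ennreal (\<rho> a b \<omega> + \<rho> b c \<omega>)"
            using elim(1) ac abc by (intro ennreal_leI) auto
          also have "\<dots> = ennreal (\<rho> a b \<omega>) + ennreal (\<rho> b c \<omega>)"
            using elim(2) ac abc by (intro ennreal_plus) auto
          finally show ?case by (auto split: split_indicator)
        qed
      qed
      also have "\<dots> = ?\<psi> a b + ?\<psi> b c" by (rule nn_integral_add) measurable
      also have "\<dots> \<le> ennreal ((C + \<epsilon>) * (b - a)) + ennreal ((C + \<epsilon>) * (c - b))"
        using 1 2 ac abc by (intro add_mono) auto
      also have "\<dots> = ennreal ((C + \<epsilon>) * (c - a))"
        using C \<epsilon> abc by (subst ennreal_plus[symmetric]) (simp_all add: distrib_left[symmetric])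
      finally show "?\<psi> a c \<le> ennreal ((C + \<epsilon>) * (c - a))" .
    qed
  next
    fix x assume x: "a0 \<le> x" "x \<le> b0"
    show "\<exists>d>0. \<forall>a b. a \<le> x \<and> x \<le> b \<and> b - a < d \<longrightarrow>
        (0 \<le> a \<and> b \<le> l \<longrightarrow> ?\<psi> a b \<le> ennreal ((C + \<epsilon>) * (b - a)))"
    proof (rule ccontr)
      assume neg: "\<not> ?thesis"
      have "\<exists>a b. a \<le> x \<and> x \<le> b \<and> b - a < d \<and> 0 \<le> a \<and> b \<le> l \<and> \<not> ?\<psi> a b \<le> ennreal ((C + \<epsilon>) * (b - a))"
        if "0 < d" for d using neg that by blast
      then have ex: "\<forall>k::nat. \<exists>a b. a \<le> x \<and> x \<le> b \<and> b - a < 1 / Suc k \<and> 0 \<le> a \<and> b \<le> l \<and>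
          \<not> ?\<psi> a b \<le> ennreal ((C + \<epsilon>) * (b - a))" by simp
      obtain a b where k0: "\<forall>k::nat. a k \<le> x \<and> x \<le> b k \<and> b k - a k < 1 / Suc k \<and> 0 \<le> a k \<and> b k \<le> l \<and>
          \<not> ?\<psi> (a k) (b k) \<le> ennreal ((C + \<epsilon>) * (b k - a k))"
        using ex unfolding choice_iff by (elim exE) (rule that)
      then have k: "\<And>k::nat. a k \<le> x" "\<And>k. x \<le> b k" "\<And>k. b k - a k < 1 / Suc k" "\<And>k. 0 \<le> a k"
          "\<And>k. b k \<le> l" "\<And>k. \<not> ?\<psi> (a k) (b k) \<le> ennreal ((C + \<epsilon>) * (b k - a k))"
        by blast+
      \<comment> \<open>A degenerate interval has \<open>\<rho>\<close> at most 0 by the Lipschitz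
        bound and cannot violate the estimate, so the difference quotients below make sense.\<close>
      have lt: "a k < b k" for k
      proof (rule ccontr)
        assume "\<not> a k < b k"
        then have e: "a k = b k" using k(1,2)[of k] by simp
        have "?\<psi> (a k) (b k) \<le> (\<integral>\<^sup>+\<omega>. 0 \<partial>P)"
        proof (rule nn_integral_mono_AE)
          show "AE \<omega> in P. ennreal (\<rho> (a k) (b k) \<omega>) * indicator (Lipschitz_event n) \<omega> \<le> 0"
            using \<rho>_Lipschitz
          proof eventually_elim
            case (elim \<omega>)
            then obtain R where "\<forall>a b. 0 \<le> a \<and> a \<le> b \<and> b \<le> l \<longrightarrow> \<rho> a b \<omega> \<le> R * (b - a)" ..
            then have "\<rho> (a k) (b k) \<omega> \<le> R * (b k - a k)"
              by (elim allE[of _ "a k"] allE[of _ "b k"] mp) (use k(4,5)[of k] e in simp)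
            then show ?case using e by (simp add: ennreal_neg)
          qed
        qed
        then show False using k(6)[of k] by simp
      qed
      define u where "u k \<omega> = ennreal (\<rho> (a k) (b k) \<omega> / (b k - a k)) * indicator (Lipschitz_event n) \<omega>" for k \<omega>
      have \<rho>m[measurable]: "\<rho> (a k) (b k) \<in> borel_measurable P" for k
        using k(4,5)[of k] lt[of k] by (intro \<rho>_measurable) auto
      have um[measurable]: "u k \<in> borel_measurable P" for k unfolding u_def by measurable
      have big: "ennreal (C + \<epsilon>) \<le> (\<integral>\<^sup>+\<omega>. u k \<omega> \<partial>P)" for k
      proof -
        have "ennreal ((C + \<epsilon>) * (b k - a k)) \<le> ?\<psi> (a k) (b k)" using k(6)[of k] by simp
        also have "\<dots> = (\<integral>\<^sup>+\<omega>. ennreal (b k - a k) * u k \<omega> \<partial>P)"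
        proof (rule nn_integral_cong_AE)
          show "AE \<omega> in P. ennreal (\<rho> (a k) (b k) \<omega>) * indicator (Lipschitz_event n) \<omega> = ennreal (b k - a k) * u k \<omega>"
            using \<rho>_nonneg
          proof eventually_elim
            case (elim \<omega>)
            then have "0 \<le> \<rho> (a k) (b k) \<omega>" using k(4,5)[of k] lt[of k] by auto
            then show ?case using lt[of k]
              by (simp add: u_def ennreal_mult[symmetric] mult.assoc[symmetric])
          qed
        qed
        also have "\<dots> = ennreal (b k - a k) * (\<integral>\<^sup>+\<omega>. u k \<omega> \<partial>P)" by (rule nn_integral_cmult) measurable
        finally have "ennreal (b k - a k) * ennreal (C + \<epsilon>) \<le> ennreal (b k - a k) * (\<integral>\<^sup>+\<omega>. u k \<omega> \<partial>P)"
          using C \<epsilon> lt[of k] by (simp add: ennreal_mult mult.commute)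
        then show ?thesis using lt[of k] by (subst (asm) ennreal_mult_le_mult_iff) auto
      qed
      have "ennreal (C + \<epsilon>) \<le> limsup (\<lambda>k. \<integral>\<^sup>+\<omega>. u k \<omega> \<partial>P)"
        by (rule le_Limsup) (simp_all add: big)
      \<comment> \<open>Reverse Fatou, with the constant \<open>n\<close> as integrable
        majorant.\<close>
      also have "\<dots> \<le> (\<integral>\<^sup>+\<omega>. limsup (\<lambda>k. u k \<omega>) \<partial>P)"
      proof (rule nn_integral_limsup[where w = "\<lambda>_. ennreal n"])
        show "AE \<omega> in P. u k \<omega> \<le> ennreal n" for k
          using \<rho>_Lipschitz \<rho>_triangle
        proof eventually_elim
          case (elim \<omega>)
          then obtain R where R: "\<forall>a b. 0 \<le> a \<and> a \<le> b \<and> b \<le> l \<longrightarrow> \<rho> a b \<omega> \<le> R * (b - a)" by blast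
          show ?case
          proof (cases "\<omega> \<in> Lipschitz_event n")
            case True
            from Lipschitz_eventD[OF R elim(2) True k(4) lt k(5)] lt[of k]
            have "\<rho> (a k) (b k) \<omega> / (b k - a k) \<le> n" by (simp add: field_simps)
            then show ?thesis using True by (simp add: u_def ennreal_leI)
          qed (simp add: u_def)
        qed
      qed (use um in \<open>simp_all add: emeasure_space_1\<close>)
      \<comment> \<open>The quotients belong to intervals shrinking to \<open>x\<close>, so their
        limit superior is at most the weight at \<open>x\<close>. Monotonicity of the integral does
        not require \<open>w x\<close> to be measurable.\<close>
      also have "\<dots> \<le> (\<integral>\<^sup>+\<omega>. w x \<omega> \<partial>P)"
      proof (rule nn_integral_mono_AE)
        have xl: "x \<in> {0..l}" using x ab by simp
        show "AE \<omega> in P. limsup (\<lambda>k. u k \<omega>) \<le> w x \<omega>"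
          using \<rho>_local[OF xl]
        proof eventually_elim
          case (elim \<omega>)
          show ?case
          proof (rule ennreal_le_epsilon)
            fix e :: real assume e: "0 < e"
            then obtain d where d: "0 < d" "\<And>a b. 0 \<le> a \<and> a \<le> x \<and> x \<le> b \<and> b \<le> l \<and> b - a < d \<Longrightarrow>
              ennreal (\<rho> a b \<omega>) \<le> (w x \<omega> + ennreal e) * ennreal (b - a)" using elim by blast
            have "(\<lambda>k. 1 / real (Suc k)) \<longlonglongrightarrow> 0" by (rule LIMSEQ_Suc) (rule lim_const_over_n)
            from order_tendstoD(2)[OF this d(1)]
            have "\<forall>\<^sub>F k in sequentially. u k \<omega> \<le> w x \<omega> + ennreal e"
            proof eventually_elim
              case (elim m)
              have "ennreal (\<rho> (a m) (b m) \<omega>) \<le> (w x \<omega> + ennreal e) * ennreal (b m - a m)"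
                using k[of m] elim by (intro d(2)) simp
              then have "ennreal (\<rho> (a m) (b m) \<omega>) / ennreal (b m - a m) \<le>
                  (w x \<omega> + ennreal e) * ennreal (b m - a m) / ennreal (b m - a m)"
                by (rule divide_right_mono_ennreal)
              also have "\<dots> = w x \<omega> + ennreal e"
                using lt[of m] by (subst ennreal_mult_divide_eq) simp_all
              finally have "ennreal (\<rho> (a m) (b m) \<omega> / (b m - a m)) \<le> w x \<omega> + ennreal e"
              proof (cases "0 \<le> \<rho> (a m) (b m) \<omega>")
                case False
                then show ?thesis using lt[of m] by (simp add: ennreal_neg divide_nonpos_pos)
              qed (use lt[of m] in \<open>simp add: divide_ennreal\<close>)
              then show ?case by (auto simp: u_def split: split_indicator)
            qed
            then show "limsup (\<lambda>k. u k \<omega>) \<le> w x \<omega> + ennreal e" by (rule Limsup_bounded)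
          qed
        qed
      qed
      also have "\<dots> \<le> ennreal C" using x ab by (intro w) auto
      finally show False using C \<epsilon> by (simp add: ennreal_le_iff2)
    qed
  qed
  then show ?thesis using ab by simp
qed

text \<open>Fatou's lemma removes the events, since almost every path lies in
  \<open>Lipschitz_event n\<close> for all large \<open>n\<close>.\<close>

lemma expectation_increment:
  assumes ab: "0 \<le> a" "a \<le> b" "b \<le> l"
  shows "(\<integral>\<^sup>+\<omega>. ennreal (\<rho> a b \<omega>) \<partial>P) \<le> ennreal (C * (b - a))"
proof -
  have [measurable]: "\<rho> a b \<in> borel_measurable P" by (rule \<rho>_measurable[OF ab])
  let ?u = "\<lambda>n \<omega>. ennreal (\<rho> a b \<omega>) * indicator (Lipschitz_event n) \<omega>"
  have "(\<integral>\<^sup>+\<omega>. ?u n \<omega> \<partial>P) \<le> ennreal (C * (b - a))" for n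
  proof (rule ennreal_le_epsilon)
    fix e :: real assume e: "0 < e"
    \<comment> \<open>The summand 1 in the denominator covers \<open>a = b\<close>.\<close>
    define \<epsilon> where "\<epsilon> = e / (b - a + 1)"
    have \<epsilon>: "0 < \<epsilon>" "\<epsilon> * (b - a) \<le> e" using e ab by (auto simp: \<epsilon>_def field_simps)
    have "(\<integral>\<^sup>+\<omega>. ?u n \<omega> \<partial>P) \<le> ennreal ((C + \<epsilon>) * (b - a))" by (rule expectation_on_event[OF \<epsilon>(1) ab])
    also have "\<dots> \<le> ennreal (C * (b - a) + e)" using \<epsilon>(2) by (intro ennreal_leI) (simp add: algebra_simps)
    also have "\<dots> = ennreal (C * (b - a)) + ennreal e" using C ab e by (intro ennreal_plus) auto
    finally show "(\<integral>\<^sup>+\<omega>. ?u n \<omega> \<partial>P) \<le> ennreal (C * (b - a)) + ennreal e" .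
  qed
  then have "liminf (\<lambda>n. \<integral>\<^sup>+\<omega>. ?u n \<omega> \<partial>P) \<le> ennreal (C * (b - a))"
    by (intro order_trans[OF Liminf_le_Limsup Limsup_bounded]) auto
  moreover have "(\<integral>\<^sup>+\<omega>. liminf (\<lambda>n. ?u n \<omega>) \<partial>P) \<le> liminf (\<lambda>n. \<integral>\<^sup>+\<omega>. ?u n \<omega> \<partial>P)"
    by (rule nn_integral_liminf) measurable
  moreover have "(\<integral>\<^sup>+\<omega>. ennreal (\<rho> a b \<omega>) \<partial>P) \<le> (\<integral>\<^sup>+\<omega>. liminf (\<lambda>n. ?u n \<omega>) \<partial>P)"
  proof (rule nn_integral_mono_AE)
    show "AE \<omega> in P. ennreal (\<rho> a b \<omega>) \<le> liminf (\<lambda>n. ?u n \<omega>)"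
      using \<rho>_Lipschitz AE_space
    proof eventually_elim
      case (elim \<omega>)
      then obtain R where R: "\<And>a b. 0 \<le> a \<and> a \<le> b \<and> b \<le> l \<Longrightarrow> \<rho> a b \<omega> \<le> R * (b - a)" by blast
      obtain m :: nat where m: "R \<le> m" using real_arch_simple by blast
      have "\<omega> \<in> Lipschitz_event n" if "m \<le> n" for n
      proof -
        have "\<rho> p q \<omega> \<le> real n * (q - p)" if "0 \<le> p" "p \<le> q" "q \<le> l" for p q
        proof -
          have "\<rho> p q \<omega> \<le> R * (q - p)" using R that by simp
          also have "\<dots> \<le> real n * (q - p)" using m that \<open>m \<le> n\<close> by (intro mult_right_mono) auto
          finally show ?thesis .
        qed
        then show ?thesis using elim(2) by (auto simp: Lipschitz_event_def)
      qed
      then have "\<forall>\<^sub>F n in sequentially. ennreal (\<rho> a b \<omega>) \<le> ?u n \<omega>"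
        by (auto simp: eventually_sequentially intro!: exI[of _ m])
      then show ?case by (rule Liminf_bounded)
    qed
  qed
  ultimately show ?thesis by simp
qed

text \<open>Stands in for the length of the random curve. Uniform grids form a sequence, so the
  result is measurable and Fatou's lemma bounds its expectation; the limit inferior along them
  already dominates each \<open>\<rho> 0 s\<close>.\<close>

definition variation :: "'w \<Rightarrow> ennreal" where
  "variation \<omega> = liminf (\<lambda>n. \<Sum>i<Suc n. ennreal (\<rho> (l * i / Suc n) (l * Suc i / Suc n) \<omega>))"

lemma grid:
  assumes "i < Suc n"
  shows "0 \<le> l * i / Suc n" "l * i / Suc n \<le> l * Suc i / Suc n" "l * Suc i / Suc n \<le> l"
proof -
  have "l * (real (Suc i) / real (Suc n)) \<le> l * 1" using l assms by (intro mult_left_mono) auto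
  then show "l * Suc i / Suc n \<le> l" by simp
qed (use l in \<open>auto simp: divide_right_mono\<close>)

lemma variation_measurable [measurable]: "variation \<in> borel_measurable P"
proof -
  have [measurable]: "(\<lambda>\<omega>. \<Sum>i<Suc n. ennreal (\<rho> (l * i / Suc n) (l * Suc i / Suc n) \<omega>)) \<in> borel_measurable P" for n
    by (intro borel_measurable_sum measurable_compose[OF \<rho>_measurable measurable_ennreal] grid) auto
  show ?thesis unfolding variation_def[abs_def] by measurable
qed

lemma expectation_variation: "(\<integral>\<^sup>+\<omega>. variation \<omega> \<partial>P) \<le> ennreal (C * l)"
proof -
  let ?V = "\<lambda>n \<omega>. \<Sum>i<Suc n. ennreal (\<rho> (l * i / Suc n) (l * Suc i / Suc n) \<omega>)"
  have m: "(\<lambda>\<omega>. ennreal (\<rho> (l * i / Suc n) (l * Suc i / Suc n) \<omega>)) \<in> borel_measurable P" if "i < Suc n" for i n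
    by (intro measurable_compose[OF \<rho>_measurable measurable_ennreal] grid that)
  have "(\<integral>\<^sup>+\<omega>. ?V n \<omega> \<partial>P) \<le> ennreal (C * l)" for n
  proof -
    have "(\<integral>\<^sup>+\<omega>. ?V n \<omega> \<partial>P) = (\<Sum>i<Suc n. \<integral>\<^sup>+\<omega>. ennreal (\<rho> (l * i / Suc n) (l * Suc i / Suc n) \<omega>) \<partial>P)"
      by (rule nn_integral_sum) (use m in auto)
    also have "\<dots> \<le> (\<Sum>i<Suc n. ennreal (C * (l * Suc i / Suc n - l * i / Suc n)))"
      by (intro sum_mono expectation_increment grid) auto
    also have "\<dots> = (\<Sum>i<Suc n. ennreal (C * (l / Suc n)))"
    proof (intro sum.cong refl arg_cong[where f = ennreal])
      fix i
      have "l * Suc i / Suc n - l * i / Suc n = (l * Suc i - l * i) / Suc n" by (rule diff_divide_distrib[symmetric])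
      then show "C * (l * Suc i / Suc n - l * i / Suc n) = C * (l / Suc n)" by (simp add: algebra_simps)
    qed
    also have "\<dots> = ennreal (\<Sum>i<Suc n. C * (l / Suc n))" using C l by (intro sum_ennreal) auto
    also have "(\<Sum>i<Suc n. C * (l / Suc n)) = C * l" by simp
    finally show ?thesis .
  qed
  then have "liminf (\<lambda>n. \<integral>\<^sup>+\<omega>. ?V n \<omega> \<partial>P) \<le> ennreal (C * l)"
    by (intro order_trans[OF Liminf_le_Limsup Limsup_bounded]) auto
  moreover have "(\<integral>\<^sup>+\<omega>. liminf (\<lambda>n. ?V n \<omega>) \<partial>P) \<le> liminf (\<lambda>n. \<integral>\<^sup>+\<omega>. ?V n \<omega> \<partial>P)"
    by (rule nn_integral_liminf) (intro borel_measurable_sum m, simp)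
  ultimately show ?thesis unfolding variation_def by (rule order_trans[rotated])
qed

text \<open>With the grid point just below \<open>s\<close>, the triangle inequality bounds the
  increment by a partial sum plus a last piece of size at most
  \<open>\<bar>R\<bar> * l / Suc n\<close>, which tends to 0.\<close>

lemma variation_ge: "AE \<omega> in P. \<forall>s\<in>{0..l}. ennreal (\<rho> 0 s \<omega>) \<le> variation \<omega>"
  using \<rho>_nonneg \<rho>_triangle \<rho>_Lipschitz
proof eventually_elim
  case (elim \<omega>)
  obtain R where R: "\<And>a b. 0 \<le> a \<and> a \<le> b \<and> b \<le> l \<Longrightarrow> \<rho> a b \<omega> \<le> R * (b - a)" using elim(3) by blast
  let ?g = "\<lambda>n i. l * real i / real (Suc n)"
  have partial: "\<rho> 0 (?g n m) \<omega> \<le> (\<Sum>i<m. \<rho> (?g n i) (?g n (Suc i)) \<omega>)" if "m \<le> Suc n" for n m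
    using that
  proof (induction m)
    case 0
    then show ?case using R[of 0 0] l by simp
  next
    case (Suc m)
    have "\<rho> 0 (?g n (Suc m)) \<omega> \<le> \<rho> 0 (?g n m) \<omega> + \<rho> (?g n m) (?g n (Suc m)) \<omega>"
      using elim(2) grid[of m n] Suc.prems by auto
    then show ?case using Suc by simp
  qed
  show ?case
  proof
    fix s assume s: "s \<in> {0..l}"
    show "ennreal (\<rho> 0 s \<omega>) \<le> variation \<omega>"
    proof (rule ennreal_le_epsilon)
      fix e :: real assume e: "0 < e"
      have "(\<lambda>n. \<bar>R\<bar> * l / real (Suc n)) \<longlonglongrightarrow> 0" by (rule LIMSEQ_Suc) (rule lim_const_over_n)
      from order_tendstoD(2)[OF this e]
      have "\<forall>\<^sub>F n in sequentially. ennreal (\<rho> 0 s \<omega>) \<le> (\<Sum>i<Suc n. ennreal (\<rho> (?g n i) (?g n (Suc i)) \<omega>)) + ennreal e"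
      proof eventually_elim
        case (elim n)
        note en = this
        \<comment> \<open>The index of the last grid point that is at most \<open>s\<close>; it
          equals \<open>Suc n\<close> when \<open>s = l\<close>.\<close>
        define m where "m = nat \<lfloor>s * Suc n / l\<rfloor>"
        have m1: "real m \<le> s * Suc n / l" "s * Suc n / l < real m + 1"
          using s l unfolding m_def by (simp_all add: of_nat_nat)
        have ms: "m \<le> Suc n"
        proof -
          have "real m \<le> l * Suc n / l" using m1(1) s l
            by (meson atLeastAtMost_iff divide_right_mono less_imp_le mult_right_mono of_nat_0_le_iff order_trans)
          then show ?thesis using l by simp
        qed
        have gm: "?g n m \<le> s" "0 \<le> ?g n m" using m1(1) l by (auto simp: field_simps)
        have "s * real (Suc n) < l * (real m + 1)" using m1(2) l by (simp add: pos_divide_less_eq mult.commute)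
        then have "s < l * (real m + 1) / real (Suc n)" by (simp add: pos_less_divide_eq)
        then have gm2: "s - ?g n m \<le> l / Suc n" by (simp add: distrib_left add_divide_distrib)
        have "\<rho> 0 s \<omega> \<le> \<rho> 0 (?g n m) \<omega> + \<rho> (?g n m) s \<omega>"
          using \<open>\<forall>a b c. 0 \<le> a \<and> a \<le> b \<and> b \<le> c \<and> c \<le> l \<longrightarrow> \<rho> a c \<omega> \<le> \<rho> a b \<omega> + \<rho> b c \<omega>\<close> gm s by auto
        moreover have "\<rho> (?g n m) s \<omega> \<le> e"
        proof -
          have "\<rho> (?g n m) s \<omega> \<le> R * (s - ?g n m)" using R gm s by auto
          also have "\<dots> \<le> \<bar>R\<bar> * (l / Suc n)" using gm gm2 by (intro mult_mono) auto
          finally show ?thesis using en by simp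
        qed
        moreover have "(\<Sum>i<m. \<rho> (?g n i) (?g n (Suc i)) \<omega>) \<le> (\<Sum>i<Suc n. \<rho> (?g n i) (?g n (Suc i)) \<omega>)"
          using ms \<open>\<forall>a b. 0 \<le> a \<and> a \<le> b \<and> b \<le> l \<longrightarrow> 0 \<le> \<rho> a b \<omega>\<close> grid by (intro sum_mono2) auto
        ultimately have "\<rho> 0 s \<omega> \<le> (\<Sum>i<Suc n. \<rho> (?g n i) (?g n (Suc i)) \<omega>) + e"
          using partial[OF ms] by linarith
        then have "ennreal (\<rho> 0 s \<omega>) \<le> ennreal ((\<Sum>i<Suc n. \<rho> (?g n i) (?g n (Suc i)) \<omega>) + e)" by (rule ennreal_leI)
        also have "\<dots> = ennreal (\<Sum>i<Suc n. \<rho> (?g n i) (?g n (Suc i)) \<omega>) + ennreal e"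
          using \<open>\<forall>a b. 0 \<le> a \<and> a \<le> b \<and> b \<le> l \<longrightarrow> 0 \<le> \<rho> a b \<omega>\<close> grid e by (intro ennreal_plus sum_nonneg) auto
        also have "ennreal (\<Sum>i<Suc n. \<rho> (?g n i) (?g n (Suc i)) \<omega>) = (\<Sum>i<Suc n. ennreal (\<rho> (?g n i) (?g n (Suc i)) \<omega>))"
          using \<open>\<forall>a b. 0 \<le> a \<and> a \<le> b \<and> b \<le> l \<longrightarrow> 0 \<le> \<rho> a b \<omega>\<close> grid by (intro sum_ennreal[symmetric]) auto
        finally show ?case .
      qed
      then have "\<forall>\<^sub>F n in sequentially. ennreal (\<rho> 0 s \<omega>) - ennreal e \<le> (\<Sum>i<Suc n. ennreal (\<rho> (?g n i) (?g n (Suc i)) \<omega>))"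
        by (rule eventually_mono) (simp add: ennreal_minus_le_iff add.commute)
      then have "ennreal (\<rho> 0 s \<omega>) - ennreal e \<le> variation \<omega>"
        unfolding variation_def by (rule Liminf_bounded)
      then show "ennreal (\<rho> 0 s \<omega>) \<le> variation \<omega> + ennreal e"
        by (simp add: ennreal_minus_le_iff add.commute)
    qed
  qed
qed

end

context riemannian begin

text \<open>Dividing by the speed bound \<open>M\<close> leaves the operator norm alone as a bound
  for the local growth rate of distances along the image curve. These are the Lipschitz and local
  conditions of \<open>random_increments\<close> for one path.\<close>

lemma rdist_C1_image_bounds:
  assumes f: "Ck_map_on (Suc 0) \<A> f W" "open W" and \<sigma>: "C1_curve \<A> l \<sigma> v" "\<sigma> ` {0..l} \<subseteq> W"
    and M: "0 < M" "\<And>s. s \<in> {0..l} \<Longrightarrow> gnorm g (\<sigma> s) (v s) \<le> M"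
  shows "\<exists>R. \<forall>a b. 0 \<le> a \<and> a \<le> b \<and> b \<le> l \<longrightarrow> rdist \<A> g (f (\<sigma> a)) (f (\<sigma> b)) / M \<le> R * (b - a)"
    and "s \<in> {0..l} \<Longrightarrow> \<forall>\<epsilon>>0. \<exists>d>0. \<forall>a b. 0 \<le> a \<and> a \<le> s \<and> s \<le> b \<and> b \<le> l \<and> b - a < d \<longrightarrow>
      ennreal (rdist \<A> g (f (\<sigma> a)) (f (\<sigma> b)) / M) \<le> (ennreal (tangent_opnorm \<A> g f (\<sigma> s)) + ennreal \<epsilon>) * ennreal (b - a)"
proof -
  define \<phi> where "\<phi> t = gnorm g (f (\<sigma> t)) (tangent_map \<A> f (\<sigma> t) (v t))" for t
  note im = C1_curve_image[OF f \<sigma>]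
  have cont: "continuous_on {0..l} \<phi>"
    using gnorm_C1_curve_continuous[OF im] by (simp add: \<phi>_def)
  have le: "rdist \<A> g (f (\<sigma> a)) (f (\<sigma> b)) \<le> R * (b - a)"
    if ab: "0 \<le> a" "a \<le> b" "b \<le> l" and R: "\<And>t. t \<in> {a..b} \<Longrightarrow> \<phi> t \<le> R" for a b R
  proof -
    have "rdist \<A> g (f (\<sigma> a)) (f (\<sigma> b)) \<le> integral {a..b} \<phi>"
      using rdist_le_integral[OF im ab] by (simp add: \<phi>_def[abs_def])
    also have "\<dots> \<le> integral {a..b} (\<lambda>t. R)"
      using ab R by (intro integral_le integrable_continuous_real continuous_on_subset[OF cont] continuous_on_const) auto
    also have "\<dots> = R * (b - a)" using ab by simp
    finally show ?thesis .
  qed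
  show "\<exists>R. \<forall>a b. 0 \<le> a \<and> a \<le> b \<and> b \<le> l \<longrightarrow> rdist \<A> g (f (\<sigma> a)) (f (\<sigma> b)) / M \<le> R * (b - a)"
  proof -
    obtain R where R: "\<forall>y\<in>\<phi> ` {0..l}. norm y \<le> R"
      using compact_imp_bounded[OF compact_continuous_image[OF cont compact_Icc]] unfolding bounded_iff by blast
    have "rdist \<A> g (f (\<sigma> a)) (f (\<sigma> b)) \<le> R * (b - a)" if "0 \<le> a" "a \<le> b" "b \<le> l" for a b
    proof (rule le[OF that])
      fix t assume "t \<in> {a..b}"
      then have "norm (\<phi> t) \<le> R" using R that by auto
      then show "\<phi> t \<le> R" by simp
    qed
    then show ?thesis using M(1) by (intro exI[of _ "R / M"]) (auto simp: field_simps)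
  qed
  assume s: "s \<in> {0..l}"
  show "\<forall>\<epsilon>>0. \<exists>d>0. \<forall>a b. 0 \<le> a \<and> a \<le> s \<and> s \<le> b \<and> b \<le> l \<and> b - a < d \<longrightarrow>
      ennreal (rdist \<A> g (f (\<sigma> a)) (f (\<sigma> b)) / M) \<le> (ennreal (tangent_opnorm \<A> g f (\<sigma> s)) + ennreal \<epsilon>) * ennreal (b - a)"
  proof (intro allI impI)
    fix \<epsilon> :: real assume \<epsilon>: "0 < \<epsilon>"
    let ?o = "tangent_opnorm \<A> g f (\<sigma> s)"
    have "0 < \<epsilon> * M" using \<epsilon> M by simp
    then obtain d where d: "0 < d" "\<And>t. t \<in> {0..l} \<Longrightarrow> dist t s < d \<Longrightarrow> dist (\<phi> t) (\<phi> s) < \<epsilon> * M"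
      using cont s unfolding continuous_on_iff by blast
    have vs: "v s \<in> tangent_space \<A> (\<sigma> s)" by (rule C1_curve_velocity[OF \<sigma>(1) s])
    have "\<phi> s \<le> ?o * gnorm g (\<sigma> s) (v s)"
      unfolding \<phi>_def by (rule gnorm_tangent_map_le[OF f _ vs]) (use \<sigma>(2) s in blast)
    \<comment> \<open>\<open>ennreal\<close> sends negative numbers to 0, so \<open>max 0\<close>
      costs nothing and spares a proof that the operator norm is nonnegative.\<close>
    also have "\<dots> \<le> max 0 ?o * M"
      using M(2)[OF s] gnorm_nonneg[OF vs] by (intro mult_mono) auto
    finally have \<phi>s: "\<phi> s \<le> max 0 ?o * M" .
    have "ennreal (rdist \<A> g (f (\<sigma> a)) (f (\<sigma> b)) / M) \<le> (ennreal ?o + ennreal \<epsilon>) * ennreal (b - a)"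
      if ab: "0 \<le> a" "a \<le> s" "s \<le> b" "b \<le> l" "b - a < d" for a b
    proof -
      have "rdist \<A> g (f (\<sigma> a)) (f (\<sigma> b)) \<le> (\<phi> s + \<epsilon> * M) * (b - a)"
      proof (rule le)
        fix t assume "t \<in> {a..b}"
        then have "dist (\<phi> t) (\<phi> s) < \<epsilon> * M" using ab by (intro d(2)) (auto simp: dist_real_def)
        then show "\<phi> t \<le> \<phi> s + \<epsilon> * M" by (simp add: dist_real_def abs_less_iff)
      qed (use ab in auto)
      also have "\<dots> \<le> (max 0 ?o * M + \<epsilon> * M) * (b - a)" using \<phi>s ab by (intro mult_right_mono) auto
      finally have "rdist \<A> g (f (\<sigma> a)) (f (\<sigma> b)) / M \<le> (max 0 ?o + \<epsilon>) * (b - a)"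
        using M(1) by (simp add: field_simps)
      then have "ennreal (rdist \<A> g (f (\<sigma> a)) (f (\<sigma> b)) / M) \<le> ennreal ((max 0 ?o + \<epsilon>) * (b - a))" by (rule ennreal_leI)
      also have "\<dots> = (ennreal (max 0 ?o) + ennreal \<epsilon>) * ennreal (b - a)"
        using \<epsilon> ab by (simp add: ennreal_mult)
      also have "ennreal (max 0 ?o) = ennreal ?o" by (simp add: max_def ennreal_neg)
      finally show ?thesis .
    qed
    then show "\<exists>d>0. \<forall>a b. 0 \<le> a \<and> a \<le> s \<and> s \<le> b \<and> b \<le> l \<and> b - a < d \<longrightarrow>
      ennreal (rdist \<A> g (f (\<sigma> a)) (f (\<sigma> b)) / M) \<le> (ennreal ?o + ennreal \<epsilon>) * ennreal (b - a)"
      using d(1) by blast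
  qed
qed

end

section \<open>The exit times along a curve\<close>

lemma (in manifold) smooth_real_continuous:
  assumes "smooth_real \<A> f" shows "continuous_on UNIV f"
  unfolding continuous_on_eq_continuous_at[OF open_UNIV]
proof
  fix x
  obtain c where c: "c \<in> \<A>" "x \<in> fst c" by (rule chart_exists)
  have "continuous_on (snd c ` fst c) (f \<circ> chart_inv c)"
    using assms c by (intro smooth_on_imp_continuous_on) (simp add: smooth_real_def)
  from continuous_on_compose[OF continuous_on_chart[OF c(1)] this]
  have "continuous_on (fst c) f"
    by (rule continuous_on_cong[THEN iffD1, rotated -1]) (simp_all add: chart_inverse[OF c(1)])
  then show "isCont f x" using c open_chart by (simp add: continuous_on_eq_continuous_at)
qed

section \<open>Processes evaluated at random times\<close>

definition floor_time :: "nat \<Rightarrow> ereal \<Rightarrow> int" where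
  "floor_time n T = \<lfloor>real (Suc n) * real_of_ereal T\<rfloor>"

text \<open>The random time is approximated from below by multiples of \<open>1 / Suc n\<close>,
  which take countably many values; measurability then follows from measurability at fixed times.
  For continuous paths the limit is the value at the time itself. An infinite time is read as 0 by
  \<open>real_of_ereal\<close>, a case that \<open>exit_variation\<close> discards.\<close>

definition at_random_time :: "(real \<Rightarrow> 'w \<Rightarrow> real) \<Rightarrow> ('w \<Rightarrow> ereal) \<Rightarrow> 'w \<Rightarrow> real" where
  "at_random_time Z T \<omega> = lim (\<lambda>n. Z (max 0 (of_int (floor_time n (T \<omega>)) / real (Suc n))) \<omega>)"

lemma at_random_time_measurable:
  assumes Z: "\<And>t. 0 \<le> t \<Longrightarrow> Z t \<in> borel_measurable P" and T[measurable]: "T \<in> borel_measurable P"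
  shows "at_random_time Z T \<in> borel_measurable P"
proof -
  have "(\<lambda>\<omega>. Z (max 0 (of_int (floor_time n (T \<omega>)) / real (Suc n))) \<omega>) \<in> borel_measurable P" for n
  proof (rule measurable_compose_countable[where f = "\<lambda>i. Z (max 0 (of_int i / real (Suc n)))" and g = "\<lambda>\<omega>. floor_time n (T \<omega>)"])
    show "(\<lambda>\<omega>. floor_time n (T \<omega>)) \<in> P \<rightarrow>\<^sub>M count_space UNIV"
      unfolding floor_time_def by measurable
  qed (rule Z, simp)
  then show ?thesis unfolding at_random_time_def[abs_def] by measurable
qed

lemma at_random_time_eq:
  assumes cont: "continuous_on {0..} (\<lambda>t. Z t \<omega>)" and T: "T \<omega> = ereal t" "0 \<le> t"
  shows "at_random_time Z T \<omega> = Z t \<omega>"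
proof -
  let ?r = "\<lambda>n. max 0 (of_int (floor_time n (T \<omega>)) / real (Suc n))"
  have bounds: "t - 1 / real (Suc n) \<le> ?r n \<and> ?r n \<le> t" for n
  proof -
    have "real_of_int (floor_time n (T \<omega>)) \<le> real (Suc n) * t" "real (Suc n) * t < real_of_int (floor_time n (T \<omega>)) + 1"
      unfolding floor_time_def T by (simp_all del: of_nat_Suc)
    then have "of_int (floor_time n (T \<omega>)) / real (Suc n) \<le> t" "t < (of_int (floor_time n (T \<omega>)) + 1) / real (Suc n)"
      by (simp_all add: pos_divide_le_eq pos_less_divide_eq mult.commute del: of_nat_Suc)
    then have "of_int (floor_time n (T \<omega>)) / real (Suc n) \<le> t" "t - 1 / real (Suc n) \<le> of_int (floor_time n (T \<omega>)) / real (Suc n)"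
      by (simp_all add: add_divide_distrib)
    then show ?thesis using T(2) by auto
  qed
  have "?r \<longlonglongrightarrow> t"
  proof (rule tendsto_sandwich)
    have "(\<lambda>n. 1 / real (Suc n)) \<longlonglongrightarrow> 0" by (rule LIMSEQ_Suc) (rule lim_const_over_n)
    from tendsto_diff[OF tendsto_const this] show "(\<lambda>n. t - 1 / real (Suc n)) \<longlonglongrightarrow> t" by simp
  qed (use bounds in auto)
  then have "(\<lambda>n. Z (?r n) \<omega>) \<longlonglongrightarrow> Z t \<omega>"
    using continuous_on_tendsto_compose[OF cont, of ?r t sequentially] T(2) by simp
  then show ?thesis unfolding at_random_time_def by (rule limI)
qed

section \<open>The flow and the cut-off flows on a common almost sure event\<close>

locale sde_flow = riemannian \<A> g + filtration P \<F>
  for \<A> :: "('a::{t2_space, second_countable_topology}, 'e::euclidean_space) chart set"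
    and g :: "('a, 'e) metric" and P :: "'w measure" and \<F> :: "real \<Rightarrow> 'w measure" +
  fixes B :: "real \<Rightarrow> 'w \<Rightarrow> real ^ 'm::finite"
    and X :: "('a, 'e, 'm) noise_field" and A :: "('a, 'e) field"
    and F :: "real \<Rightarrow> 'a \<Rightarrow> 'w \<Rightarrow> 'a" and \<xi> :: "'a \<Rightarrow> 'w \<Rightarrow> ereal"
    and U :: "nat \<Rightarrow> 'a set" and lam :: "nat \<Rightarrow> 'a \<Rightarrow> real"
    and Fi :: "nat \<Rightarrow> real \<Rightarrow> 'a \<Rightarrow> 'w \<Rightarrow> 'a"
  assumes flow: "partial_flow \<A> g P \<F> B X A F \<xi>"
    and cutoff: "cutoff_system \<A> g P \<F> B X A U lam Fi"
begin

lemma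
  shows U_open: "open (U j)" and U_compact: "compact (closure (U j))"
    and U_closure: "closure (U j) \<subseteq> U (Suc j)" and U_cover: "(\<Union>j. U j) = UNIV"
  using cutoff unfolding cutoff_system_def by blast+

lemma U_mono: "U j \<subseteq> U (Suc j)"
  using U_closure closure_subset by blast

text \<open>The value 1 passes from \<open>U (Suc j)\<close> to its closure by continuity. Since
  \<open>closure (U j)\<close> lies in the open set \<open>U (Suc j)\<close>, the flows can be
  compared on a region larger than the one whose exit is timed, as passing to nearby starting points
  demands.\<close>

lemma lam_eq_1: assumes "z \<in> closure (U (Suc j))" shows "lam j z = 1"
proof -
  have "smooth_real \<A> (lam j)" "\<forall>x\<in>U (j + 1). lam j x = 1"
    using cutoff unfolding cutoff_system_def by blast+
  then have "closed {z. lam j z = 1}" "U (Suc j) \<subseteq> {z. lam j z = 1}"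
    using continuous_closed_preimage_constant[OF smooth_real_continuous closed_UNIV, of "lam j" 1] by auto
  then show ?thesis using closure_minimal[of "U (Suc j)" "{z. lam j z = 1}"] assms by blast
qed

lemma cutoff_flow: "partial_flow \<A> g P \<F> B (\<lambda>x e c. lam i x *\<^sub>R X x e c) (\<lambda>x c. lam i x *\<^sub>R A x c) (Fi i) (\<lambda>x \<omega>. \<infinity>)"
  using cutoff unfolding cutoff_system_def by blast

lemma cutoff_solution: "local_solution \<A> P \<F> B (\<lambda>x e c. lam i x *\<^sub>R X x e c) (\<lambda>x c. lam i x *\<^sub>R A x c) x (\<lambda>t. Fi i t x) (\<lambda>\<omega>. \<infinity>)"
  using cutoff_flow[of i] unfolding partial_flow_def maximal_solution_def by blast

lemma Fi_measurable: assumes "0 \<le> t" shows "Fi i t x \<in> borel_measurable P"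
proof (rule borel_measurableI)
  fix G :: "'a set" assume "open G"
  then have "{\<omega>\<in>space P. ereal t < \<infinity> \<and> Fi i t x \<omega> \<in> G} \<in> sets (augment P \<F> t)"
    using cutoff_solution[of i x] assms unfolding local_solution_def by blast
  then have "{\<omega>\<in>space P. ereal t < \<infinity> \<and> Fi i t x \<omega> \<in> G} \<in> sets P" using augment_subset[OF assms] by blast
  moreover have "{\<omega>\<in>space P. ereal t < \<infinity> \<and> Fi i t x \<omega> \<in> G} = Fi i t x -` G \<inter> space P" by auto
  ultimately show "Fi i t x -` G \<inter> space P \<in> sets P" by simp
qed

lemma AE_pathwise_flow:
  assumes "partial_flow \<A> g P \<F> B X' A' F' \<xi>'"
  shows "AE \<omega> in P. pathwise_flow (\<lambda>t x. F' t x \<omega>) (\<lambda>x. \<xi>' x \<omega>)"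
proof -
  have "AE \<omega> in P. (\<forall>x. 0 < \<xi>' x \<omega> \<and> F' 0 x \<omega> = x) \<and>
        (\<forall>t\<ge>0. open (flow_dom \<xi>' t \<omega>) \<and>
           C1_diffeo_onto_open \<A> (\<lambda>x. F' t x \<omega>) (flow_dom \<xi>' t \<omega>) \<and>
           C1_compact_continuous_at \<A> (\<lambda>s x. F' s x \<omega>) (\<lambda>s. flow_dom \<xi>' s \<omega>) t)"
    using assms unfolding partial_flow_def by blast
  then show ?thesis by (rule eventually_mono) (simp add: pathwise_flow_def flow_dom_def)
qed

text \<open>Agreement is asked for points of \<open>Q\<close> only: each starting point brings its
  own null set, and a countable \<open>Q\<close> keeps the event almost sure.\<close>

definition good_path :: "'a set \<Rightarrow> 'w \<Rightarrow> bool" where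
  "good_path Q \<omega> \<longleftrightarrow> pathwise_flow (\<lambda>t x. F t x \<omega>) (\<lambda>x. \<xi> x \<omega>) \<and>
     (\<forall>j. pathwise_flow (\<lambda>t x. Fi j t x \<omega>) (\<lambda>x. \<infinity>)) \<and>
     (\<forall>j. \<forall>q\<in>Q. \<forall>t s. (\<forall>u. 0 \<le> u \<and> u < t \<longrightarrow> Fi j u q \<omega> \<in> closure (U (Suc j))) \<and> 0 \<le> s \<and> s < t \<longrightarrow>
        F s q \<omega> = Fi j s q \<omega>)"

lemma AE_good_path: assumes "countable Q" shows "AE \<omega> in P. good_path Q \<omega>"
proof -
  have "AE \<omega> in P. \<forall>t s. (\<forall>u. 0 \<le> u \<and> u < t \<longrightarrow> Fi j u q \<omega> \<in> closure (U (Suc j))) \<and> 0 \<le> s \<and> s < t \<longrightarrow>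
        F s q \<omega> = Fi j s q \<omega>" for j q
    by (rule maximal_solution_cutoff[OF _ cutoff_solution closed_closure lam_eq_1])
      (use flow in \<open>unfold partial_flow_def, blast\<close>)
  then have "AE \<omega> in P. \<forall>j. \<forall>q\<in>Q. \<forall>t s. (\<forall>u. 0 \<le> u \<and> u < t \<longrightarrow> Fi j u q \<omega> \<in> closure (U (Suc j))) \<and> 0 \<le> s \<and> s < t \<longrightarrow>
        F s q \<omega> = Fi j s q \<omega>"
    using assms by (simp add: AE_all_countable AE_ball_countable)
  moreover have "AE \<omega> in P. \<forall>j. pathwise_flow (\<lambda>t x. Fi j t x \<omega>) (\<lambda>x. \<infinity>)"
    using AE_pathwise_flow[OF cutoff_flow] by (simp add: AE_all_countable)
  ultimately show ?thesis
    using AE_pathwise_flow[OF flow] by eventually_elim (simp add: good_path_def)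
qed

abbreviation explodes :: "'a set \<Rightarrow> 'a \<Rightarrow> 'w \<Rightarrow> bool" where
  "explodes K x0 \<omega> \<equiv> inf_time \<xi> K \<omega> < \<infinity> \<longrightarrow>
    ((\<lambda>t. SUP x\<in>K. ereal (rdist \<A> g x0 (F t x \<omega>))) \<longlongrightarrow> \<infinity>) (at_left (real_of_ereal (inf_time \<xi> K \<omega>)))"

lemma AE_explodes: "compact K \<Longrightarrow> AE \<omega> in P. explodes K x0 \<omega>"
  using flow unfolding partial_flow_def by blast

lemma exit_time_on_eq:
  "exit_time_on U Fi j K \<omega> = (INF x\<in>K. Inf {ereal t |t. 0 \<le> t \<and> Fi j t x \<omega> \<notin> closure (U j)})"
  by (simp add: exit_time_on_def exit_time_def)

lemma good_path_exit:
  assumes good: "good_path Q \<omega>" and Q: "\<And>X. open X \<Longrightarrow> X \<noteq> {} \<Longrightarrow> \<exists>q\<in>Q. q \<in> X"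
    and K: "compact K" "K \<noteq> {}" and ex: "explodes K x0 \<omega>"
  shows "\<And>s x. 0 \<le> s \<Longrightarrow> ereal s \<le> exit_time_on U Fi j K \<omega> \<Longrightarrow> x \<in> K \<Longrightarrow> ereal s < \<xi> x \<omega> \<and> F s x \<omega> = Fi j s x \<omega>"
    and "0 \<le> exit_time_on U Fi j K \<omega>"
    and "exit_time_on U Fi j K \<omega> < \<infinity> \<Longrightarrow> exit_time_on U Fi j K \<omega> < inf_time \<xi> K \<omega>"
proof -
  have f: "pathwise_flow (\<lambda>t x. F t x \<omega>) (\<lambda>x. \<xi> x \<omega>)" and h: "pathwise_flow (\<lambda>t x. Fi j t x \<omega>) (\<lambda>x. \<infinity>)"
    using good by (simp_all add: good_path_def)
  have agree: "F s q \<omega> = Fi j s q \<omega>"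
    if "q \<in> Q" "\<And>s. 0 \<le> s \<Longrightarrow> s < t \<Longrightarrow> Fi j s q \<omega> \<in> U (Suc j)" "0 \<le> s" "s < t" for q t s
  proof -
    have "\<forall>u. 0 \<le> u \<and> u < t \<longrightarrow> Fi j u q \<omega> \<in> closure (U (Suc j))" using that(2) closure_subset by blast
    then show ?thesis using good that(1,3,4) unfolding good_path_def by blast
  qed
  note * = exit_before_explosion[OF f h U_open Q agree U_compact U_closure K ex[unfolded inf_time_def, rule_format] exit_time_on_eq]
  show "\<And>s x. 0 \<le> s \<Longrightarrow> ereal s \<le> exit_time_on U Fi j K \<omega> \<Longrightarrow> x \<in> K \<Longrightarrow> ereal s < \<xi> x \<omega> \<and> F s x \<omega> = Fi j s x \<omega>"
    by (rule *(1))
  show "0 \<le> exit_time_on U Fi j K \<omega>" by (rule *(2))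
  show "exit_time_on U Fi j K \<omega> < \<infinity> \<Longrightarrow> exit_time_on U Fi j K \<omega> < inf_time \<xi> K \<omega>"
    unfolding inf_time_def by (rule *(3))
qed

lemma good_path_exit_limit:
  assumes good: "good_path Q \<omega>" and Q: "\<And>X. open X \<Longrightarrow> X \<noteq> {} \<Longrightarrow> \<exists>q\<in>Q. q \<in> X"
    and K: "compact K" "K \<noteq> {}" and ex: "explodes K x0 \<omega>"
    and t: "0 \<le> t" "ereal t < inf_time \<xi> K \<omega>"
  shows "\<forall>\<^sub>F j in sequentially. ereal t \<le> exit_time_on U Fi j K \<omega>"
proof (rule exit_times_exhaust[where f = "\<lambda>t x. F t x \<omega>" and \<zeta> = "\<lambda>x. \<xi> x \<omega>" and h = "\<lambda>j t x. Fi j t x \<omega>"])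
  show "pathwise_flow (\<lambda>t x. F t x \<omega>) (\<lambda>x. \<xi> x \<omega>)" "\<And>j. pathwise_flow (\<lambda>t x. Fi j t x \<omega>) (\<lambda>x. \<infinity>)"
    using good by (simp_all add: good_path_def)
  show "ereal t < (INF x\<in>K. \<xi> x \<omega>)" using t(2) by (simp add: inf_time_def)
  show "\<And>j s x. 0 \<le> s \<Longrightarrow> ereal s \<le> exit_time_on U Fi j K \<omega> \<Longrightarrow> x \<in> K \<Longrightarrow> ereal s < \<xi> x \<omega> \<and> F s x \<omega> = Fi j s x \<omega>"
    by (rule good_path_exit(1)[OF good Q K ex])
  show "0 \<le> t" by (rule t(1))
qed (fact U_open U_mono U_cover K(1) exit_time_on_eq)+

end

section \<open>A single curve: measurable exit times and the length at exit\<close>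

locale sde_curve = sde_flow \<A> g P \<F> B X A F \<xi> U lam Fi
  for \<A> :: "('a::{t2_space, second_countable_topology}, 'e::euclidean_space) chart set"
    and g P \<F> and B :: "real \<Rightarrow> 'w \<Rightarrow> real ^ 'm::finite" and X A F \<xi> U lam Fi +
  fixes \<sigma> :: "real \<Rightarrow> 'a" and l :: real and v :: "real \<Rightarrow> ('a, 'e) tvec"
  assumes curve: "C1_curve \<A> l \<sigma> v"
begin

definition K :: "'a set" where "K = \<sigma> ` {0..l}"

abbreviation S :: "nat \<Rightarrow> 'w \<Rightarrow> ereal" where "S j \<equiv> exit_time_on U Fi j K"

lemma l_pos: "0 < l" and \<sigma>_continuous: "continuous_on {0..l} \<sigma>"
  using curve by (simp_all add: C1_curve_def)

lemma K_compact: "compact K" and K_nonempty: "K \<noteq> {}"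
  unfolding K_def using compact_continuous_image[OF \<sigma>_continuous compact_Icc] l_pos by auto

lemma \<sigma>_in_K: "s \<in> {0..l} \<Longrightarrow> \<sigma> s \<in> K" by (simp add: K_def)

definition dense_set :: "'a set" where
  "dense_set = (SOME Q. countable Q \<and> (\<forall>X. open X \<and> X \<noteq> {} \<longrightarrow> (\<exists>q\<in>Q. q \<in> X)))"

lemma dense_set: "countable dense_set" "\<And>X. open X \<Longrightarrow> X \<noteq> {} \<Longrightarrow> \<exists>q\<in>dense_set. q \<in> X"
proof -
  obtain Q :: "'a set" where Q: "countable Q" "\<And>X. open X \<Longrightarrow> X \<noteq> {} \<Longrightarrow> \<exists>q\<in>Q. q \<in> X"
    by (rule countable_dense_setE) blast
  have "countable dense_set \<and> (\<forall>X. open X \<and> X \<noteq> {} \<longrightarrow> (\<exists>q\<in>dense_set. q \<in> X))"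
    unfolding dense_set_def by (rule someI[of _ Q]) (use Q in blast)
  then show "countable dense_set" "\<And>X. open X \<Longrightarrow> X \<noteq> {} \<Longrightarrow> \<exists>q\<in>dense_set. q \<in> X" by blast+
qed

definition typical :: "'w \<Rightarrow> bool" where
  "typical \<omega> \<longleftrightarrow> good_path dense_set \<omega> \<and> explodes K (\<sigma> 0) \<omega>"

lemma AE_typical: "AE \<omega> in P. typical \<omega>"
  using AE_good_path[OF dense_set(1)] AE_explodes[OF K_compact, of "\<sigma> 0"]
  by eventually_elim (simp add: typical_def)

lemma typical_flow:
  assumes "typical \<omega>"
  shows "pathwise_flow (\<lambda>t x. F t x \<omega>) (\<lambda>x. \<xi> x \<omega>)" "pathwise_flow (\<lambda>t x. Fi j t x \<omega>) (\<lambda>x. \<infinity>)"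
  using assms by (simp_all add: typical_def good_path_def)

lemma typical_exit:
  assumes "typical \<omega>"
  shows "\<And>s x. 0 \<le> s \<Longrightarrow> ereal s \<le> S j \<omega> \<Longrightarrow> x \<in> K \<Longrightarrow> ereal s < \<xi> x \<omega> \<and> F s x \<omega> = Fi j s x \<omega>"
    and "0 \<le> S j \<omega>" and "S j \<omega> < \<infinity> \<Longrightarrow> S j \<omega> < inf_time \<xi> K \<omega>"
    and "\<And>t. 0 \<le> t \<Longrightarrow> ereal t < inf_time \<xi> K \<omega> \<Longrightarrow> \<forall>\<^sub>F j in sequentially. ereal t \<le> S j \<omega>"
  using assms good_path_exit[OF _ dense_set(2) K_compact K_nonempty]
    good_path_exit_limit[OF _ dense_set(2) K_compact K_nonempty]
  unfolding typical_def by blast+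

text \<open>A measurable version of \<open>S j\<close>: rational curve parameters and rational times
  make the infimum countable.\<close>

definition S' :: "nat \<Rightarrow> 'w \<Rightarrow> ereal" where
  "S' j \<omega> = (INF s\<in>\<rat> \<inter> {0..l}. rational_exit (closure (U j)) (\<lambda>t. Fi j t (\<sigma> s)) \<omega>)"

lemma S'_measurable [measurable]: "S' j \<in> borel_measurable P"
proof -
  have "rational_exit (closure (U j)) (\<lambda>t. Fi j t x) \<in> borel_measurable P" for x
  proof -
    have m: "{\<omega>\<in>space P. Fi j r x \<omega> \<in> closure (U j)} \<in> sets P" if "0 \<le> r" for r
      using measurable_sets[OF Fi_measurable[OF that] borel_closed[OF closed_closure], of j x "U j"]
      by (simp add: vimage_def Int_def conj_commute)
    \<comment> \<open>The index set of the infimum depends on \<open>\<omega>\<close>; filling in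
      infinity at the other rationals makes it a fixed countable set.\<close>
    have eq: "rational_exit (closure (U j)) (\<lambda>t. Fi j t x) \<omega> =
        (INF r\<in>\<rat> \<inter> {0..}. if Fi j r x \<omega> \<in> closure (U j) then \<infinity> else ereal r)" for \<omega>
      unfolding rational_exit_def
    proof (rule antisym)
      show "(INF r\<in>{r \<in> \<rat>. 0 \<le> r \<and> Fi j r x \<omega> \<notin> closure (U j)}. ereal r) \<le>
          (INF r\<in>\<rat> \<inter> {0..}. if Fi j r x \<omega> \<in> closure (U j) then \<infinity> else ereal r)"
        by (rule INF_greatest) (auto intro: INF_lower)
      show "(INF r\<in>\<rat> \<inter> {0..}. if Fi j r x \<omega> \<in> closure (U j) then \<infinity> else ereal r) \<le>
        (INF r\<in>{r \<in> \<rat>. 0 \<le> r \<and> Fi j r x \<omega> \<notin> closure (U j)}. ereal r)"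
      proof (rule INF_greatest)
        fix r assume "r \<in> {r \<in> \<rat>. 0 \<le> r \<and> Fi j r x \<omega> \<notin> closure (U j)}"
        then show "(INF r\<in>\<rat> \<inter> {0..}. if Fi j r x \<omega> \<in> closure (U j) then \<infinity> else ereal r) \<le> ereal r"
          by (intro INF_lower2[of r]) auto
      qed
    qed
    have "(\<lambda>\<omega>. INF r\<in>\<rat> \<inter> {0..}. if Fi j r x \<omega> \<in> closure (U j) then \<infinity> else ereal r) \<in> borel_measurable P"
      by (intro borel_measurable_INF measurable_If borel_measurable_const m countable_Int1 countable_rat) auto
    then show ?thesis by (simp add: eq[abs_def] cong: measurable_cong)
  qed
  then show ?thesis unfolding S'_def[abs_def]
    by (intro borel_measurable_INF countable_Int1 countable_rat)
qed

text \<open>Being outside \<open>closure (U j)\<close> is an open condition on time and starting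
  point together, so any exit is approximated by exits at slightly later rational times from nearby
  rational parameters.\<close>

lemma S'_eq: assumes "typical \<omega>" shows "S' j \<omega> = S j \<omega>"
proof (rule antisym)
  show "S j \<omega> \<le> S' j \<omega>"
    unfolding S'_def rational_exit_def
  proof (intro INF_greatest)
    fix s r assume s: "s \<in> \<rat> \<inter> {0..l}" and r: "r \<in> {r \<in> \<rat>. 0 \<le> r \<and> Fi j r (\<sigma> s) \<omega> \<notin> closure (U j)}"
    have "S j \<omega> \<le> Inf {ereal t |t. 0 \<le> t \<and> Fi j t (\<sigma> s) \<omega> \<notin> closure (U j)}"
      unfolding exit_time_on_eq by (rule INF_lower) (use s in \<open>auto intro: \<sigma>_in_K\<close>)
    also have "\<dots> \<le> ereal r" using r by (intro Inf_lower) auto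
    finally show "S j \<omega> \<le> ereal r" .
  qed
  show "S' j \<omega> \<le> S j \<omega>"
    unfolding exit_time_on_eq
  proof (intro INF_greatest Inf_greatest)
    fix x u assume "x \<in> K" "u \<in> {ereal t |t. 0 \<le> t \<and> Fi j t x \<omega> \<notin> closure (U j)}"
    then obtain t s where t: "u = ereal t" "0 \<le> t" "Fi j t x \<omega> \<in> - closure (U j)" and s: "s \<in> {0..l}" "x = \<sigma> s"
      by (auto simp: K_def)
    obtain T N where TN: "open T" "t \<in> T" "open N" "x \<in> N"
      "\<And>s y. s \<in> T \<Longrightarrow> 0 \<le> s \<Longrightarrow> y \<in> N \<Longrightarrow> ereal s < \<infinity> \<and> Fi j s y \<omega> \<in> - closure (U j)"
      by (rule pathwise_flow_nbhd[OF typical_flow(2)[OF assms] t(2) _ open_Compl[OF closed_closure] t(3)]) (simp, blast)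
    obtain A where A: "open A" "s \<in> A" "\<And>y. y \<in> {0..l} \<Longrightarrow> y \<in> A \<Longrightarrow> \<sigma> y \<in> N"
      using \<sigma>_continuous[unfolded continuous_on_topological, rule_format, OF s(1) TN(3)] TN(4) s(2) by blast
    obtain d where d: "0 < d" "\<And>y. dist y s < d \<Longrightarrow> y \<in> A" using A(1,2) by (meson open_dist)
    \<comment> \<open>Clipping at 0 and \<open>l\<close> leaves a nonempty open interval even when
      \<open>s\<close> is an endpoint.\<close>
    obtain s' where s': "s' \<in> \<rat>" "max 0 (s - d) < s'" "s' < min l (s + d)"
      using Rats_dense_in_real[of "max 0 (s - d)" "min l (s + d)"] s(1) d(1) l_pos by auto
    have "\<sigma> s' \<in> N" using s' by (intro A(3) d(2)) (auto simp: dist_real_def)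
    show "S' j \<omega> \<le> u"
      unfolding t(1)
    proof (rule ereal_le_epsilon2)
      fix e :: real assume e: "0 < e"
      obtain d' where d': "0 < d'" "\<And>y. dist y t < d' \<Longrightarrow> y \<in> T" using TN(1,2) by (meson open_dist)
      obtain r where r: "r \<in> \<rat>" "t < r" "r < t + min d' e"
        using Rats_dense_in_real[of t "t + min d' e"] e d'(1) by auto
      have "Fi j r (\<sigma> s') \<omega> \<notin> closure (U j)"
        using TN(5)[of r "\<sigma> s'"] d'(2)[of r] r t(2) \<open>\<sigma> s' \<in> N\<close> by (auto simp: dist_real_def)
      then have "rational_exit (closure (U j)) (\<lambda>t. Fi j t (\<sigma> s')) \<omega> \<le> ereal r"
        unfolding rational_exit_def using r t(2) by (intro INF_lower) auto
      moreover have "S' j \<omega> \<le> rational_exit (closure (U j)) (\<lambda>t. Fi j t (\<sigma> s')) \<omega>"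
        unfolding S'_def using s' by (intro INF_lower) auto
      moreover have "ereal r \<le> ereal t + ereal e" using r by simp
      ultimately show "S' j \<omega> \<le> ereal t + ereal e" by (meson order_trans)
    qed
  qed
qed

text \<open>Distances are taken in the cut-off flow, which is defined for all times and measurable
  at each of them; at the exit time they coincide with those in \<open>F\<close>.\<close>

definition Fi_dist :: "nat \<Rightarrow> real \<Rightarrow> real \<Rightarrow> real \<Rightarrow> 'w \<Rightarrow> real" where
  "Fi_dist j a b t \<omega> = rdist \<A> g (Fi j t (\<sigma> a) \<omega>) (Fi j t (\<sigma> b) \<omega>)"

lemma Fi_dist_measurable: assumes "0 \<le> t" shows "Fi_dist j a b t \<in> borel_measurable P"
proof -
  have "(\<lambda>p. case p of (x, y) \<Rightarrow> rdist \<A> g x y) \<in> borel_measurable (borel \<Otimes>\<^sub>M borel)"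
    unfolding borel_prod by (rule borel_measurable_continuous_onI[OF continuous_rdist])
  from measurable_compose[OF measurable_Pair[OF Fi_measurable[OF assms] Fi_measurable[OF assms]] this]
  show ?thesis by (simp add: Fi_dist_def[abs_def])
qed

lemma Fi_dist_continuous: assumes "typical \<omega>" shows "continuous_on {0..} (\<lambda>t. Fi_dist j a b t \<omega>)"
proof -
  have c: "continuous_on {0..} (\<lambda>t. Fi j t x \<omega>)" for x
    using continuous_on_compose2[OF pathwise_flow_continuous[OF typical_flow(2)[OF assms, of j]], of "{0..}" "\<lambda>t. (t, x)"]
    by (simp add: image_subset_iff continuous_on_Pair continuous_on_id continuous_on_const)
  show ?thesis
    using continuous_on_compose2[OF continuous_rdist continuous_on_Pair[OF c[of "\<sigma> a"] c[of "\<sigma> b"]] subset_UNIV]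
    by (simp add: Fi_dist_def)
qed

lemma speed_bound: obtains M where "0 < M" "\<And>s. s \<in> {0..l} \<Longrightarrow> gnorm g (\<sigma> s) (v s) \<le> M"
proof -
  obtain M where M: "\<forall>y\<in>(\<lambda>s. gnorm g (\<sigma> s) (v s)) ` {0..l}. norm y \<le> M"
    using compact_imp_bounded[OF compact_continuous_image[OF gnorm_C1_curve_continuous[OF curve] compact_Icc]]
    unfolding bounded_iff by blast
  have "gnorm g (\<sigma> s) (v s) \<le> max M 1" if "s \<in> {0..l}" for s
    using bspec[OF M imageI[OF that]] by simp
  then show ?thesis by (intro that[of "max M 1"]) auto
qed

text \<open>The increments are the distances at time \<open>S j\<close> between two points of the
  image curve, divided by the speed bound and set to 0 off the event \<open>S j < t\<close>; the
  weights are the operator norms in \<open>bound\<close>. Their variation serves as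
  \<open>Z\<close>, so its expectation is bounded uniformly over all \<open>j\<close> that share the
  constant \<open>C\<close>.\<close>

lemma exit_variation:
  assumes M: "0 < M" "\<And>s. s \<in> {0..l} \<Longrightarrow> gnorm g (\<sigma> s) (v s) \<le> M" and C: "0 \<le> C"
    and bound: "(SUP x\<in>K. \<integral>\<^sup>+ \<omega>.
        ennreal (tangent_opnorm \<A> g (\<lambda>z. F (real_of_ereal (S j \<omega>)) z \<omega>) x) *
        indicator {\<omega>. S j \<omega> < ereal t} \<omega> \<partial>P) \<le> ennreal C"
  obtains Z where "Z \<in> borel_measurable P" "(\<integral>\<^sup>+\<omega>. Z \<omega> \<partial>P) \<le> ennreal (C * l)"
    "AE \<omega> in P. S j \<omega> < ereal t \<longrightarrow> (\<forall>s\<in>{0..l}.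
      ennreal (rdist \<A> g (F (real_of_ereal (S j \<omega>)) (\<sigma> 0) \<omega>) (F (real_of_ereal (S j \<omega>)) (\<sigma> s) \<omega>) / M) \<le> Z \<omega>)"
proof -
  define \<rho> where "\<rho> a b \<omega> = (if S' j \<omega> < ereal t then at_random_time (Fi_dist j a b) (S' j) \<omega> / M else 0)" for a b \<omega>
  define w where "w s \<omega> = ennreal (tangent_opnorm \<A> g (\<lambda>z. F (real_of_ereal (S j \<omega>)) z \<omega>) (\<sigma> s)) *
        indicator {\<omega>. S j \<omega> < ereal t} \<omega>" for s \<omega>
  have \<rho>_eq: "\<rho> a b \<omega> = rdist \<A> g (F (real_of_ereal (S j \<omega>)) (\<sigma> a) \<omega>) (F (real_of_ereal (S j \<omega>)) (\<sigma> b) \<omega>) / M"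
    if "typical \<omega>" "S j \<omega> < ereal t" "a \<in> {0..l}" "b \<in> {0..l}" for a b \<omega>
  proof -
    have "0 \<le> S j \<omega>" "S j \<omega> \<noteq> \<infinity>" using typical_exit(2)[OF that(1)] that(2) by auto
    then obtain u where u: "S j \<omega> = ereal u" "0 \<le> u" by (cases "S j \<omega>") auto
    have "at_random_time (Fi_dist j a b) (S' j) \<omega> = Fi_dist j a b u \<omega>"
      by (rule at_random_time_eq[where Z = "Fi_dist j a b", OF Fi_dist_continuous[OF that(1)] _ u(2)])
        (simp add: S'_eq[OF that(1)] u)
    moreover have "F u (\<sigma> a) \<omega> = Fi j u (\<sigma> a) \<omega>" "F u (\<sigma> b) \<omega> = Fi j u (\<sigma> b) \<omega>"
      using typical_exit(1)[OF that(1) u(2), of j] u(1) \<sigma>_in_K that(3,4) by simp_all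
    ultimately show ?thesis using that(2) by (simp add: \<rho>_def S'_eq[OF that(1)] u(1) Fi_dist_def)
  qed
  have \<rho>_0: "\<rho> a b \<omega> = 0" if "typical \<omega>" "\<not> S j \<omega> < ereal t" for a b \<omega>
    using that by (simp add: \<rho>_def S'_eq)
  have C1: "Ck_map_on (Suc 0) \<A> (\<lambda>z. F (real_of_ereal (S j \<omega>)) z \<omega>) {x. S j \<omega> < \<xi> x \<omega>}" (is ?A)
    and W: "open {x. S j \<omega> < \<xi> x \<omega>}" (is ?B) and im: "\<sigma> ` {0..l} \<subseteq> {x. S j \<omega> < \<xi> x \<omega>}" (is ?C)
    if "typical \<omega>" "S j \<omega> < ereal t" for \<omega>
  proof -
    have "0 \<le> S j \<omega>" "S j \<omega> \<noteq> \<infinity>" using typical_exit(2)[OF that(1)] that(2) by auto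
    then obtain u where u: "S j \<omega> = ereal u" "0 \<le> u" by (cases "S j \<omega>") auto
    show ?A ?B
      using typical_flow(1)[OF that(1)] u unfolding pathwise_flow_def C1_diffeo_onto_open_def by simp_all
    show ?C using typical_exit(1)[OF that(1) u(2), of j] u(1) \<sigma>_in_K by auto
  qed
  interpret random_increments P l \<rho> w C
  proof
    show "0 < l" by (rule l_pos)
    show "0 \<le> C" by (rule C)
  next
    fix a b :: real
    have [measurable]: "at_random_time (Fi_dist j a b) (S' j) \<in> borel_measurable P"
      by (rule at_random_time_measurable[OF Fi_dist_measurable S'_measurable])
    show "\<rho> a b \<in> borel_measurable P" unfolding \<rho>_def[abs_def] by measurable
  next
    show "AE \<omega> in P. \<forall>a b. 0 \<le> a \<and> a \<le> b \<and> b \<le> l \<longrightarrow> 0 \<le> \<rho> a b \<omega>"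
      using AE_typical
    proof eventually_elim
      case (elim \<omega>)
      then show ?case using \<rho>_eq[OF elim] \<rho>_0[OF elim] M(1) rdist_nonneg
        by (cases "S j \<omega> < ereal t") auto
    qed
    show "AE \<omega> in P. \<exists>R. \<forall>a b. 0 \<le> a \<and> a \<le> b \<and> b \<le> l \<longrightarrow> \<rho> a b \<omega> \<le> R * (b - a)"
      using AE_typical
    proof eventually_elim
      case (elim \<omega>)
      show ?case
      proof (cases "S j \<omega> < ereal t")
        case True
        from rdist_C1_image_bounds(1)[OF C1[OF elim True] W[OF elim True] curve im[OF elim True] M]
        show ?thesis using \<rho>_eq[OF elim True] by auto
      next
        case False
        then show ?thesis using \<rho>_0[OF elim False] by (intro exI[of _ 0]) simp
      qed
    qed
    show "AE \<omega> in P. \<forall>a b c. 0 \<le> a \<and> a \<le> b \<and> b \<le> c \<and> c \<le> l \<longrightarrow> \<rho> a c \<omega> \<le> \<rho> a b \<omega> + \<rho> b c \<omega>"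
      using AE_typical
    proof eventually_elim
      case (elim \<omega>)
      show ?case
      proof (cases "S j \<omega> < ereal t")
        case True
        then show ?thesis using \<rho>_eq[OF elim True] M(1) rdist_triangle
          by (auto simp: add_divide_distrib[symmetric] divide_right_mono)
      next
        case False
        then show ?thesis using \<rho>_0[OF elim False] by simp
      qed
    qed
  next
    fix s assume s: "s \<in> {0..l}"
    show "AE \<omega> in P. \<forall>\<epsilon>>0. \<exists>d>0. \<forall>a b. 0 \<le> a \<and> a \<le> s \<and> s \<le> b \<and> b \<le> l \<and> b - a < d \<longrightarrow>
      ennreal (\<rho> a b \<omega>) \<le> (w s \<omega> + ennreal \<epsilon>) * ennreal (b - a)"
      using AE_typical
    proof eventually_elim
      case (elim \<omega>)
      show ?case
      proof (cases "S j \<omega> < ereal t")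
        case True
        have "w s \<omega> = ennreal (tangent_opnorm \<A> g (\<lambda>z. F (real_of_ereal (S j \<omega>)) z \<omega>) (\<sigma> s))"
          using True by (simp add: w_def)
        with rdist_C1_image_bounds(2)[OF C1[OF elim True] W[OF elim True] curve im[OF elim True] M s]
        show ?thesis using \<rho>_eq[OF elim True] by simp
      next
        case False
        then show ?thesis using \<rho>_0[OF elim False] by (auto intro: exI[of _ 1])
      qed
    qed
    have "(\<integral>\<^sup>+\<omega>. w s \<omega> \<partial>P) \<le> (SUP x\<in>K. \<integral>\<^sup>+ \<omega>.
        ennreal (tangent_opnorm \<A> g (\<lambda>z. F (real_of_ereal (S j \<omega>)) z \<omega>) x) *
        indicator {\<omega>. S j \<omega> < ereal t} \<omega> \<partial>P)"
      unfolding w_def by (rule SUP_upper[OF \<sigma>_in_K[OF s]])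
    also note bound
    finally show "(\<integral>\<^sup>+\<omega>. w s \<omega> \<partial>P) \<le> ennreal C" .
  qed
  show ?thesis
  proof (rule that[OF variation_measurable expectation_variation])
    show "AE \<omega> in P. S j \<omega> < ereal t \<longrightarrow> (\<forall>s\<in>{0..l}.
      ennreal (rdist \<A> g (F (real_of_ereal (S j \<omega>)) (\<sigma> 0) \<omega>) (F (real_of_ereal (S j \<omega>)) (\<sigma> s) \<omega>) / M) \<le> variation \<omega>)"
      using AE_typical variation_ge
    proof eventually_elim
      case (elim \<omega>)
      then show ?case using \<rho>_eq[OF elim(1), of 0] l_pos by auto
    qed
  qed
qed

text \<open>Up to the explosion time \<open>T\<close> of the curve, the trajectory of the starting
  point stays within \<open>b0\<close> of \<open>\<sigma> 0\<close>. Shortly before \<open>T\<close>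
  some point of the image is farther away than \<open>b0 + b * M\<close>, hence at least
  \<open>b * M\<close> from the image of the starting point. The exit times of large index fall in
  that last time interval.\<close>

lemma exit_variation_tendsto:
  assumes \<omega>: "typical \<omega>" and start: "\<xi> (\<sigma> 0) \<omega> = \<infinity>" and t: "inf_time \<xi> K \<omega> < ereal t"
    and M: "0 < M" and r: "filterlim r at_top sequentially"
    and Z: "\<And>n. S (r n) \<omega> < ereal t \<Longrightarrow> \<forall>s\<in>{0..l}.
      ennreal (rdist \<A> g (F (real_of_ereal (S (r n) \<omega>)) (\<sigma> 0) \<omega>) (F (real_of_ereal (S (r n) \<omega>)) (\<sigma> s) \<omega>) / M) \<le> Z n"
  shows "liminf Z = \<infinity>"
proof -
  have pos: "0 < inf_time \<xi> K \<omega>"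
    using pathwise_flow_INF_pos[OF typical_flow(1)[OF \<omega>] K_compact] by (simp add: inf_time_def)
  then obtain T where T: "inf_time \<xi> K \<omega> = ereal T" "0 < T" using t by (cases "inf_time \<xi> K \<omega>") auto
  have "continuous_on {0..T} (\<lambda>s. F s (\<sigma> 0) \<omega>)"
    using continuous_on_compose2[OF pathwise_flow_continuous[OF typical_flow(1)[OF \<omega>]], of "{0..T}" "\<lambda>s. (s, \<sigma> 0)"] start
    by (simp add: image_subset_iff continuous_on_Pair continuous_on_id continuous_on_const)
  from compact_continuous_image[OF this compact_Icc]
  obtain b0 where b0: "\<And>y. y \<in> (\<lambda>s. F s (\<sigma> 0) \<omega>) ` {0..T} \<Longrightarrow> rdist \<A> g (\<sigma> 0) y \<le> b0"
    by (rule rdist_bounded_on_compact) blast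
  have "ennreal b \<le> liminf Z" if b: "0 \<le> b" for b
  proof (rule Liminf_bounded)
    have "((\<lambda>t. SUP x\<in>K. ereal (rdist \<A> g (\<sigma> 0) (F t x \<omega>))) \<longlongrightarrow> \<infinity>) (at_left T)"
      using \<omega> T(1) by (simp add: typical_def)
    then have "\<forall>\<^sub>F s in at_left T. ereal (b0 + b * M) < (SUP x\<in>K. ereal (rdist \<A> g (\<sigma> 0) (F s x \<omega>)))"
      by (rule order_tendstoD(1)) simp
    then obtain c where c: "c < T" "\<And>s. c < s \<Longrightarrow> s < T \<Longrightarrow> ereal (b0 + b * M) < (SUP x\<in>K. ereal (rdist \<A> g (\<sigma> 0) (F s x \<omega>)))"
      unfolding eventually_at_left_field by blast
    \<comment> \<open>A nonnegative time between \<open>c\<close> and \<open>T\<close>: exit times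
      from \<open>d\<close> on fall where the distance is large.\<close>
    define d where "d = (max 0 c + T) / 2"
    have d: "0 \<le> d" "c < d" "d < T" using c(1) T(2) by (auto simp: d_def)
    have "\<forall>\<^sub>F j in sequentially. ereal d \<le> S j \<omega>"
      using typical_exit(4)[OF \<omega> d(1)] d(3) T(1) by simp
    then have "\<forall>\<^sub>F n in sequentially. ereal d \<le> S (r n) \<omega>" using r by (rule eventually_compose_filterlim)
    then show "\<forall>\<^sub>F n in sequentially. ennreal b \<le> Z n"
    proof eventually_elim
      case (elim n)
      \<comment> \<open>An infinite exit time is excluded too: all of \<open>K\<close> would survive
        beyond \<open>T\<close>, and by compactness the explosion time would exceed itself.\<close>
      have lt: "S (r n) \<omega> < ereal T"
      proof (cases "S (r n) \<omega> < \<infinity>")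
        case True
        then show ?thesis using typical_exit(3)[OF \<omega>] T(1) by simp
      next
        case False
        have "ereal T \<le> S (r n) \<omega>" using False by simp
        then have "ereal T < \<xi> x \<omega>" if "x \<in> K" for x using typical_exit(1)[OF \<omega> less_imp_le[OF T(2)]] that by blast
        from pathwise_flow_less_INF[OF typical_flow(1)[OF \<omega>] K_compact less_imp_le[OF T(2)] this]
        show ?thesis using T(1) by (simp add: inf_time_def)
      qed
      then obtain u where u: "S (r n) \<omega> = ereal u" "d \<le> u" "u < T" using elim by (cases "S (r n) \<omega>") auto
      have "ereal (b0 + b * M) < (SUP x\<in>K. ereal (rdist \<A> g (\<sigma> 0) (F u x \<omega>)))" using u d by (intro c(2)) auto
      then obtain s where s: "s \<in> {0..l}" "b0 + b * M < rdist \<A> g (\<sigma> 0) (F u (\<sigma> s) \<omega>)"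
        unfolding less_SUP_iff K_def by auto
      have "rdist \<A> g (\<sigma> 0) (F u (\<sigma> 0) \<omega>) \<le> b0" using u d by (intro b0) auto
      then have "b * M \<le> rdist \<A> g (F u (\<sigma> 0) \<omega>) (F u (\<sigma> s) \<omega>)"
        using s(2) rdist_triangle[of "\<sigma> 0" "F u (\<sigma> s) \<omega>" "F u (\<sigma> 0) \<omega>"] by linarith
      then have "b \<le> rdist \<A> g (F u (\<sigma> 0) \<omega>) (F u (\<sigma> s) \<omega>) / M" using M by (simp add: field_simps)
      then have "ennreal b \<le> ennreal (rdist \<A> g (F u (\<sigma> 0) \<omega>) (F u (\<sigma> s) \<omega>) / M)" by (rule ennreal_leI)
      also have "\<dots> \<le> Z n"
      proof -
        have "S (r n) \<omega> < ereal t" using lt t T(1) by (metis less_trans)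
        from Z[OF this] s(1) show ?thesis by (simp add: u(1))
      qed
      finally show ?case .
    qed
  qed
  then have "of_nat n \<le> liminf Z" for n
    using ennreal_of_nat_eq_real_of_nat[of n] by simp
  then show ?thesis
    by (metis ennreal_Ex_less_of_nat infinity_ennreal_def leD top.not_eq_extremum)
qed

lemma curve_complete:
  assumes start: "AE \<omega> in P. \<xi> (\<sigma> 0) \<omega> = \<infinity>"
    and bound: "\<And>t. 0 < t \<Longrightarrow> liminf (\<lambda>j. SUP x\<in>K. \<integral>\<^sup>+ \<omega>.
        ennreal (tangent_opnorm \<A> g (\<lambda>z. F (real_of_ereal (S j \<omega>)) z \<omega>) x) *
        indicator {\<omega>. S j \<omega> < ereal t} \<omega> \<partial>P) < \<infinity>"
  shows "AE \<omega> in P. inf_time \<xi> K \<omega> = \<infinity>"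
proof -
  obtain M where M: "0 < M" "\<And>s. s \<in> {0..l} \<Longrightarrow> gnorm g (\<sigma> s) (v s) \<le> M" by (rule speed_bound) blast
  have "AE \<omega> in P. \<not> inf_time \<xi> K \<omega> < ereal t" if t: "0 < t" for t
  proof -
    define a where "a j = (SUP x\<in>K. \<integral>\<^sup>+ \<omega>.
        ennreal (tangent_opnorm \<A> g (\<lambda>z. F (real_of_ereal (S j \<omega>)) z \<omega>) x) *
        indicator {\<omega>. S j \<omega> < ereal t} \<omega> \<partial>P)" for j
    have "liminf a < \<infinity>" using bound[OF t] by (simp add: a_def[abs_def])
    then obtain N :: nat where N: "liminf a < of_nat N"
      using ennreal_Ex_less_of_nat[of "liminf a"] by auto
    define C where "C = real N"
    have C: "0 \<le> C" "liminf a < ennreal C"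
      using N by (simp_all add: C_def ennreal_of_nat_eq_real_of_nat)
    have "\<exists>\<^sub>F j in sequentially. a j \<le> ennreal C"
    proof (rule ccontr)
      assume "\<not> (\<exists>\<^sub>F j in sequentially. a j \<le> ennreal C)"
      then have "\<forall>\<^sub>F j in sequentially. ennreal C \<le> a j"
        unfolding not_frequently by (rule eventually_mono) simp
      then have "ennreal C \<le> liminf a" by (rule Liminf_bounded)
      with C(2) show False by simp
    qed
    then have inf: "infinite {j. a j \<le> ennreal C}"
      by (simp add: frequently_cofinite cofinite_eq_sequentially[symmetric])
    \<comment> \<open>A finite limit inferior controls only infinitely many \<open>j\<close>;
      enumerating them gives the subsequence.\<close>
    define r where "r = enumerate {j. a j \<le> ennreal C}"
    have r: "a (r n) \<le> ennreal C" for n using enumerate_in_set[OF inf] by (simp add: r_def)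
    have rlim: "filterlim r at_top sequentially"
      unfolding r_def by (rule filterlim_subseq[OF strict_mono_enumerate[OF inf]])
    let ?dominates = "\<lambda>n Z \<omega>. S (r n) \<omega> < ereal t \<longrightarrow> (\<forall>s\<in>{0..l}.
      ennreal (rdist \<A> g (F (real_of_ereal (S (r n) \<omega>)) (\<sigma> 0) \<omega>) (F (real_of_ereal (S (r n) \<omega>)) (\<sigma> s) \<omega>) / M) \<le> Z \<omega>)"
    have "\<forall>n. \<exists>Z. Z \<in> borel_measurable P \<and> (\<integral>\<^sup>+\<omega>. Z \<omega> \<partial>P) \<le> ennreal (C * l) \<and> (AE \<omega> in P. ?dominates n Z \<omega>)"
    proof (intro allI, rule exit_variation[OF M C(1) r[unfolded a_def]])
      fix s assume "s \<in> {0..l}" then show "s \<in> {0..l}" .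
    next
      fix n Z assume "Z \<in> borel_measurable P" "(\<integral>\<^sup>+\<omega>. Z \<omega> \<partial>P) \<le> ennreal (C * l)"
        "AE \<omega> in P. ?dominates n Z \<omega>"
      then show "\<exists>Z. Z \<in> borel_measurable P \<and> (\<integral>\<^sup>+\<omega>. Z \<omega> \<partial>P) \<le> ennreal (C * l) \<and> (AE \<omega> in P. ?dominates n Z \<omega>)"
        by (intro exI[of _ Z] conjI)
    qed
    from choice[OF this] obtain Z where ZA: "\<forall>n. Z n \<in> borel_measurable P \<and> (\<integral>\<^sup>+\<omega>. Z n \<omega> \<partial>P) \<le> ennreal (C * l) \<and>
        (AE \<omega> in P. ?dominates n (Z n) \<omega>)" by (elim exE)
    have Z: "Z n \<in> borel_measurable P" "(\<integral>\<^sup>+\<omega>. Z n \<omega> \<partial>P) \<le> ennreal (C * l)" "AE \<omega> in P. ?dominates n (Z n) \<omega>" for n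
      by (rule conjunct1[OF spec[OF ZA]], rule conjunct1[OF conjunct2[OF spec[OF ZA]]],
          rule conjunct2[OF conjunct2[OF spec[OF ZA]]])
    have "(\<integral>\<^sup>+\<omega>. liminf (\<lambda>n. Z n \<omega>) \<partial>P) \<le> liminf (\<lambda>n. \<integral>\<^sup>+\<omega>. Z n \<omega> \<partial>P)"
      by (rule nn_integral_liminf[OF Z(1)])
    also have "\<dots> \<le> ennreal (C * l)"
      using Z(2) by (intro order_trans[OF Liminf_le_Limsup Limsup_bounded]) auto
    finally have "(\<integral>\<^sup>+\<omega>. liminf (\<lambda>n. Z n \<omega>) \<partial>P) \<noteq> \<infinity>" by (auto simp: top_unique)
    \<comment> \<open>This almost sure finiteness clashes with the value infinity that the limit
      inferior takes on the event of explosion before \<open>t\<close>.\<close>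
    then have "AE \<omega> in P. liminf (\<lambda>n. Z n \<omega>) \<noteq> \<infinity>"
      by (intro nn_integral_noteq_infinite) (use Z(1) in measurable)
    moreover have "AE \<omega> in P. \<forall>n. ?dominates n (Z n) \<omega>"
      using Z(3) by (simp add: AE_all_countable)
    ultimately show ?thesis
      using AE_typical start
    proof eventually_elim
      case (elim \<omega>)
      show ?case
      proof
        assume "inf_time \<xi> K \<omega> < ereal t"
        then have "liminf (\<lambda>n. Z n \<omega>) = \<infinity>"
          by (rule exit_variation_tendsto[OF elim(3,4) _ M(1) rlim]) (rule mp[OF spec[OF elim(2)]])
        with elim(1) show False by blast
      qed
    qed
  qed
  \<comment> \<open>Countably many bounds suffice; \<open>Suc n\<close> keeps them positive.\<close>
  then have "AE \<omega> in P. \<forall>n::nat. \<not> inf_time \<xi> K \<omega> < ereal (real (Suc n))"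
    unfolding AE_all_countable by simp
  then show ?thesis
  proof (rule eventually_mono)
    fix \<omega> assume *: "\<forall>n::nat. \<not> inf_time \<xi> K \<omega> < ereal (real (Suc n))"
    show "inf_time \<xi> K \<omega> = \<infinity>"
    proof (rule ccontr)
      assume "inf_time \<xi> K \<omega> \<noteq> \<infinity>"
      then obtain n :: nat where "inf_time \<xi> K \<omega> < ereal (real n)" using less_PInf_Ex_of_nat by auto
      also have "\<dots> \<le> ereal (real (Suc n))" by simp
      finally show False using * by blast
    qed
  qed
qed

end

section \<open>Simplices and chart balls\<close>

context manifold begin

text \<open>The standard simplex in the real line is [0,1]. The smooth extension to an open
  neighbourhood gives two-sided derivatives, whose coordinates in the charts form the
  velocity.\<close>

lemma smooth_simplex_K11:
  assumes "K \<in> smooth_simplices TYPE(real) \<A>" shows "K \<in> K11 \<A>"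
proof -
  have hull: "convex hull (insert 0 (Basis :: real set)) = {0..1}"
    by (simp add: segment_convex_hull[symmetric] closed_segment_eq_real_ivl)
  obtain \<sigma> W where K: "K = \<sigma> ` {0..1::real}" and W: "open W" "{0..1} \<subseteq> W" "continuous_on W \<sigma>"
    and sm: "\<And>c. c \<in> \<A> \<Longrightarrow> smooth_on (snd c \<circ> \<sigma>) (W \<inter> \<sigma> -` fst c)"
    using assms unfolding smooth_simplices_def hull by blast
  have op: "open (W \<inter> \<sigma> -` fst c)" if "c \<in> \<A>" for c
    using continuous_on_open_vimage[OF W(1)] W(3) open_chart[OF that] by (metis Int_commute)
  define D where "D c t = frechet_derivative (snd c \<circ> \<sigma>) (at t) 1"
    for c :: "('a, 'e) chart" and t :: real
  \<comment> \<open>Coordinates in charts that miss the point are 0, as \<open>tangent_space\<close>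
    demands.\<close>
  define v where "v t c = (if c \<in> \<A> \<and> \<sigma> t \<in> fst c then D c t else 0)" for t c
  have d: "((snd c \<circ> \<sigma>) has_vector_derivative D c t) (at t)" if c: "c \<in> \<A>" "\<sigma> t \<in> fst c" "t \<in> W" for c t
  proof -
    have "((snd c \<circ> \<sigma>) has_derivative frechet_derivative (snd c \<circ> \<sigma>) (at t)) (at t)"
      by (rule Ck_on_1_has_derivative[OF smooth_on_imp_Ck_on[OF sm[OF c(1)]]]) (use c in simp)
    moreover have "frechet_derivative (snd c \<circ> \<sigma>) (at t) = (\<lambda>h. h *\<^sub>R D c t)"
    proof
      fix h show "frechet_derivative (snd c \<circ> \<sigma>) (at t) h = h *\<^sub>R D c t"
        unfolding D_def using linear_scale[OF has_derivative_linear[OF calculation], of h 1] by simp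
    qed
    ultimately show ?thesis by (simp add: has_vector_derivative_def)
  qed
  have "C1_curve \<A> 1 \<sigma> v"
  proof (rule C1_curveI)
    show "(0::real) < 1" by simp
    show "continuous_on {0..1} \<sigma>" by (rule continuous_on_subset[OF W(3,2)])
  next
    fix t :: real assume "t \<in> {0..1}"
    then have t: "t \<in> W" using W(2) by blast
    have tr: "D c' t = transition_deriv c c' (\<sigma> t) (D c t)"
      if c: "c \<in> \<A>" "\<sigma> t \<in> fst c" and c': "c' \<in> \<A>" "\<sigma> t \<in> fst c'" for c c'
    proof -
      have "((snd c' \<circ> chart_inv c) has_derivative transition_deriv c c' (\<sigma> t)) (at ((snd c \<circ> \<sigma>) t))"
        using transition_has_derivative[OF c(1) c'(1) c(2) c'(2)] by simp
      from diff_chain_at[OF d[OF c t, unfolded has_vector_derivative_def] this]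
      have "((\<lambda>s. snd c' (chart_inv c (snd c (\<sigma> s)))) has_vector_derivative transition_deriv c c' (\<sigma> t) (D c t)) (at t)"
        using bounded_linear.linear[OF transition_deriv_linear[OF c(1) c'(1) c(2) c'(2)]]
        by (simp add: has_vector_derivative_def o_def linear_scale)
      moreover have "\<forall>\<^sub>F s in at t. snd c' (chart_inv c (snd c (\<sigma> s))) = (snd c' \<circ> \<sigma>) s"
        using eventually_nhds_in_open[OF op[OF c(1)], of t] c t
        by (auto elim!: eventually_mono simp: chart_inverse[OF c(1)] eventually_nhds_conv_at)
      ultimately have "((snd c' \<circ> \<sigma>) has_vector_derivative transition_deriv c c' (\<sigma> t) (D c t)) (at t)"
        unfolding has_vector_derivative_def
        by (rule has_derivative_transform_eventually)
          (simp_all add: chart_inverse[OF c])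
      from vector_derivative_unique_at[OF d[OF c' t] this] show ?thesis .
    qed
    show "v t \<in> tangent_space \<A> (\<sigma> t)"
    proof -
      obtain c where c: "c \<in> \<A>" "\<sigma> t \<in> fst c" by (rule chart_exists)
      have "v t = tvec_of \<A> c (\<sigma> t) (D c t)"
        using tr[OF c] by (auto simp: v_def tvec_of_def fun_eq_iff)
      then show ?thesis using tvec_of_tangent[OF c] by simp
    qed
    obtain c where c: "c \<in> \<A>" "\<sigma> t \<in> fst c" by (rule chart_exists)
    have "((\<lambda>s. D c s) \<longlongrightarrow> D c t) (at t)"
    proof -
      have "continuous_on (W \<inter> \<sigma> -` fst c) (D c)"
        using smooth_on_imp_Ck_on[OF sm[OF c(1)], of "Suc 0"] by (simp add: D_def[abs_def])
      then have "isCont (D c) t"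
        using op[OF c(1)] c t by (simp add: continuous_on_eq_continuous_at)
      then show ?thesis by (simp add: isCont_def)
    qed
    moreover have "\<forall>\<^sub>F s in at t. D c s = v s c"
      using eventually_nhds_in_open[OF op[OF c(1)], of t] c t
      by (auto elim!: eventually_mono simp: v_def eventually_nhds_conv_at)
    ultimately have "((\<lambda>s. v s c) \<longlongrightarrow> D c t) (at t)" by (rule Lim_transform_eventually)
    then have "((\<lambda>s. v s c) \<longlongrightarrow> D c t) (at t within {0..1})"
      by (rule tendsto_within_subset) simp
    then have "((\<lambda>s. v s c) \<longlongrightarrow> v t c) (at t within {0..1})"
      using c by (simp add: v_def)
    moreover have "((snd c \<circ> \<sigma>) has_vector_derivative v t c) (at t within {0..1})"
      using has_vector_derivative_at_within[OF d[OF c t]] c by (simp add: v_def)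
    ultimately show "\<exists>c\<in>\<A>. \<sigma> t \<in> fst c \<and> ((snd c \<circ> \<sigma>) has_vector_derivative v t c) (at t within {0..1}) \<and>
      ((\<lambda>s. v s c) \<longlongrightarrow> v t c) (at t within {0..1})" using c by blast
  qed
  then show ?thesis unfolding K11_def K by blast
qed

text \<open>The curve only has to cover the sphere and may run through the inside of the ball. In
  dimension two it is the circle; in dimension one \<open>b2\<close> is 0 and the curve sweeps back
  and forth along the segment whose ends are the sphere.\<close>

lemma sphere_subset_K11:
  assumes dim: "DIM('e) \<le> 2" and c: "c \<in> \<A>" and r: "0 < r" "cball p r \<subseteq> snd c ` fst c"
  obtains H where "H \<in> K11 \<A>" "chart_inv c ` sphere p r \<subseteq> H"
proof -
  have "\<exists>b1 b2 :: 'e. (\<forall>t. norm (cos t *\<^sub>R b1 + sin t *\<^sub>R b2) \<le> 1) \<and>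
      (\<forall>u. norm u = 1 \<longrightarrow> (\<exists>x y. u = x *\<^sub>R b1 + y *\<^sub>R b2 \<and> x\<^sup>2 + y\<^sup>2 = 1))"
  proof (cases "DIM('e) = 1")
    case True
    then obtain b :: 'e where b: "Basis = {b}" by (auto simp: card_1_singleton_iff)
    then have nb: "norm b = 1" by (metis insertI1 norm_Basis)
    have "\<exists>x y. u = x *\<^sub>R b + y *\<^sub>R 0 \<and> x\<^sup>2 + y\<^sup>2 = 1" if "norm u = 1" for u :: 'e
    proof -
      have u: "u = (u \<bullet> b) *\<^sub>R b" using euclidean_representation[of u] by (simp add: b)
      then have "\<bar>u \<bullet> b\<bar> = 1" using that nb by (metis mult.right_neutral norm_scaleR)
      then have "(u \<bullet> b)\<^sup>2 + 0\<^sup>2 = 1" by (metis add.right_neutral one_power2 power2_abs zero_power2)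
      with u show ?thesis by (intro exI[of _ "u \<bullet> b"] exI[of _ 0]) simp
    qed
    then show ?thesis using nb by (intro exI[of _ b] exI[of _ 0]) auto
  next
    case False
    then have "DIM('e) = 2" using dim DIM_positive[where 'a = 'e] by linarith
    then obtain b1 b2 :: 'e where b: "Basis = {b1, b2}" "b1 \<noteq> b2" by (auto simp: card_2_iff)
    have B: "b1 \<in> Basis" "b2 \<in> Basis" using b by auto
    have n: "(norm (x *\<^sub>R b1 + y *\<^sub>R b2))\<^sup>2 = x\<^sup>2 + y\<^sup>2" for x y
      unfolding power2_norm_eq_inner
      using B b(2) by (simp add: inner_add_left inner_add_right inner_Basis power2_eq_square)
    have "\<exists>x y. u = x *\<^sub>R b1 + y *\<^sub>R b2 \<and> x\<^sup>2 + y\<^sup>2 = 1" if "norm u = 1" for u :: 'e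
    proof -
      have "(\<Sum>b\<in>{b1, b2}. (u \<bullet> b) *\<^sub>R b) = u" unfolding b(1)[symmetric] by (rule euclidean_representation)
      then have u: "u = (u \<bullet> b1) *\<^sub>R b1 + (u \<bullet> b2) *\<^sub>R b2" using b(2) by simp
      have "(u \<bullet> b1)\<^sup>2 + (u \<bullet> b2)\<^sup>2 = 1" using n[of "u \<bullet> b1" "u \<bullet> b2"] that u by simp
      with u show ?thesis by blast
    qed
    moreover have "norm (cos t *\<^sub>R b1 + sin t *\<^sub>R b2) \<le> 1" for t
      using n[of "cos t" "sin t"] by (simp add: abs_square_eq_1 power2_eq_1_iff)
    ultimately show ?thesis by blast
  qed
  then obtain b1 b2 :: 'e where b: "\<And>t. norm (cos t *\<^sub>R b1 + sin t *\<^sub>R b2) \<le> 1"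
      "\<And>u. norm u = 1 \<Longrightarrow> \<exists>x y. u = x *\<^sub>R b1 + y *\<^sub>R b2 \<and> x\<^sup>2 + y\<^sup>2 = 1" by blast
  define \<gamma> where "\<gamma> t = p + r *\<^sub>R (cos t *\<^sub>R b1 + sin t *\<^sub>R b2)" for t
  have "\<gamma> ` {0..2 * pi} \<subseteq> cball p r"
  proof
    fix q assume "q \<in> \<gamma> ` {0..2 * pi}"
    then obtain t where "q = \<gamma> t" by blast
    then have "dist p q = r * norm (cos t *\<^sub>R b1 + sin t *\<^sub>R b2)" using r(1) by (simp add: \<gamma>_def dist_norm)
    also have "\<dots> \<le> r * 1" using r(1) b(1) by (intro mult_left_mono) auto
    finally show "q \<in> cball p r" by simp
  qed
  then have "C1_curve \<A> (2 * pi) (chart_inv c \<circ> \<gamma>)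
      (\<lambda>t. tvec_of \<A> c (chart_inv c (\<gamma> t)) (r *\<^sub>R (- sin t *\<^sub>R b1 + cos t *\<^sub>R b2)))"
    using r(2) unfolding \<gamma>_def[abs_def]
    by (intro chart_path_C1_curve[OF c]) (auto intro!: derivative_eq_intros continuous_intros simp: has_vector_derivative_def fun_eq_iff scaleR_diff_right mult_ac)
  then have "(chart_inv c \<circ> \<gamma>) ` {0..2 * pi} \<in> K11 \<A>" unfolding K11_def by blast
  moreover have "chart_inv c ` sphere p r \<subseteq> (chart_inv c \<circ> \<gamma>) ` {0..2 * pi}"
  proof
    fix y assume "y \<in> chart_inv c ` sphere p r"
    then obtain q where q: "dist p q = r" "y = chart_inv c q" by auto
    have "norm ((q - p) /\<^sub>R r) = 1" using q(1) r(1) by (simp add: dist_norm norm_minus_commute)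
    from b(2)[OF this] obtain x z where xz: "(q - p) /\<^sub>R r = x *\<^sub>R b1 + z *\<^sub>R b2" "x\<^sup>2 + z\<^sup>2 = 1" by blast
    obtain t where t: "0 \<le> t" "t < 2 * pi" "x = cos t" "z = sin t" using sincos_total_2pi[OF xz(2)] by blast
    have "q = p + r *\<^sub>R ((q - p) /\<^sub>R r)" using r(1) by simp
    then have "q = \<gamma> t" unfolding xz(1) by (simp add: \<gamma>_def t)
    then show "y \<in> (chart_inv c \<circ> \<gamma>) ` {0..2 * pi}" using q(2) t by (intro image_eqI[of _ _ t]) auto
  qed
  ultimately show ?thesis by (rule that)
qed

end

section \<open>A ball whose boundary does not explode\<close>

context riemannian begin

text \<open>The image of the open ball is relatively clopen off the compact set traced out by the sphere.  On a neighbourhood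
  of the frontier of some \<open>U i\<close> it is thus described by one of finitely many patterns, and two images with
  the same pattern agree outside \<open>U i\<close>, because their difference there would be clopen in \<open>M\<close>.\<close>

lemma chart_ball_no_explosion:
  fixes U :: "nat \<Rightarrow> 'a set"
  assumes f: "pathwise_flow f \<zeta>"
    and U: "\<And>j. open (U j)" "\<And>j. compact (closure (U j))" "\<And>j. U j \<subseteq> U (Suc j)" "(\<Union>j. U j) = UNIV"
    and c: "c \<in> \<A>" "x \<in> fst c" and r: "0 < r" "cball (snd c x) r \<subseteq> snd c ` fst c"
    and E: "\<And>y. y \<in> chart_inv c ` sphere (snd c x) r \<Longrightarrow> \<zeta> y = \<infinity>"
    and explosion: "(INF y\<in>chart_inv c ` cball (snd c x) r. \<zeta> y) < \<infinity> \<Longrightarrow>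
      ((\<lambda>t. SUP y\<in>chart_inv c ` cball (snd c x) r. ereal (rdist \<A> g x0 (f t y))) \<longlongrightarrow> \<infinity>)
        (at_left (real_of_ereal (INF y\<in>chart_inv c ` cball (snd c x) r. \<zeta> y)))"
  shows "(INF y\<in>chart_inv c ` cball (snd c x) r. \<zeta> y) = \<infinity>"
proof (rule ccontr)
  let ?B = "chart_inv c ` cball (snd c x) r" and ?E = "chart_inv c ` sphere (snd c x) r" and ?I = "chart_inv c ` ball (snd c x) r"
  assume "(INF y\<in>?B. \<zeta> y) \<noteq> \<infinity>"
  then have fin: "(INF y\<in>?B. \<zeta> y) < \<infinity>" by simp
  note ball = chart_ball[OF c r]
  have "cball (snd c x) r = ball (snd c x) r \<union> sphere (snd c x) r" by auto
  then have BIE: "?B = ?I \<union> ?E" by (simp only: image_Un)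
  have Ec: "compact ?E"
    using sphere_cball[of "snd c x" r] r(2)
    by (intro compact_continuous_image[OF continuous_on_subset[OF continuous_on_chart_inv[OF c(1)]]] compact_sphere) auto
  obtain T where T: "(INF y\<in>?B. \<zeta> y) = ereal T" "0 < T"
    using fin pathwise_flow_INF_pos[OF f ball(4)] by (cases "INF y\<in>?B. \<zeta> y") auto
  have B\<zeta>: "ereal t < \<zeta> y" if "t < T" "y \<in> ?B" for t y
  proof -
    have "ereal t < (INF y\<in>?B. \<zeta> y)" using that T by simp
    also have "\<dots> \<le> \<zeta> y" using that(2) by (rule INF_lower)
    finally show ?thesis .
  qed
  \<comment> \<open>The trace of the sphere up to the time \<open>T\<close>, compact because no
    point of the sphere explodes.\<close>
  define C where "C = (\<lambda>(t, y). f t y) ` ({0..T} \<times> ?E)"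
  have "continuous_on ({0..T} \<times> ?E) (\<lambda>(t, y). f t y)"
    by (rule continuous_on_subset[OF pathwise_flow_continuous[OF f]]) (use E in auto)
  then have C: "compact C" unfolding C_def by (rule compact_continuous_image) (intro compact_Times compact_Icc Ec)
  have EC: "f t y \<in> C" if "0 \<le> t" "t \<le> T" "y \<in> ?E" for t y
    unfolding C_def using that by (intro image_eqI[of _ _ "(t, y)"]) auto
  \<comment> \<open>A point of the sphere at time 0 lies in \<open>C\<close>; it shows later that
    the difference set \<open>Q\<close> is not the whole space.\<close>
  have "sphere (snd c x) r \<noteq> {}" using r(1) by simp
  then obtain e0 where "e0 \<in> ?E" by blast
  then have C_ne: "f 0 e0 \<in> C" using T(2) by (intro EC) auto
  obtain J where J: "finite J" "C \<subseteq> (\<Union>j\<in>J. U j)"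
    by (rule compactE_image[OF C, of UNIV U]) (use U(1,4) in auto)
  define i where "i = Max (insert 0 J)"
  have CU: "C \<subseteq> U i"
  proof
    fix y assume "y \<in> C"
    then obtain j where j: "j \<in> J" "y \<in> U j" using J(2) by blast
    then have "j \<le> i" using J(1) unfolding i_def by simp
    then show "y \<in> U i" using lift_Suc_mono_le[of U j i, OF U(3)] j(2) by blast
  qed
  let ?Fr = "closure (U i) - U i"
  have Fr: "compact ?Fr" by (rule compact_diff[OF U(2,1)])
  \<comment> \<open>Connected neighbourhoods that avoid \<open>C\<close>: no boundary point of the
    image of the ball lies in such a neighbourhood, so that image contains it or misses it.\<close>
  have "\<exists>N. open N \<and> connected N \<and> z \<in> N \<and> N \<inter> C = {}" if "z \<in> ?Fr" for z
  proof -
    obtain d where d: "d \<in> \<A>" "z \<in> fst d" by (rule chart_exists)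
    have "open (- C)" "z \<in> - C" using compact_imp_closed[OF C] that CU by auto
    then obtain q where q: "0 < q" "cball (snd d z) q \<subseteq> snd d ` fst d" "chart_inv d ` cball (snd d z) q \<subseteq> - C"
      by (rule chart_cball[OF d])
    have "chart_inv d ` ball (snd d z) q \<subseteq> chart_inv d ` cball (snd d z) q" by (intro image_mono ball_subset_cball)
    then show ?thesis using chart_ball[OF d q(1,2)] q(3) by (intro exI[of _ "chart_inv d ` ball (snd d z) q"]) auto
  qed
  then have "\<exists>N. \<forall>z\<in>?Fr. open (N z) \<and> connected (N z) \<and> z \<in> N z \<and> N z \<inter> C = {}" by (rule bchoice[rule_format])
  then obtain N where N: "\<And>z. z \<in> ?Fr \<Longrightarrow> open (N z) \<and> connected (N z) \<and> z \<in> N z \<and> N z \<inter> C = {}" by blast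
  obtain Z where Z: "Z \<subseteq> ?Fr" "finite Z" "?Fr \<subseteq> (\<Union>z\<in>Z. N z)"
    by (rule compactE_image[OF Fr, of ?Fr N]) (use N in auto)
  define V where "V t = f t ` ?I" for t
  have cont: "continuous_on {y. ereal t < \<zeta> y} (f t)" and V_open: "open (V t)" and closed: "closed (f t ` ?B)"
    if t: "0 \<le> t" "t < T" for t
  proof -
    let ?D = "{y. ereal t < \<zeta> y}"
    have diffeo: "C1_diffeo_onto_open \<A> (f t) ?D" using f t(1) by (simp add: pathwise_flow_def)
    then show cont: "continuous_on ?D (f t)" unfolding C1_diffeo_onto_open_def Ck_map_on_def by blast
    have inj: "inj_on (f t) ?D" and op: "open (f t ` ?D)" and inv: "continuous_on (f t ` ?D) (inv_into ?D (f t))"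
      using diffeo unfolding C1_diffeo_onto_open_def Ck_map_on_def by blast+
    have sub: "?I \<subseteq> ?D" "?B \<subseteq> ?D" using B\<zeta>[OF t(2)] BIE by auto
    have "V t = inv_into ?D (f t) -` ?I \<inter> f t ` ?D"
      unfolding V_def using sub(1) inv_into_f_f[OF inj] by (auto simp: image_iff)
    then show "open (V t)" using continuous_on_open_vimage[OF op] inv ball(1) by metis
    show "closed (f t ` ?B)"
      by (rule compact_imp_closed[OF compact_continuous_image[OF continuous_on_subset[OF cont sub(2)] ball(4)]])
  qed
  have VE: "f t ` ?B = V t \<union> f t ` ?E" for t unfolding V_def BIE by (rule image_Un)
  have fE: "f t ` ?E \<subseteq> C" if "0 \<le> t" "t < T" for t using EC that by auto
  have dich: "N z \<subseteq> V t" if t: "0 \<le> t" "t < T" and z: "z \<in> Z" "N z \<inter> V t \<noteq> {}" for t z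
  proof (rule ccontr)
    assume "\<not> N z \<subseteq> V t"
    moreover have "N z \<inter> f t ` ?E = {}" using N[of z] z(1) Z(1) fE[OF t] by blast
    moreover have "V t \<inter> - (f t ` ?B) \<inter> N z = {}" using VE[of t] by blast
    moreover have "connected (N z)" using N[of z] z(1) Z(1) by blast
    moreover from calculation(1,2) have "N z \<subseteq> V t \<union> - (f t ` ?B)" "- (f t ` ?B) \<inter> N z \<noteq> {}"
      unfolding VE by blast+
    ultimately show False
      using connectedD[of "N z" "V t" "- (f t ` ?B)", OF _ V_open[OF t] open_Compl[OF closed[OF t]]] z(2)
      by (simp add: Int_commute)
  qed
  \<comment> \<open>A finite set of frontier neighbourhoods has finitely many subsets, so finitely
    many times realise all patterns that occur before \<open>T\<close>.\<close>
  define pat where "pat t = {z\<in>Z. N z \<inter> V t \<noteq> {}}" for t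
  have "finite (pat ` {0..<T})" by (rule finite_subset[of _ "Pow Z"]) (auto simp: pat_def Z(2))
  then obtain R where R: "finite R" "R \<subseteq> {0..<T}" "pat ` {0..<T} = pat ` R"
    by (metis finite_subset_image subset_refl)
  \<comment> \<open>A compact set for all times before \<open>T\<close>: outside \<open>U i\<close>
    the image of the open ball will be contained in its image at one of the finitely many times in
    \<open>R\<close>.\<close>
  define Y where "Y = closure (U i) \<union> (\<Union>s\<in>R. f s ` ?B)"
  have "compact (f s ` ?B)" if "s \<in> R" for s
  proof (rule compact_continuous_image[OF continuous_on_subset[OF cont] ball(4)])
    show "?B \<subseteq> {y. ereal s < \<zeta> y}" using B\<zeta>[of s] that R(2) by auto
  qed (use that R(2) in auto)
  then have Y: "compact Y" unfolding Y_def using R(1) U(2) by (intro compact_Un compact_UN) auto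
  have VY: "V t \<subseteq> Y" if t: "0 \<le> t" "t < T" for t
  proof -
    obtain s where s: "s \<in> R" "pat t = pat s" using R(3) t by (metis atLeastLessThan_iff imageE imageI)
    then have s0: "0 \<le> s" "s < T" using R(2) by auto
    define Q where "Q = V t - V s - U i"
    \<comment> \<open>The sphere is mapped into \<open>U i\<close>, so outside \<open>U i\<close>
      the images of the open and the closed ball coincide; this makes \<open>Q\<close>
      closed.\<close>
    have "Q = f t ` ?B \<inter> - V s \<inter> - U i" unfolding Q_def using VE[of t] fE[OF t] CU by blast
    then have Qc: "closed Q" using closed[OF t] V_open[OF s0] U(1) by auto
    have FrV: "z \<in> V s" if zV: "z \<in> V t" and zF: "z \<in> ?Fr" for z
    proof -
      obtain z' where z': "z' \<in> Z" "z \<in> N z'" using Z(3) zF by blast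
      then have "z' \<in> pat t" using zV by (auto simp: pat_def)
      then have "N z' \<subseteq> V s" using s(2) by (intro dich[OF s0]) (auto simp: pat_def)
      then show ?thesis using z'(2) by blast
    qed
    \<comment> \<open>Frontier points in \<open>V t\<close> are in \<open>V s\<close> by the common
      pattern, so \<open>Q\<close> avoids the frontier and \<open>U i\<close> may be replaced by its
      closure; this makes \<open>Q\<close> open.\<close>
    have "Q = V t \<inter> - (f s ` ?B) \<inter> - closure (U i)"
    proof (rule set_eqI, rule iffI)
      fix z assume z: "z \<in> Q"
      then have "z \<notin> f s ` ?E" using fE[OF s0] CU by (auto simp: Q_def)
      with z have "z \<notin> f s ` ?B" unfolding VE by (simp add: Q_def)
      with z FrV[of z] show "z \<in> V t \<inter> - (f s ` ?B) \<inter> - closure (U i)" by (auto simp: Q_def)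
    next
      fix z assume z: "z \<in> V t \<inter> - (f s ` ?B) \<inter> - closure (U i)"
      then have "z \<notin> U i" using closure_subset by blast
      with z show "z \<in> Q" unfolding VE by (simp add: Q_def)
    qed
    then have Qo: "open Q" using V_open[OF t] closed[OF s0] by auto
    have "Q = {}"
    proof (rule ccontr)
      assume ne: "Q \<noteq> {}"
      have "f 0 e0 \<notin> Q" using C_ne CU by (auto simp: Q_def)
      then show False using connectedD[OF connected Qo open_Compl[OF Qc]] ne by auto
    qed
    then have "V t \<subseteq> V s \<union> U i" by (auto simp: Q_def)
    also have "\<dots> \<subseteq> Y"
    proof (rule Un_least)
      have "V s \<subseteq> f s ` ?B" unfolding VE by (rule Un_upper1)
      also have "\<dots> \<subseteq> (\<Union>s\<in>R. f s ` ?B)" using s(1) by (rule UN_upper)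
      finally show "V s \<subseteq> Y" unfolding Y_def by (rule le_supI2)
      show "U i \<subseteq> Y" unfolding Y_def by (rule le_supI1[OF closure_subset])
    qed
    finally show ?thesis .
  qed
  have BY: "f t y \<in> Y" if "0 \<le> t" "t < T" "y \<in> ?B" for t y
  proof -
    have "f t y \<in> V t \<union> f t ` ?E" using imageI[OF that(3), of "f t"] unfolding VE .
    moreover have "C \<subseteq> Y" unfolding Y_def using CU closure_subset by (intro le_supI1) (rule order_trans)
    ultimately show ?thesis using VY[OF that(1,2)] fE[OF that(1,2)] by blast
  qed
  obtain b where b: "\<And>y. y \<in> Y \<Longrightarrow> rdist \<A> g x0 y \<le> b" using rdist_bounded_on_compact[OF Y] by blast
  have "((\<lambda>t. SUP y\<in>?B. ereal (rdist \<A> g x0 (f t y))) \<longlongrightarrow> \<infinity>) (at_left T)"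
    using explosion[OF fin] T(1) by simp
  then have "\<forall>\<^sub>F t in at_left T. ereal b < (SUP y\<in>?B. ereal (rdist \<A> g x0 (f t y)))"
    by (rule order_tendstoD(1)) simp
  moreover have "\<forall>\<^sub>F t in at_left T. t \<in> {0<..<T}" by (rule eventually_at_left_real[OF T(2)])
  ultimately obtain s where s: "ereal b < (SUP y\<in>?B. ereal (rdist \<A> g x0 (f s y)))" "s \<in> {0<..<T}"
    by (metis (mono_tags, lifting) eventually_conj eventually_happens trivial_limit_at_left_real)
  have "(SUP y\<in>?B. ereal (rdist \<A> g x0 (f s y))) \<le> ereal b"
    using s(2) by (intro SUP_least) (simp add: b BY)
  with s(1) show False by simp
qed

end

section \<open>Nonexplosion along all curves and on the whole manifold\<close>

context sde_flow begin

text \<open>The flow is jointly continuous wherever it is defined, so on \<open>K\<close> only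
  nonexplosion has to be shown.\<close>

lemma complete_onI:
  assumes "AE \<omega> in P. inf_time \<xi> K \<omega> = \<infinity>" shows "complete_on P F \<xi> K"
  unfolding complete_on_def using assms AE_pathwise_flow[OF flow]
proof eventually_elim
  case (elim \<omega>)
  have "\<xi> x \<omega> = \<infinity>" if "x \<in> K" for x
    using elim(1) INF_lower[of x K "\<lambda>x. \<xi> x \<omega>"] that by (simp add: inf_time_def)
  then have "{0..} \<times> K \<subseteq> {(t, x). 0 \<le> t \<and> ereal t < \<xi> x \<omega>}" by auto
  from continuous_on_subset[OF pathwise_flow_continuous[OF elim(2)] this] elim(1) show ?case by simp
qed

lemma K11_no_explosion:
  assumes bound: "\<And>K t. K \<in> K11 \<A> \<Longrightarrow> 0 < t \<Longrightarrow>
      liminf (\<lambda>j. SUP x\<in>K. \<integral>\<^sup>+ \<omega>.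
        ennreal (tangent_opnorm \<A> g (\<lambda>z. F (real_of_ereal (exit_time_on U Fi j K \<omega>)) z \<omega>) x) *
        indicator {\<omega>. exit_time_on U Fi j K \<omega> < ereal t} \<omega> \<partial>P) < \<infinity>"
    and start: "AE \<omega> in P. \<xi> xbar \<omega> = \<infinity>" and H: "H \<in> K11 \<A>"
  shows "AE \<omega> in P. inf_time \<xi> H \<omega> = \<infinity>"
proof -
  have complete: "AE \<omega> in P. inf_time \<xi> (\<sigma> ` {0..l}) \<omega> = \<infinity>"
    if "C1_curve \<A> l \<sigma> v" "AE \<omega> in P. \<xi> (\<sigma> 0) \<omega> = \<infinity>" for \<sigma> l v
  proof -
    interpret sde_curve \<A> g P \<F> B X A F \<xi> U lam Fi \<sigma> l v by unfold_locales (rule that(1))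
    have "K \<in> K11 \<A>" unfolding K_def K11_def using that(1) by blast
    from curve_complete[OF that(2) bound[OF this]] show ?thesis by (simp add: K_def)
  qed
  have point: "AE \<omega> in P. \<xi> p \<omega> = \<infinity>" for p
  proof (rule connected_segment_induct[where R = "\<lambda>p. AE \<omega> in P. \<xi> p \<omega> = \<infinity>", OF start])
    fix \<sigma> v assume \<sigma>: "C1_curve \<A> 1 \<sigma> v" "AE \<omega> in P. \<xi> (\<sigma> 0) \<omega> = \<infinity>"
    show "AE \<omega> in P. \<xi> (\<sigma> 1) \<omega> = \<infinity>"
      using complete[OF \<sigma>]
    proof (rule eventually_mono)
      fix \<omega> assume "inf_time \<xi> (\<sigma> ` {0..1}) \<omega> = \<infinity>"
      moreover have "inf_time \<xi> (\<sigma> ` {0..1}) \<omega> \<le> \<xi> (\<sigma> 1) \<omega>" unfolding inf_time_def by (rule INF_lower) simp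
      ultimately show "\<xi> (\<sigma> 1) \<omega> = \<infinity>" by simp
    qed
  qed
  obtain \<sigma> l v where "H = \<sigma> ` {0..l}" "C1_curve \<A> l \<sigma> v" using H unfolding K11_def by blast
  then show ?thesis using complete point by simp
qed

text \<open>Each point has a coordinate ball that almost surely does not explode, with a null set of
  its own. By the Lindelof property countably many such balls cover the manifold, so one null set
  serves for all points.\<close>

lemma no_explosion_dim_le_2:
  assumes K11: "\<And>H. H \<in> K11 \<A> \<Longrightarrow> AE \<omega> in P. inf_time \<xi> H \<omega> = \<infinity>" and dim: "DIM('e) \<le> 2"
  shows "AE \<omega> in P. inf_time \<xi> UNIV \<omega> = \<infinity>"
proof -
  have "\<exists>N. open N \<and> x \<in> N \<and> (AE \<omega> in P. \<forall>y\<in>N. \<xi> y \<omega> = \<infinity>)" for x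
  proof -
    obtain c where c: "c \<in> \<A>" "x \<in> fst c" by (rule chart_exists)
    obtain r where r: "0 < r" "cball (snd c x) r \<subseteq> snd c ` fst c"
      by (rule chart_cball[OF c open_UNIV UNIV_I])
    obtain H where H: "H \<in> K11 \<A>" "chart_inv c ` sphere (snd c x) r \<subseteq> H"
      by (rule sphere_subset_K11[OF dim c(1) r])
    let ?B = "chart_inv c ` cball (snd c x) r"
    note ball = chart_ball[OF c r]
    have "AE \<omega> in P. \<forall>y\<in>chart_inv c ` ball (snd c x) r. \<xi> y \<omega> = \<infinity>"
      using K11[OF H(1)] AE_explodes[OF ball(4), of x] AE_pathwise_flow[OF flow]
    proof eventually_elim
      case (elim \<omega>)
      have E: "\<xi> y \<omega> = \<infinity>" if "y \<in> chart_inv c ` sphere (snd c x) r" for y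
        using elim(1) INF_lower[of y H "\<lambda>x. \<xi> x \<omega>"] that H(2) by (auto simp: inf_time_def)
      have "(INF y\<in>?B. \<xi> y \<omega>) = \<infinity>"
        by (rule chart_ball_no_explosion[OF elim(3) U_open U_compact U_mono U_cover c r E
              elim(2)[unfolded inf_time_def, rule_format]])
      moreover have "(INF y\<in>?B. \<xi> y \<omega>) \<le> \<xi> y \<omega>" if "y \<in> chart_inv c ` ball (snd c x) r" for y
        using that ball_subset_cball by (intro INF_lower) blast
      ultimately show ?case by auto
    qed
    with ball(1,2) show ?thesis by blast
  qed
  then have "\<forall>x. \<exists>N. open N \<and> x \<in> N \<and> (AE \<omega> in P. \<forall>y\<in>N. \<xi> y \<omega> = \<infinity>)" by blast
  from choice[OF this] obtain N where N: "\<forall>x. open (N x) \<and> x \<in> N x \<and> (AE \<omega> in P. \<forall>y\<in>N x. \<xi> y \<omega> = \<infinity>)" ..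
  obtain \<N> where \<N>: "\<N> \<subseteq> range N" "countable \<N>" "\<Union>\<N> = \<Union>(range N)"
    by (rule Lindelof[of "range N"]) (use N in auto)
  have "AE \<omega> in P. \<forall>M\<in>\<N>. \<forall>y\<in>M. \<xi> y \<omega> = \<infinity>"
    using \<N>(1,2) N by (subst AE_ball_countable) auto
  then show ?thesis
  proof (rule eventually_mono)
    fix \<omega> assume *: "\<forall>M\<in>\<N>. \<forall>y\<in>M. \<xi> y \<omega> = \<infinity>"
    have "\<xi> y \<omega> = \<infinity>" for y
    proof -
      have "y \<in> \<Union>(range N)" using N by blast
      then show ?thesis using * \<N>(3) by blast
    qed
    then show "inf_time \<xi> UNIV \<omega> = \<infinity>" by (simp add: inf_time_def)
  qed
qed

end

theorem theorem3p1:
  fixes \<A> :: "('a::{t2_space, second_countable_topology}, 'e::euclidean_space) chart set"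
    and g :: "('a, 'e) metric"
    and P :: "'w measure" and \<F> :: "real \<Rightarrow> 'w measure"
    and B :: "real \<Rightarrow> 'w \<Rightarrow> real ^ 'm::finite"
    and X :: "('a, 'e, 'm) noise_field" and A :: "('a, 'e) field"
    and F :: "real \<Rightarrow> 'a \<Rightarrow> 'w \<Rightarrow> 'a" and \<xi> :: "'a \<Rightarrow> 'w \<Rightarrow> ereal"
    and U :: "nat \<Rightarrow> 'a set" and lam :: "nat \<Rightarrow> 'a \<Rightarrow> real"
    and Fi :: "nat \<Rightarrow> real \<Rightarrow> 'a \<Rightarrow> 'w \<Rightarrow> 'a"
    and xbar :: 'a
  assumes manifold: "smooth_manifold \<A>" "connected (UNIV :: 'a set)"
    and riemannian: "riemannian_metric \<A> g" "riemannian_complete \<A> g"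
    and noise: "filtered_prob_space P \<F>" "brownian_motion P \<F> B"
    and coefficients: "C2_coefficients \<A> X A"
    and flow: "partial_flow \<A> g P \<F> B X A F \<xi>"
    and cutoff: "cutoff_system \<A> g P \<F> B X A U lam Fi"
    and nonexplosion: "AE \<omega> in P. \<xi> xbar \<omega> = \<infinity>"
    and bound: "\<And>K t. K \<in> K11 \<A> \<Longrightarrow> 0 < t \<Longrightarrow>
      liminf (\<lambda>j. SUP x\<in>K. \<integral>\<^sup>+ \<omega>.
        ennreal (tangent_opnorm \<A> g (\<lambda>z. F (real_of_ereal (exit_time_on U Fi j K \<omega>)) z \<omega>) x) *
        indicator {\<omega>. exit_time_on U Fi j K \<omega> < ereal t} \<omega> \<partial>P) < \<infinity>"
  shows "(\<forall>H\<in>K11 \<A>. AE \<omega> in P. inf_time \<xi> H \<omega> = \<infinity>) \<and>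
    strongly_p_complete TYPE(real) \<A> P F \<xi> \<and>
    (DIM('e) \<le> 2 \<longrightarrow> strongly_complete P F \<xi>)"
proof -
  interpret sde_flow \<A> g P \<F> B X A F \<xi> U lam Fi
    by unfold_locales (fact manifold riemannian(1) noise(1) flow cutoff)+
  have K11: "AE \<omega> in P. inf_time \<xi> H \<omega> = \<infinity>" if "H \<in> K11 \<A>" for H
    by (rule K11_no_explosion[OF _ nonexplosion that]) (rule bound)
  have "strongly_p_complete TYPE(real) \<A> P F \<xi>"
    unfolding strongly_p_complete_def by (intro ballI complete_onI K11 smooth_simplex_K11)
  moreover have "strongly_complete P F \<xi>" if "DIM('e) \<le> 2"
    unfolding strongly_complete_def by (intro complete_onI no_explosion_dim_le_2 K11 that)
  ultimately show ?thesis using K11 by blast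
qed

end
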